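(* Work over $\mathbb C$. The correspondence $(A,R)\mapsto(({\mathcal A},{\mathcal R}),u)$ described in the context, between triangular Hopf algebras with Drinfeld element $u$ satisfying $u^2=1$ and pairs consisting of a triangular Hopf superalgebra with Drinfeld element $1$ and a grouplike element $g$ with $g^2=1$ acting by parity, restricts to a one-to-one correspondence between: (1) isomorphism classes of ordinary triangular Hopf algebras with $R$-matrix of rank $\le 2$, and (2) isomorphism classes of pairs $({\mathcal A},g)$ where ${\mathcal A}$ is a cocommutative Hopf superalgebra and $g$ is a grouplike element of ${\mathcal A}$ such that $g^2=1$ and $gxg^{-1}=(-1)^{p(x)}x$ for all homogeneous $x\in{\mathcal A}$.
   Context: A Hopf superalgebra is a Hopf algebra in the symmetric tensor category of $\mathbb Z_2$-graded complex vector spaces with symmetry $\beta(v\otimes w)=(-1)^{p(v)p(w)}w\otimes v$, $p$ denoting parity; in particular $(a\otimes b)(a'\otimes b')=(-1)^{p(a')p(b)}aa'\otimes bb'$ in a tensor product. It is cocommutative if $\Delta=\beta\circ\Delta$. A triangular Hopf (super)algebra $(A,R)$ has an invertible (even, in the super case) $R\in A\otimes A$ with $(\Delta\otimes \mathrm{Id})(R)=R_{13}R_{23}$, $(\mathrm{Id}\otimes\Delta)(R)=R_{13}R_{12}$, $\Delta^{cop}(a)R=R\Delta(a)$, $R^{-1}=R_{21}$ (in the super case all interpreted with $\beta$ in place of the flip). The Drinfeld element is $u=m\circ\beta\circ(\mathrm{Id}\otimes S)(R)$ (with $\beta$ the ordinary flip in the non-super case, i.e. $u=\sum_i S(b_i)a_i$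 for $R=\sum a_i\otimes b_i$). For a grouplike $u$ with $u^2=1$ put $R_u:=\frac12(1\otimes 1+1\otimes u+u\otimes1-u\otimes u)$. The rank of $R$ is the dimension of the Hopf subalgebra generated by the tensorands of $R$ (written in the shortest possible way); rank $\le 2$ means $R=R_u$ for a grouplike $u$ of order $\le 2$, and then $u$ is the Drinfeld element. The correspondence: let $(A,R)$ be a triangular Hopf algebra with Drinfeld element $u$, $u^2=1$. Grade $A=A_0\oplus A_1$ by the $\pm1$-eigenspaces of $\mathrm{Ad}(u)$, and write $\Delta(a)=\Delta_0(a)+\Delta_1(a)$ with $\Delta_i(a)\in A\otimes A_i$, and $R=R_0+R_1$ with $R_i\in A_i\otimes A_i$. Let ${\mathcal A}=A$ as a superalgebra, with coproduct $\tilde\Delta(a)=\Delta_0(a)-(-1)^{p(a)}(u\otimes 1)\Delta_1(a)$, the same counit, antipode $\tilde S(a)=u^{p(a)}S(a)$, and ${\mathcal R}=(R_0+(1\otimes u)R_1)R_u$. The image of $(A,R)$ is the pair $(({\mathcal A},{\mathcal R}),g)$ with $g=u$. The inverse sends $(({\mathcal A},{\mathcal R}),g)$ to $A={\mathcal A}$ as an algebra with $\Delta(a)=\tilde\Delta_0(a)-(-1)^{p(a)}(g\otimes1)\tilde\Delta_1(a)$, $S(a)=g^{p(a)}\tilde S(a)$, $R=({\mathcal R}_0+(1\otimes g){\mathcal R}_1)R_g$. In the claim, a cocommutative Hopf superalgebra is regarded as triangular with ${\mathcal R}=1\otimes 1$. *)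

theory Defs
  imports Complex_Main "HOL-Library.Poly_Mapping" "HOL-Library.Z2" "HOL-Library.Extended_Nat"
begin

section \<open>Complex vector spaces\<close>

class complex_vector = ab_group_add +
  fixes scaleC :: "complex \<Rightarrow> 'a \<Rightarrow> 'a"  (infixr \<open>*\<^sub>C\<close> 75)
  assumes scaleC_add_right: "c *\<^sub>C (x + y) = c *\<^sub>C x + c *\<^sub>C y"
    and scaleC_add_left: "(c + d) *\<^sub>C x = c *\<^sub>C x + d *\<^sub>C x"
    and scaleC_scaleC: "c *\<^sub>C d *\<^sub>C x = (c * d) *\<^sub>C x"
    and scaleC_one: "1 *\<^sub>C x = x"

global_interpretation complex_vector: vector_space "scaleC :: complex \<Rightarrow> 'a \<Rightarrow> 'a::complex_vector"
  by unfold_locales (simp_all add: scaleC_add_right scaleC_add_left scaleC_scaleC scaleC_one)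

instantiation complex :: complex_vector
begin

definition scaleC_complex :: "complex \<Rightarrow> complex \<Rightarrow> complex"
  where "scaleC_complex c x = c * x"

instance
  by standard (simp_all add: scaleC_complex_def algebra_simps)

end

instantiation poly_mapping :: (type, complex_vector) complex_vector
begin

definition scaleC_poly_mapping :: "complex \<Rightarrow> ('a \<Rightarrow>\<^sub>0 'b) \<Rightarrow> ('a \<Rightarrow>\<^sub>0 'b)"
  where "scaleC_poly_mapping c = Poly_Mapping.map (scaleC c)"

lemma lookup_scaleC: "Poly_Mapping.lookup (c *\<^sub>C p) k = c *\<^sub>C Poly_Mapping.lookup p k"
  unfolding scaleC_poly_mapping_def by (simp add: map.rep_eq when_def)

instance
  by standard
    (auto intro!: poly_mapping_eqI
      simp: lookup_scaleC lookup_add scaleC_add_right scaleC_add_left scaleC_scaleC scaleC_one)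

end

definition clinear :: "('a::complex_vector \<Rightarrow> 'b::complex_vector) \<Rightarrow> bool"
  where "clinear f \<longleftrightarrow> Vector_Spaces.linear scaleC scaleC f"

lemma clinear_iff:
  "clinear f \<longleftrightarrow> (\<forall>x y. f (x + y) = f x + f y) \<and> (\<forall>c x. f (c *\<^sub>C x) = c *\<^sub>C f x)"
  unfolding clinear_def
  by (simp add: Vector_Spaces.linear_iff complex_vector.vector_space_axioms)

definition cbilinear :: "('a::complex_vector \<Rightarrow> 'b::complex_vector \<Rightarrow> 'c::complex_vector) \<Rightarrow> bool"
  where "cbilinear f \<longleftrightarrow> (\<forall>a. clinear (\<lambda>b. f a b)) \<and> (\<forall>b. clinear (\<lambda>a. f a b))"


section \<open>Tensor products\<close>

definition tensor_relators :: "('a::complex_vector \<times> 'b::complex_vector \<Rightarrow>\<^sub>0 complex) set"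
  where "tensor_relators =
    {Poly_Mapping.single (a + a', b) 1 - Poly_Mapping.single (a, b) 1 - Poly_Mapping.single (a', b) 1 | a a' b. True}
    \<union> {Poly_Mapping.single (a, b + b') 1 - Poly_Mapping.single (a, b) 1 - Poly_Mapping.single (a, b') 1 | a b b'. True}
    \<union> {Poly_Mapping.single (c *\<^sub>C a, b) 1 - c *\<^sub>C Poly_Mapping.single (a, b) 1 | c a b. True}
    \<union> {Poly_Mapping.single (a, c *\<^sub>C b) 1 - c *\<^sub>C Poly_Mapping.single (a, b) 1 | c a b. True}"

quotient_type (overloaded) ('a, 'b) tensor =
  "('a::complex_vector \<times> 'b::complex_vector) \<Rightarrow>\<^sub>0 complex" /
  "\<lambda>s t. s - t \<in> complex_vector.span tensor_relators"
proof (rule equivpI)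
  show "reflp (\<lambda>s t. s - t \<in> complex_vector.span (tensor_relators :: ('a \<times> 'b \<Rightarrow>\<^sub>0 complex) set))"
    by (auto intro!: reflpI simp: complex_vector.span_zero)
  show "symp (\<lambda>s t. s - t \<in> complex_vector.span (tensor_relators :: ('a \<times> 'b \<Rightarrow>\<^sub>0 complex) set))"
    by (rule sympI) (use complex_vector.span_neg in fastforce)
  show "transp (\<lambda>s t. s - t \<in> complex_vector.span (tensor_relators :: ('a \<times> 'b \<Rightarrow>\<^sub>0 complex) set))"
    by (rule transpI) (use complex_vector.span_add in fastforce)
qed

instantiation tensor :: (complex_vector, complex_vector) complex_vector
begin

lift_definition zero_tensor :: "('a, 'b) tensor" is 0 .

lift_definition plus_tensor :: "('a, 'b) tensor \<Rightarrow> ('a, 'b) tensor \<Rightarrow> ('a, 'b) tensor" is "(+)"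
  unfolding add_diff_add by (rule complex_vector.span_add)

lift_definition uminus_tensor :: "('a, 'b) tensor \<Rightarrow> ('a, 'b) tensor" is uminus
  unfolding minus_diff_minus by (rule complex_vector.span_neg)

lift_definition minus_tensor :: "('a, 'b) tensor \<Rightarrow> ('a, 'b) tensor \<Rightarrow> ('a, 'b) tensor" is "(-)"
proof -
  fix s s' t t' :: "'a \<times> 'b \<Rightarrow>\<^sub>0 complex"
  assume "s - s' \<in> complex_vector.span tensor_relators" "t - t' \<in> complex_vector.span tensor_relators"
  then have "(s - s') - (t - t') \<in> complex_vector.span tensor_relators"
    by (rule complex_vector.span_diff)
  moreover have "(s - s') - (t - t') = (s - t) - (s' - t')"
    by (simp add: algebra_simps)
  ultimately show "(s - t) - (s' - t') \<in> complex_vector.span tensor_relators"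
    by simp
qed

lift_definition scaleC_tensor :: "complex \<Rightarrow> ('a, 'b) tensor \<Rightarrow> ('a, 'b) tensor" is scaleC
  unfolding complex_vector.scale_right_diff_distrib[symmetric] by (rule complex_vector.span_scale)

instance
  by standard
    (transfer; simp add: scaleC_add_right scaleC_add_left scaleC_scaleC
      complex_vector.span_zero)+

end

lift_definition pure_tensor :: "'a::complex_vector \<Rightarrow> 'b::complex_vector \<Rightarrow> ('a, 'b) tensor"
    (infixl \<open>\<otimes>\<close> 75)
  is "\<lambda>a b. Poly_Mapping.single (a, b) 1" .

text \<open>The linear map on the tensor product that corresponds to a bilinear map; meaningful only
  for bilinear maps, for which it is characterized below.\<close>

definition tensor_lift ::
    "('a::complex_vector \<Rightarrow> 'b::complex_vector \<Rightarrow> 'c::complex_vector) \<Rightarrow> ('a, 'b) tensor \<Rightarrow> 'c"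
  where "tensor_lift f = (THE h. clinear h \<and> (\<forall>a b. h (a \<otimes> b) = f a b))"

lemma tensor_lift_unique:
  fixes g h :: "('a::complex_vector, 'b::complex_vector) tensor \<Rightarrow> 'c::complex_vector"
  assumes "clinear g" "clinear h" and eq: "\<And>a b. g (a \<otimes> b) = h (a \<otimes> b)"
  shows "g = h"
proof
  fix t :: "('a, 'b) tensor"
  obtain p where t: "t = abs_tensor p"
    using tensor.abs_induct[of "\<lambda>t. \<exists>p. t = abs_tensor p"] by blast
  have "g (abs_tensor p) = h (abs_tensor p)"
  proof (induction "card (Poly_Mapping.keys p)" arbitrary: p)
    case 0
    then have "abs_tensor p = 0"
      by (simp add: zero_tensor_def)
    then show ?case
      using assms(1,2)[unfolded clinear_iff] by (metis complex_vector.scale_zero_left)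
  next
    case (Suc n)
    from Suc(2) have "Poly_Mapping.keys p \<noteq> {}"
      by (metis card.empty nat.distinct(1))
    then obtain k where k: "k \<in> Poly_Mapping.keys p"
      by blast
    let ?s = "Poly_Mapping.single k (Poly_Mapping.lookup p k)"
    have "Poly_Mapping.keys (p - ?s) = Poly_Mapping.keys p - {k}"
      by (auto simp: in_keys_iff lookup_minus lookup_single when_def split: if_splits)
    then have IH: "g (abs_tensor (p - ?s)) = h (abs_tensor (p - ?s))"
      using Suc k by (intro Suc(1)) simp
    have "?s = Poly_Mapping.lookup p k *\<^sub>C Poly_Mapping.single k 1"
      by (auto intro!: poly_mapping_eqI simp: lookup_scaleC lookup_single when_def scaleC_complex_def)
    then have "p = (p - ?s) + Poly_Mapping.lookup p k *\<^sub>C Poly_Mapping.single (fst k, snd k) 1"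
      by simp
    then have "abs_tensor p = abs_tensor (p - ?s) + Poly_Mapping.lookup p k *\<^sub>C (fst k \<otimes> snd k)"
      by (metis plus_tensor.abs_eq scaleC_tensor.abs_eq pure_tensor.abs_eq)
    then show ?case
      using assms IH by (simp add: clinear_iff)
  qed
  then show "g t = h t"
    by (simp add: t)
qed

context
  fixes f :: "'a::complex_vector \<Rightarrow> 'b::complex_vector \<Rightarrow> 'c::complex_vector"
begin

private definition extend :: "('a \<times> 'b \<Rightarrow>\<^sub>0 complex) \<Rightarrow> 'c"
  where "extend p = (\<Sum>k\<in>Poly_Mapping.keys p. Poly_Mapping.lookup p k *\<^sub>C f (fst k) (snd k))"

private lemma extend_superset:
  assumes "finite K" "Poly_Mapping.keys p \<subseteq> K"
  shows "extend p = (\<Sum>k\<in>K. Poly_Mapping.lookup p k *\<^sub>C f (fst k) (snd k))"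
  unfolding extend_def by (rule sum.mono_neutral_left) (use assms in \<open>auto simp: in_keys_iff\<close>)

private lemma extend_add: "extend (p + q) = extend p + extend q"
proof -
  let ?K = "Poly_Mapping.keys p \<union> Poly_Mapping.keys q"
  have "Poly_Mapping.keys (p + q) \<subseteq> ?K"
    by (rule keys_add)
  then show ?thesis
    by (simp add: extend_superset[of ?K] lookup_add scaleC_add_left sum.distrib)
qed

private lemma extend_scale: "extend (c *\<^sub>C p) = c *\<^sub>C extend p"
proof -
  have "Poly_Mapping.keys (c *\<^sub>C p) \<subseteq> Poly_Mapping.keys p"
    by (auto simp: in_keys_iff lookup_scaleC scaleC_complex_def)
  then show ?thesis
    by (simp add: extend_superset[of "Poly_Mapping.keys p"] lookup_scaleC scaleC_complex_def
        complex_vector.scale_sum_right)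
qed

private lemma extend_single: "extend (Poly_Mapping.single (a, b) 1) = f a b"
  by (simp add: extend_def)

private lemma extend_diff: "extend (p - q) = extend p - extend q"
  using extend_add[of "p - q" q] by simp

private lemma extend_relators:
  assumes "cbilinear f" and "p \<in> complex_vector.span tensor_relators"
  shows "extend p = 0"
proof -
  have "extend ` tensor_relators \<subseteq> {0}"
    using assms(1)
    by (auto simp: tensor_relators_def cbilinear_def clinear_iff extend_diff extend_scale extend_single)
  then have "tensor_relators \<subseteq> {p. extend p = 0}"
    by auto
  moreover have "complex_vector.subspace {p. extend p = 0}"
    using extend_scale[of 0 0] by (auto simp: complex_vector.subspace_def extend_add extend_scale)
  ultimately have "complex_vector.span tensor_relators \<subseteq> {p. extend p = 0}"
    by (rule complex_vector.span_minimal)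
  then show ?thesis
    using assms(2) by auto
qed

lemma tensor_lift:
  assumes "cbilinear f"
  shows clinear_tensor_lift: "clinear (tensor_lift f)"
    and tensor_lift_pure: "tensor_lift f (a \<otimes> b) = f a b"
proof -
  define h where "h = (\<lambda>t. extend (rep_tensor t))"
  have abs: "h (abs_tensor p) = extend p" for p
  proof -
    have "rep_tensor (abs_tensor p) - p \<in> complex_vector.span tensor_relators"
      using rep_abs_rsp_left[OF Quotient3_tensor, of p p] by (simp add: complex_vector.span_zero)
    from extend_relators[OF assms this] show ?thesis
      by (simp add: h_def extend_diff)
  qed
  have h: "clinear h \<and> (\<forall>a b. h (a \<otimes> b) = f a b)"
  proof (intro conjI allI)
    have "h (s + t) = h s + h t" for s t
      by (induction s rule: tensor.abs_induct; induction t rule: tensor.abs_induct)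
        (simp add: plus_tensor.abs_eq abs extend_add)
    moreover have "h (c *\<^sub>C t) = c *\<^sub>C h t" for c t
      by (induction t rule: tensor.abs_induct) (simp add: scaleC_tensor.abs_eq abs extend_scale)
    ultimately show "clinear h"
      by (simp add: clinear_iff)
    show "h (a \<otimes> b) = f a b" for a b
      by (simp add: pure_tensor.abs_eq abs extend_single)
  qed
  have "clinear (tensor_lift f) \<and> (\<forall>a b. tensor_lift f (a \<otimes> b) = f a b)"
    unfolding tensor_lift_def by (rule theI[of _ h]) (use h in \<open>auto intro: tensor_lift_unique\<close>)
  then show "clinear (tensor_lift f)" "tensor_lift f (a \<otimes> b) = f a b"
    by auto
qed

end

definition tensor_map :: "('a::complex_vector \<Rightarrow> 'c::complex_vector) \<Rightarrow> ('b::complex_vector \<Rightarrow> 'd::complex_vector)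
    \<Rightarrow> ('a, 'b) tensor \<Rightarrow> ('c, 'd) tensor"
  where "tensor_map f g = tensor_lift (\<lambda>a b. f a \<otimes> g b)"

definition tensor_flip :: "('a::complex_vector, 'b::complex_vector) tensor \<Rightarrow> ('b, 'a) tensor"
  where "tensor_flip = tensor_lift (\<lambda>a b. b \<otimes> a)"

definition tensor_assoc :: "(('a::complex_vector, 'b::complex_vector) tensor, 'c::complex_vector) tensor
    \<Rightarrow> ('a, ('b, 'c) tensor) tensor"
  where "tensor_assoc = tensor_lift (\<lambda>t c. tensor_lift (\<lambda>a b. a \<otimes> (b \<otimes> c)) t)"

definition tensor_mult :: "('a::complex_vector \<Rightarrow> 'a \<Rightarrow> 'a) \<Rightarrow> ('b::complex_vector \<Rightarrow> 'b \<Rightarrow> 'b)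
    \<Rightarrow> ('a, 'b) tensor \<Rightarrow> ('a, 'b) tensor \<Rightarrow> ('a, 'b) tensor"
  where "tensor_mult m n s t =
    tensor_lift (\<lambda>a b. tensor_lift (\<lambda>a' b'. m a a' \<otimes> n b b') t) s"

text \<open>For \<open>R\<close> in \<open>A \<otimes> A\<close> and \<open>e\<close> the unit of \<open>A\<close>: the elements \<open>R\<^sub>1\<^sub>2\<close>, \<open>R\<^sub>1\<^sub>3\<close> and \<open>R\<^sub>2\<^sub>3\<close> of
  \<open>A \<otimes> (A \<otimes> A)\<close>. The unit is even, so these are also the right elements when the symmetry carries
  Koszul signs.\<close>

definition leg12 :: "'a::complex_vector \<Rightarrow> ('a, 'a) tensor \<Rightarrow> ('a, ('a, 'a) tensor) tensor"
  where "leg12 e = tensor_lift (\<lambda>a b. a \<otimes> (b \<otimes> e))"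

definition leg13 :: "'a::complex_vector \<Rightarrow> ('a, 'a) tensor \<Rightarrow> ('a, ('a, 'a) tensor) tensor"
  where "leg13 e = tensor_lift (\<lambda>a b. a \<otimes> (e \<otimes> b))"

definition leg23 :: "'a::complex_vector \<Rightarrow> ('a, 'a) tensor \<Rightarrow> ('a, ('a, 'a) tensor) tensor"
  where "leg23 e R = e \<otimes> R"


section \<open>Superspaces\<close>

text \<open>A \<open>\<int>\<^sub>2\<close>-grading is given by its homogeneous components \<open>P 0\<close> (even) and \<open>P 1\<close> (odd).\<close>

definition is_grading :: "(bit \<Rightarrow> 'a::complex_vector set) \<Rightarrow> bool"
  where "is_grading P \<longleftrightarrow> (\<forall>i. complex_vector.subspace (P i)) \<and> P 0 \<inter> P 1 = {0} \<and>
    (\<forall>a. \<exists>x\<in>P 0. \<exists>y\<in>P 1. a = x + y)"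

definition component :: "(bit \<Rightarrow> 'a::complex_vector set) \<Rightarrow> bit \<Rightarrow> 'a \<Rightarrow> 'a"
  where "component P i a = (THE x. x \<in> P i \<and> a - x \<in> P (i + 1))"

text \<open>\<open>sign p\<close> is \<open>(-1)\<^sup>p\<close>.\<close>

definition sign :: "bit \<Rightarrow> complex"
  where "sign p = (if p = 0 then 1 else - 1)"

definition tensor_grading :: "(bit \<Rightarrow> 'a::complex_vector set) \<Rightarrow> (bit \<Rightarrow> 'b::complex_vector set)
    \<Rightarrow> bit \<Rightarrow> ('a, 'b) tensor set"
  where "tensor_grading P Q k = complex_vector.span {a \<otimes> b | a b. \<exists>i j. a \<in> P i \<and> b \<in> Q j \<and> i + j = k}"

definition super_flip :: "(bit \<Rightarrow> 'a::complex_vector set) \<Rightarrow> (bit \<Rightarrow> 'b::complex_vector set)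
    \<Rightarrow> ('a, 'b) tensor \<Rightarrow> ('b, 'a) tensor"
  where "super_flip P Q = tensor_lift (\<lambda>v w.
    \<Sum>i\<in>{0, 1}. \<Sum>j\<in>{0, 1}. sign (i * j) *\<^sub>C (component Q j w \<otimes> component P i v))"

text \<open>\<open>(a \<otimes> b)(a' \<otimes> b') = (-1)\<^bsup>p(a')p(b)\<^esup> aa' \<otimes> bb'\<close>, extended linearly from homogeneous \<open>a'\<close> and \<open>b\<close>.\<close>

definition super_tensor_mult ::
    "(bit \<Rightarrow> 'a::complex_vector set) \<Rightarrow> (bit \<Rightarrow> 'b::complex_vector set)
      \<Rightarrow> ('a \<Rightarrow> 'a \<Rightarrow> 'a) \<Rightarrow> ('b \<Rightarrow> 'b \<Rightarrow> 'b) \<Rightarrow> ('a, 'b) tensor \<Rightarrow> ('a, 'b) tensor \<Rightarrow> ('a, 'b) tensor"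
  where "super_tensor_mult P Q m n s t =
    tensor_lift (\<lambda>a b. tensor_lift (\<lambda>a' b'.
      \<Sum>i\<in>{0, 1}. \<Sum>j\<in>{0, 1}. sign (i * j) *\<^sub>C (m a (component P i a') \<otimes> n (component Q j b) b')) t) s"


section \<open>Hopf algebras and Hopf superalgebras\<close>

record (overloaded) 'a hopf =
  mult :: "'a \<Rightarrow> 'a \<Rightarrow> 'a"
  unit :: 'a
  comult :: "'a \<Rightarrow> ('a, 'a) tensor"
  counit :: "'a \<Rightarrow> complex"
  antipode :: "'a \<Rightarrow> 'a"

record (overloaded) 'a super_hopf = "'a hopf" +
  grade :: "bit \<Rightarrow> 'a set"

text \<open>The axioms that read the same for Hopf algebras and Hopf superalgebras: comultiplication,
  counit and antipode are even, so no signs occur in them. What is missing is that the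
  comultiplication is an algebra homomorphism.\<close>

locale hopf_common =
  fixes H :: "('a::complex_vector, 'm) hopf_scheme"
  assumes mult_bilinear: "cbilinear (mult H)"
    and mult_assoc: "mult H (mult H a b) c = mult H a (mult H b c)"
    and mult_unit_left: "mult H (unit H) a = a"
    and mult_unit_right: "mult H a (unit H) = a"
    and comult_linear: "clinear (comult H)"
    and comult_coassoc:
      "tensor_assoc (tensor_map (comult H) id (comult H a)) = tensor_map id (comult H) (comult H a)"
    and counit_linear: "clinear (counit H)"
    and counit_left: "tensor_lift (\<lambda>x y. counit H x *\<^sub>C y) (comult H a) = a"
    and counit_right: "tensor_lift (\<lambda>x y. counit H y *\<^sub>C x) (comult H a) = a"
    and counit_mult: "counit H (mult H a b) = counit H a * counit H b"
    and counit_unit: "counit H (unit H) = 1"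
    and comult_unit: "comult H (unit H) = unit H \<otimes> unit H"
    and antipode_linear: "clinear (antipode H)"
    and antipode_left:
      "tensor_lift (mult H) (tensor_map (antipode H) id (comult H a)) = counit H a *\<^sub>C unit H"
    and antipode_right:
      "tensor_lift (mult H) (tensor_map id (antipode H) (comult H a)) = counit H a *\<^sub>C unit H"

locale hopf_algebra = hopf_common H for H :: "('a::complex_vector, 'm) hopf_scheme" +
  assumes comult_mult:
    "comult H (mult H a b) = tensor_mult (mult H) (mult H) (comult H a) (comult H b)"

locale hopf_superalgebra = hopf_common H for H :: "('a::complex_vector, 'm) super_hopf_scheme" +
  assumes grading: "is_grading (grade H)"
    and unit_even: "unit H \<in> grade H 0"
    and mult_even: "a \<in> grade H i \<Longrightarrow> b \<in> grade H j \<Longrightarrow> mult H a b \<in> grade H (i + j)"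
    and comult_even: "a \<in> grade H i \<Longrightarrow> comult H a \<in> tensor_grading (grade H) (grade H) i"
    and counit_even: "a \<in> grade H 1 \<Longrightarrow> counit H a = 0"
    and antipode_even: "a \<in> grade H i \<Longrightarrow> antipode H a \<in> grade H i"
    and comult_mult:
      "comult H (mult H a b) =
        super_tensor_mult (grade H) (grade H) (mult H) (mult H) (comult H a) (comult H b)"

locale cocommutative_hopf_superalgebra = hopf_superalgebra H
  for H :: "('a::complex_vector, 'm) super_hopf_scheme" +
  assumes cocommutative: "super_flip (grade H) (grade H) (comult H a) = comult H a"

definition inverse_of :: "('a::complex_vector, 'm) hopf_scheme \<Rightarrow> 'a \<Rightarrow> 'a"
  where "inverse_of H g = (THE h. mult H g h = unit H \<and> mult H h g = unit H)"

definition grouplike :: "('a::complex_vector, 'm) hopf_scheme \<Rightarrow> 'a \<Rightarrow> bool"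
  where "grouplike H g \<longleftrightarrow> comult H g = g \<otimes> g \<and> g \<noteq> 0"

definition parity_grouplike :: "('a::complex_vector, 'm) super_hopf_scheme \<Rightarrow> 'a \<Rightarrow> bool"
  where "parity_grouplike H g \<longleftrightarrow> grouplike H g \<and> mult H g g = unit H \<and>
    (\<forall>p. \<forall>x\<in>grade H p. mult H (mult H g x) (inverse_of H g) = sign p *\<^sub>C x)"


section \<open>Triangular structures\<close>

locale triangular_hopf_algebra = hopf_algebra H
  for H :: "('a::complex_vector, 'm) hopf_scheme" and R :: "('a, 'a) tensor" +
  assumes comult_R_left:
      "tensor_assoc (tensor_map (comult H) id R) =
        tensor_mult (mult H) (tensor_mult (mult H) (mult H)) (leg13 (unit H) R) (leg23 (unit H) R)"
    and comult_R_right: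
      "tensor_map id (comult H) R =
        tensor_mult (mult H) (tensor_mult (mult H) (mult H)) (leg13 (unit H) R) (leg12 (unit H) R)"
    and comult_op:
      "tensor_mult (mult H) (mult H) (tensor_flip (comult H a)) R =
        tensor_mult (mult H) (mult H) R (comult H a)"
    and R_flip_right: "tensor_mult (mult H) (mult H) R (tensor_flip R) = unit H \<otimes> unit H"
    and R_flip_left: "tensor_mult (mult H) (mult H) (tensor_flip R) R = unit H \<otimes> unit H"

locale triangular_hopf_superalgebra = hopf_superalgebra H
  for H :: "('a::complex_vector, 'm) super_hopf_scheme" and R :: "('a, 'a) tensor" +
  assumes R_even: "R \<in> tensor_grading (grade H) (grade H) 0"
    and comult_R_left:
      "tensor_assoc (tensor_map (comult H) id R) =
        super_tensor_mult (grade H) (tensor_grading (grade H) (grade H)) (mult H)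
          (super_tensor_mult (grade H) (grade H) (mult H) (mult H)) (leg13 (unit H) R) (leg23 (unit H) R)"
    and comult_R_right:
      "tensor_map id (comult H) R =
        super_tensor_mult (grade H) (tensor_grading (grade H) (grade H)) (mult H)
          (super_tensor_mult (grade H) (grade H) (mult H) (mult H)) (leg13 (unit H) R) (leg12 (unit H) R)"
    and comult_op:
      "super_tensor_mult (grade H) (grade H) (mult H) (mult H)
          (super_flip (grade H) (grade H) (comult H a)) R =
        super_tensor_mult (grade H) (grade H) (mult H) (mult H) R (comult H a)"
    and R_flip_right:
      "super_tensor_mult (grade H) (grade H) (mult H) (mult H) R
        (super_flip (grade H) (grade H) R) = unit H \<otimes> unit H"
    and R_flip_left:
      "super_tensor_mult (grade H) (grade H) (mult H) (mult H)
        (super_flip (grade H) (grade H) R) R = unit H \<otimes> unit H"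

definition drinfeld :: "('a::complex_vector, 'm) hopf_scheme \<Rightarrow> ('a, 'a) tensor \<Rightarrow> 'a"
  where "drinfeld H R = tensor_lift (mult H) (tensor_flip (tensor_map id (antipode H) R))"

definition super_drinfeld :: "('a::complex_vector, 'm) super_hopf_scheme \<Rightarrow> ('a, 'a) tensor \<Rightarrow> 'a"
  where "super_drinfeld H R =
    tensor_lift (mult H) (super_flip (grade H) (grade H) (tensor_map id (antipode H) R))"

definition R_of :: "('a::complex_vector, 'm) hopf_scheme \<Rightarrow> 'a \<Rightarrow> ('a, 'a) tensor"
  where "R_of H u =
    (1 / 2) *\<^sub>C (unit H \<otimes> unit H + unit H \<otimes> u + u \<otimes> unit H - u \<otimes> u)"

subsection \<open>The rank of an R-matrix\<close>

definition hopf_subalgebra :: "('a::complex_vector, 'm) hopf_scheme \<Rightarrow> 'a set \<Rightarrow> bool"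
  where "hopf_subalgebra H B \<longleftrightarrow> complex_vector.subspace B \<and> unit H \<in> B \<and>
    (\<forall>x\<in>B. \<forall>y\<in>B. mult H x y \<in> B) \<and>
    (\<forall>x\<in>B. comult H x \<in> complex_vector.span {b \<otimes> c | b c. b \<in> B \<and> c \<in> B}) \<and>
    (\<forall>x\<in>B. antipode H x \<in> B)"

definition hopf_generated :: "('a::complex_vector, 'm) hopf_scheme \<Rightarrow> 'a set \<Rightarrow> 'a set"
  where "hopf_generated H X = \<Inter>{B. hopf_subalgebra H B \<and> X \<subseteq> B}"

definition shortest_expression ::
    "('a::complex_vector, 'b::complex_vector) tensor \<Rightarrow> ('a \<times> 'b) list \<Rightarrow> bool"
  where "shortest_expression t xs \<longleftrightarrow> (\<Sum>(a, b)\<leftarrow>xs. a \<otimes> b) = t \<and>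
    (\<forall>ys. (\<Sum>(a, b)\<leftarrow>ys. a \<otimes> b) = t \<longrightarrow> length xs \<le> length ys)"

text \<open>All shortest expressions have the same linear spans of left and of right tensorands, so
  taking the tensorands of all of them together does not change the subalgebra they generate.\<close>

definition tensorands :: "('a::complex_vector, 'a) tensor \<Rightarrow> 'a set"
  where "tensorands t = (\<Union>xs\<in>{xs. shortest_expression t xs}. fst ` set xs \<union> snd ` set xs)"

text \<open>The case distinction is needed because \<open>complex_vector.dim\<close> is \<open>0\<close> on infinite-dimensional
  subspaces.\<close>

definition edim :: "'a::complex_vector set \<Rightarrow> enat"
  where "edim V = (if \<exists>F. finite F \<and> V \<subseteq> complex_vector.span F then enat (complex_vector.dim V) else \<infinity>)"

definition R_rank :: "('a::complex_vector, 'm) hopf_scheme \<Rightarrow> ('a, 'a) tensor \<Rightarrow> enat"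
  where "R_rank H R = edim (hopf_generated H (tensorands R))"


section \<open>The correspondence\<close>

text \<open>The formulas of the two directions are the same. They are written here for a grading \<open>P\<close> and
  an element \<open>g\<close>, with \<open>\<Delta>\<^sub>i = (Id \<otimes> \<pi>\<^sub>i) \<Delta>\<close> and \<open>R\<^sub>i = (\<pi>\<^sub>i \<otimes> \<pi>\<^sub>i)(R)\<close> for the projections \<open>\<pi>\<^sub>i\<close> onto
  the homogeneous components, and extended linearly from homogeneous \<open>a\<close>. The products in
  \<open>A \<otimes> A\<close> below need no Koszul signs in either direction, because \<open>g\<close> and the unit are even.\<close>

definition twist_comult :: "('a::complex_vector, 'm) hopf_scheme \<Rightarrow> (bit \<Rightarrow> 'a set) \<Rightarrow> 'a \<Rightarrow> 'a \<Rightarrow> ('a, 'a) tensor"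
  where "twist_comult H P g a = (\<Sum>p\<in>{0, 1}.
    tensor_map id (component P 0) (comult H (component P p a)) -
    sign p *\<^sub>C tensor_mult (mult H) (mult H) (g \<otimes> unit H)
      (tensor_map id (component P 1) (comult H (component P p a))))"

definition twist_antipode :: "('a::complex_vector, 'm) hopf_scheme \<Rightarrow> (bit \<Rightarrow> 'a set) \<Rightarrow> 'a \<Rightarrow> 'a \<Rightarrow> 'a"
  where "twist_antipode H P g a =
    antipode H (component P 0 a) + mult H g (antipode H (component P 1 a))"

definition twist_R :: "('a::complex_vector, 'm) hopf_scheme \<Rightarrow> (bit \<Rightarrow> 'a set) \<Rightarrow> 'a \<Rightarrow> ('a, 'a) tensor \<Rightarrow> ('a, 'a) tensor"
  where "twist_R H P g R = tensor_mult (mult H) (mult H)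
    (tensor_map (component P 0) (component P 0) R +
     tensor_mult (mult H) (mult H) (unit H \<otimes> g) (tensor_map (component P 1) (component P 1) R))
    (R_of H g)"

definition Ad_grading :: "('a::complex_vector, 'm) hopf_scheme \<Rightarrow> 'a \<Rightarrow> bit \<Rightarrow> 'a set"
  where "Ad_grading H u p = {a. mult H (mult H u a) (inverse_of H u) = sign p *\<^sub>C a}"

definition to_super ::
    "'a::complex_vector hopf \<times> ('a, 'a) tensor \<Rightarrow> ('a super_hopf \<times> ('a, 'a) tensor) \<times> 'a"
  where "to_super = (\<lambda>(H, R). let u = drinfeld H R; P = Ad_grading H u in
    ((\<lparr>mult = mult H, unit = unit H, comult = twist_comult H P u, counit = counit H,
       antipode = twist_antipode H P u, grade = P\<rparr>,
      twist_R H P u R), u))"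

definition from_super ::
    "('a::complex_vector super_hopf \<times> ('a, 'a) tensor) \<times> 'a \<Rightarrow> 'a hopf \<times> ('a, 'a) tensor"
  where "from_super = (\<lambda>((H, R), g). let P = grade H in
    (\<lparr>mult = mult H, unit = unit H, comult = twist_comult H P g, counit = counit H,
      antipode = twist_antipode H P g\<rparr>,
     twist_R H P g R))"

text \<open>The domain and the codomain of the correspondence.\<close>

definition triangular_involutive :: "('a::complex_vector hopf \<times> ('a, 'a) tensor) set"
  where "triangular_involutive = {(H, R). triangular_hopf_algebra H R \<and>
    mult H (drinfeld H R) (drinfeld H R) = unit H}"

definition super_triangular_pairs :: "(('a::complex_vector super_hopf \<times> ('a, 'a) tensor) \<times> 'a) set"
  where "super_triangular_pairs = {((H, R), g). triangular_hopf_superalgebra H R \<and>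
    super_drinfeld H R = unit H \<and> parity_grouplike H g}"

definition triangular_rank_le_2 :: "('a::complex_vector hopf \<times> ('a, 'a) tensor) set"
  where "triangular_rank_le_2 = {(H, R). triangular_hopf_algebra H R \<and> R_rank H R \<le> 2}"

definition cocommutative_pairs :: "('a::complex_vector super_hopf \<times> 'a) set"
  where "cocommutative_pairs = {(H, g). cocommutative_hopf_superalgebra H \<and> parity_grouplike H g}"

definition with_trivial_R ::
    "'a::complex_vector super_hopf \<times> 'a \<Rightarrow> ('a super_hopf \<times> ('a, 'a) tensor) \<times> 'a"
  where "with_trivial_R = (\<lambda>(H, g). ((H, unit H \<otimes> unit H), g))"

subsection \<open>Isomorphisms\<close>

definition hopf_iso :: "('a::complex_vector \<Rightarrow> 'b::complex_vector)
    \<Rightarrow> ('a, 'm) hopf_scheme \<Rightarrow> ('b, 'n) hopf_scheme \<Rightarrow> bool"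
  where "hopf_iso f H K \<longleftrightarrow> clinear f \<and> bij f \<and>
    (\<forall>a b. f (mult H a b) = mult K (f a) (f b)) \<and> f (unit H) = unit K \<and>
    (\<forall>a. comult K (f a) = tensor_map f f (comult H a)) \<and>
    (\<forall>a. counit K (f a) = counit H a) \<and> (\<forall>a. antipode K (f a) = f (antipode H a))"

definition super_hopf_iso :: "('a::complex_vector \<Rightarrow> 'b::complex_vector)
    \<Rightarrow> ('a, 'm) super_hopf_scheme \<Rightarrow> ('b, 'n) super_hopf_scheme \<Rightarrow> bool"
  where "super_hopf_iso f H K \<longleftrightarrow> hopf_iso f H K \<and> (\<forall>p. f ` grade H p = grade K p)"

definition triangular_isomorphic ::
    "'a::complex_vector hopf \<times> ('a, 'a) tensor \<Rightarrow> 'b::complex_vector hopf \<times> ('b, 'b) tensor \<Rightarrow> bool"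
  where "triangular_isomorphic = (\<lambda>(H, R) (K, S). \<exists>f. hopf_iso f H K \<and> tensor_map f f R = S)"

definition super_triangular_isomorphic ::
    "('a::complex_vector super_hopf \<times> ('a, 'a) tensor) \<times> 'a
      \<Rightarrow> ('b::complex_vector super_hopf \<times> ('b, 'b) tensor) \<times> 'b \<Rightarrow> bool"
  where "super_triangular_isomorphic = (\<lambda>((H, R), g) ((K, S), h).
    \<exists>f. super_hopf_iso f H K \<and> tensor_map f f R = S \<and> f g = h)"

definition super_pair_isomorphic ::
    "'a::complex_vector super_hopf \<times> 'a \<Rightarrow> 'b::complex_vector super_hopf \<times> 'b \<Rightarrow> bool"
  where "super_pair_isomorphic = (\<lambda>(H, g) (K, h). \<exists>f. super_hopf_iso f H K \<and> f g = h)"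

text \<open>A Hopf algebra here has a whole type \<open>'a\<close> as its underlying vector space. As \<open>'a\<close> ranges over
  all types, and the correspondence does not change the underlying space, the isomorphism classes
  are sorted by the underlying space.\<close>

definition triangular_iso_rel ::
    "(('a::complex_vector hopf \<times> ('a, 'a) tensor) \<times> ('a hopf \<times> ('a, 'a) tensor)) set"
  where "triangular_iso_rel = {(x, y). x \<in> triangular_rank_le_2 \<and> y \<in> triangular_rank_le_2 \<and>
    triangular_isomorphic x y}"

definition super_pair_iso_rel ::
    "(('a::complex_vector super_hopf \<times> 'a) \<times> ('a super_hopf \<times> 'a)) set"
  where "super_pair_iso_rel = {(x, y). x \<in> cocommutative_pairs \<and> y \<in> cocommutative_pairs \<and>
    super_pair_isomorphic x y}"

end

theory Submission
  imports Defs
begin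

text \<open>
  Let \<open>F(x \<otimes> y) = x g\<^bsup>p(y)\<^esup> \<otimes> y\<close>. In both directions the twisted comultiplication is \<open>F \<circ> \<Delta>\<close>; \<open>F\<close> is an
  involution and \<open>F(s t)\<close> is the product of \<open>F(s)\<close> and \<open>F(t)\<close> with Koszul signs, so twisting exchanges
  Hopf algebras and Hopf superalgebras. The antipode axiom survives because \<open>S(x g) = g S(x)\<close>, which
  follows from the uniqueness of convolution inverses. Moreover
  \<open>R\<^sub>g (x \<otimes> y) = (-1)\<^bsup>p(x)p(y)\<^esup> (x g\<^bsup>p(y)\<^esup> \<otimes> y g\<^bsup>p(x)\<^esup>) R\<^sub>g\<close>, and the operator on the right is the flip of
  \<open>F \<beta> F\<close>; hence \<open>\<Delta>\<^sup>o\<^sup>p R\<^sub>g = R\<^sub>g \<Delta>\<close> says exactly that \<open>F \<circ> \<Delta>\<close> is supercocommutative.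

  If \<open>R\<close> has rank at most 2, the Hopf subalgebra generated by its tensorands is spanned by 1 and an element
  \<open>g\<close> with \<open>\<Delta>(g) = g \<otimes> g\<close> and \<open>g\<^sup>2 = 1\<close>, and \<open>R\<close> is a symmetric bicharacter of \<open>{1, g}\<close>, so that
  \<open>R = R\<^sub>g\<close> or \<open>R = 1 \<otimes> 1 = R\<^sub>1\<close>.
\<close>

subsection \<open>Linear maps and tensors\<close>

text \<open>A Hopf algebra and a Hopf superalgebra obey different rules for the comultiplication of
  a product, yet one argument has to serve both directions. Apart from that rule itself, twisting
  needs it only for products with \<open>g\<close>, where the Koszul signs vanish because
  \<open>g\<close> is even. The locale \<open>twistable\<close> assumes just this common part; the
  full rule is exchanged separately by \<open>twist_mult\<close>. That \<open>g\<close> is even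
  holds because the grading of the superalgebra is forced: its components lie in the eigenspaces of
  conjugation by \<open>g\<close>, and two such decompositions coincide. Hence the grading and F
  depend only on the product and \<open>g\<close>, which both directions keep, so that applying F
  again restores the comultiplication. The element \<open>g\<close> is not part of the data of a
  triangular Hopf algebra. It is recovered as the Drinfeld element of \<open>R_of H g\<close>, and
  therefore isomorphisms that preserve the R-matrix also preserve \<open>g\<close>. Rank is defined
  through shortest expressions. The link to linear algebra is that each tensorand of a shortest
  expression arises by contracting the other factor with a linear functional, in any
  dimension.\<close>

lemma clinearI:
  "(\<And>x y. f (x + y) = f x + f y) \<Longrightarrow> (\<And>c x. f (c *\<^sub>C x) = c *\<^sub>C f x) \<Longrightarrow> clinear f"
  by (simp add: clinear_iff)

lemma
  assumes "clinear f"
  shows clinear_add: "f (x + y) = f x + f y"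
    and clinear_scale: "f (c *\<^sub>C x) = c *\<^sub>C f x"
    and clinear_zero: "f 0 = 0"
    and clinear_minus: "f (- x) = - f x"
    and clinear_diff: "f (x - y) = f x - f y"
proof -
  show add: "f (x + y) = f x + f y" and scale: "f (c *\<^sub>C x) = c *\<^sub>C f x" for x y c
    using assms by (auto simp: clinear_iff)
  show zero: "f 0 = 0"
    using scale[of 0 0] by simp
  show minus: "f (- x) = - f x" for x
    using add[of x "- x"] zero by (simp add: eq_neg_iff_add_eq_0 add.commute)
  show "f (x - y) = f x - f y"
    using add[of x "- y"] minus[of y] by simp
qed

lemma clinear_ident: "clinear id" "clinear (\<lambda>x. x)"
  by (simp_all add: clinear_iff)

lemma clinear_compose: "clinear f \<Longrightarrow> clinear g \<Longrightarrow> clinear (\<lambda>x. f (g x))"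
  by (simp add: clinear_iff)

lemma cbilinearI:
  assumes "\<And>x y b. f (x + y) b = f x b + f y b" "\<And>c x b. f (c *\<^sub>C x) b = c *\<^sub>C f x b"
    "\<And>a x y. f a (x + y) = f a x + f a y" "\<And>a c x. f a (c *\<^sub>C x) = c *\<^sub>C f a x"
  shows "cbilinear f"
  using assms by (simp add: cbilinear_def clinear_iff)

lemma
  assumes "cbilinear f"
  shows cbilinear_add_left: "f (x + y) b = f x b + f y b"
    and cbilinear_add_right: "f a (z + w) = f a z + f a w"
    and cbilinear_scale_left: "f (c *\<^sub>C x) b = c *\<^sub>C f x b"
    and cbilinear_scale_right: "f a (c *\<^sub>C z) = c *\<^sub>C f a z"
    and cbilinear_zero_left: "f 0 b = 0"
    and cbilinear_zero_right: "f a 0 = 0"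
    and cbilinear_minus_left: "f (- x) b = - f x b"
    and cbilinear_minus_right: "f a (- z) = - f a z"
    and cbilinear_diff_left: "f (x - y) b = f x b - f y b"
    and cbilinear_diff_right: "f a (z - w) = f a z - f a w"
proof -
  have "clinear (f a)" for a
    using assms unfolding cbilinear_def by simp
  then show "f a (z + w) = f a z + f a w" "f a (c *\<^sub>C z) = c *\<^sub>C f a z" "f a 0 = 0"
    "f a (- z) = - f a z" "f a (z - w) = f a z - f a w"
    by (simp_all add: clinear_add clinear_scale clinear_zero clinear_minus clinear_diff)
  have "clinear (\<lambda>a. f a b)" for b
    using assms unfolding cbilinear_def by simp
  from clinear_add[OF this] clinear_scale[OF this] clinear_zero[OF this] clinear_minus[OF this]
    clinear_diff[OF this]
  show "f (x + y) b = f x b + f y b" "f (c *\<^sub>C x) b = c *\<^sub>C f x b" "f 0 b = 0"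
    "f (- x) b = - f x b" "f (x - y) b = f x b - f y b"
    by simp_all
qed

lemmas cbilinear_simps = cbilinear_add_left cbilinear_add_right cbilinear_scale_left
  cbilinear_scale_right cbilinear_zero_left cbilinear_zero_right cbilinear_minus_left
  cbilinear_minus_right cbilinear_diff_left cbilinear_diff_right

lemma cbilinear_pure_tensor: "cbilinear (\<otimes>)"
proof (rule cbilinearI)
  note base = complex_vector.span_base[of _ tensor_relators]
  show "(x + y) \<otimes> b = x \<otimes> b + y \<otimes> b" for x y :: 'a and b :: 'b
    by (transfer, rule base) (unfold tensor_relators_def diff_diff_eq[symmetric], blast)
  show "a \<otimes> (x + y) = a \<otimes> x + a \<otimes> y" for x y :: 'b and a :: 'a
    by (transfer, rule base) (unfold tensor_relators_def diff_diff_eq[symmetric], blast)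
  show "(c *\<^sub>C x) \<otimes> b = c *\<^sub>C (x \<otimes> b)" for x :: 'a and b :: 'b and c
    by (transfer, rule base) (unfold tensor_relators_def, blast)
  show "a \<otimes> (c *\<^sub>C x) = c *\<^sub>C (a \<otimes> x)" for x :: 'b and a :: 'a and c
    by (transfer, rule base) (unfold tensor_relators_def, blast)
qed

lemmas pure_tensor_simps = cbilinear_simps[OF cbilinear_pure_tensor]

lemma complex_scaleC_eq [simp]: "(c::complex) *\<^sub>C d = c * d"
  by (simp add: scaleC_complex_def)

text \<open>Scalars are absorbed into the left factor and \<open>0\<close> is the pure tensor
  \<open>0 \<otimes> 0\<close>, so pure tensors and sums are the only cases.\<close>

lemma tensor_induct [case_names pure add]:
  fixes t :: "('a::complex_vector, 'b::complex_vector) tensor"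
  assumes pure: "\<And>a b. Q (a \<otimes> b)" and add: "\<And>s t. Q s \<Longrightarrow> Q t \<Longrightarrow> Q (s + t)"
  shows "Q t"
proof -
  obtain p where t: "t = abs_tensor p"
    using tensor.abs_induct[of "\<lambda>t. \<exists>p. t = abs_tensor p"] by blast
  have "Q (abs_tensor p)"
  proof (induction "card (Poly_Mapping.keys p)" arbitrary: p)
    case 0
    then have "abs_tensor p = (0 :: ('a, 'b) tensor)"
      by (simp add: zero_tensor_def)
    also have "\<dots> = 0 \<otimes> 0"
      by (simp add: pure_tensor_simps)
    finally show ?case
      by (simp only: pure)
  next
    case (Suc n)
    from Suc(2) have "Poly_Mapping.keys p \<noteq> {}"
      by (metis card.empty nat.distinct(1))
    then obtain k where k: "k \<in> Poly_Mapping.keys p"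
      by blast
    let ?s = "Poly_Mapping.single k (Poly_Mapping.lookup p k)"
    have "Poly_Mapping.keys (p - ?s) = Poly_Mapping.keys p - {k}"
      by (auto simp: in_keys_iff lookup_minus lookup_single when_def split: if_splits)
    then have IH: "Q (abs_tensor (p - ?s))"
      using Suc k by (intro Suc(1)) simp
    have "?s = Poly_Mapping.lookup p k *\<^sub>C Poly_Mapping.single k 1"
      by (auto intro!: poly_mapping_eqI simp: lookup_scaleC lookup_single when_def scaleC_complex_def)
    then have "p = (p - ?s) + Poly_Mapping.lookup p k *\<^sub>C Poly_Mapping.single (fst k, snd k) 1"
      by simp
    then have "abs_tensor p = abs_tensor (p - ?s) + Poly_Mapping.lookup p k *\<^sub>C (fst k \<otimes> snd k)"
      by (metis plus_tensor.abs_eq scaleC_tensor.abs_eq pure_tensor.abs_eq)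
    also have "\<dots> = abs_tensor (p - ?s) + (Poly_Mapping.lookup p k *\<^sub>C fst k) \<otimes> snd k"
      by (simp add: pure_tensor_simps)
    finally show ?case
      using IH pure add by simp
  qed
  then show ?thesis
    by (simp add: t)
qed

lemma tensor_sum_list: "\<exists>xs. (\<Sum>(a, b)\<leftarrow>xs. a \<otimes> b) = t"
proof (induction t rule: tensor_induct)
  case (pure a b)
  have "(\<Sum>(a, b)\<leftarrow>[(a, b)]. a \<otimes> b) = a \<otimes> b"
    by simp
  then show ?case
    by blast
next
  case (add s t)
  then obtain xs ys where "(\<Sum>(a, b)\<leftarrow>xs. a \<otimes> b) = s" "(\<Sum>(a, b)\<leftarrow>ys. a \<otimes> b) = t"
    by blast
  then have "(\<Sum>(a, b)\<leftarrow>xs @ ys. a \<otimes> b) = s + t"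
    by simp
  then show ?case
    by blast
qed

lemma
  assumes "cbilinear f"
  shows tensor_lift_add: "tensor_lift f (s + t) = tensor_lift f s + tensor_lift f t"
    and tensor_lift_scale: "tensor_lift f (c *\<^sub>C s) = c *\<^sub>C tensor_lift f s"
  using clinear_tensor_lift[OF assms] by (simp_all add: clinear_add clinear_scale)

lemma
  assumes "clinear f" "clinear g"
  shows clinear_tensor_map: "clinear (tensor_map f g)"
    and tensor_map_pure: "tensor_map f g (a \<otimes> b) = f a \<otimes> g b"
proof -
  have "cbilinear (\<lambda>a b. f a \<otimes> g b)"
    using assms by (intro cbilinearI) (simp_all add: clinear_add clinear_scale pure_tensor_simps)
  then show "clinear (tensor_map f g)" "tensor_map f g (a \<otimes> b) = f a \<otimes> g b"
    unfolding tensor_map_def by (simp_all add: clinear_tensor_lift tensor_lift_pure)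
qed

lemma
  assumes "cbilinear f" "cbilinear h"
  shows tensor_lift_fun_add: "tensor_lift (\<lambda>a b. f a b + h a b) t = tensor_lift f t + tensor_lift h t"
    and tensor_lift_fun_scale: "tensor_lift (\<lambda>a b. c *\<^sub>C f a b) t = c *\<^sub>C tensor_lift f t"
proof -
  have add: "cbilinear (\<lambda>a b. f a b + h a b)"
    by (intro cbilinearI)
      (simp_all add: cbilinear_simps[OF assms(1)] cbilinear_simps[OF assms(2)] scaleC_add_right ac_simps)
  have scale: "cbilinear (\<lambda>a b. c *\<^sub>C f a b)"
    by (intro cbilinearI)
      (simp_all add: cbilinear_simps[OF assms(1)] scaleC_add_right scaleC_scaleC mult.commute)
  show "tensor_lift (\<lambda>a b. f a b + h a b) t = tensor_lift f t + tensor_lift h t"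
    by (induction t rule: tensor_induct)
      (simp_all only: tensor_lift_pure[OF add] tensor_lift_add[OF add] tensor_lift_pure[OF assms(1)]
        tensor_lift_add[OF assms(1)] tensor_lift_pure[OF assms(2)] tensor_lift_add[OF assms(2)] ac_simps)
  show "tensor_lift (\<lambda>a b. c *\<^sub>C f a b) t = c *\<^sub>C tensor_lift f t"
    by (induction t rule: tensor_induct)
      (simp_all only: tensor_lift_pure[OF scale] tensor_lift_add[OF scale] tensor_lift_pure[OF assms(1)]
        tensor_lift_add[OF assms(1)] scaleC_add_right)
qed

lemma
  fixes a :: "'a::complex_vector" and b :: "'b::complex_vector"
  shows clinear_tensor_flip: "clinear (tensor_flip :: ('a, 'b) tensor \<Rightarrow> ('b, 'a) tensor)"
    and tensor_flip_pure [simp]: "tensor_flip (a \<otimes> b) = b \<otimes> a"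
proof -
  have "cbilinear (\<lambda>(a::'a) (b::'b). b \<otimes> a)"
    by (intro cbilinearI) (simp_all add: pure_tensor_simps)
  then show "clinear (tensor_flip :: ('a, 'b) tensor \<Rightarrow> ('b, 'a) tensor)" "tensor_flip (a \<otimes> b) = b \<otimes> a"
    unfolding tensor_flip_def by (simp_all only: clinear_tensor_lift tensor_lift_pure)
qed

lemma tensor_flip_flip: "tensor_flip (tensor_flip t) = t"
  by (induction t rule: tensor_induct) (simp_all add: clinear_add[OF clinear_tensor_flip])

lemma
  fixes a :: "'a::complex_vector" and b :: "'b::complex_vector" and c :: "'c::complex_vector"
  shows clinear_tensor_assoc:
      "clinear (tensor_assoc :: (('a, 'b) tensor, 'c) tensor \<Rightarrow> ('a, ('b, 'c) tensor) tensor)"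
    and tensor_assoc_pure [simp]: "tensor_assoc ((a \<otimes> b) \<otimes> c) = a \<otimes> (b \<otimes> c)"
proof -
  have b1: "cbilinear (\<lambda>(a::'a) (b::'b). a \<otimes> (b \<otimes> c))" for c :: 'c
    by (intro cbilinearI) (simp_all add: pure_tensor_simps)
  have "cbilinear (\<lambda>t c. tensor_lift (\<lambda>(a::'a) (b::'b). a \<otimes> (b \<otimes> (c::'c))) t)"
    by (intro cbilinearI) (simp_all only: tensor_lift_add[OF b1] tensor_lift_scale[OF b1] pure_tensor_simps
      tensor_lift_fun_add[OF b1 b1] tensor_lift_fun_scale[OF b1 b1])
  then show "clinear (tensor_assoc :: (('a, 'b) tensor, 'c) tensor \<Rightarrow> ('a, ('b, 'c) tensor) tensor)"
    "tensor_assoc ((a \<otimes> b) \<otimes> c) = a \<otimes> (b \<otimes> c)"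
    unfolding tensor_assoc_def by (simp_all only: clinear_tensor_lift tensor_lift_pure b1)
qed

text \<open>\<open>tensor_mult\<close> and \<open>super_tensor_mult\<close> are both of the following form.\<close>

lemma tensor_lift2:
  assumes bc: "\<And>a b. cbilinear (f a b)" and ba: "\<And>c d. cbilinear (\<lambda>a b. f a b c d)"
  shows cbilinear_tensor_lift2: "cbilinear (\<lambda>s t. tensor_lift (\<lambda>a b. tensor_lift (f a b) t) s)"
    and tensor_lift2_pure: "tensor_lift (\<lambda>a b. tensor_lift (f a b) (c \<otimes> d)) (a \<otimes> b) = f a b c d"
proof -
  have ext: "f (x + y) u = (\<lambda>a b. f x u a b + f y u a b)" "f v (z + w) = (\<lambda>a b. f v z a b + f v w a b)"
    "f (c *\<^sub>C x) u = (\<lambda>a b. c *\<^sub>C f x u a b)" "f v (c *\<^sub>C z) = (\<lambda>a b. c *\<^sub>C f v z a b)" for x y u v z w c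
    by (simp_all add: fun_eq_iff cbilinear_simps[OF ba])
  have b: "cbilinear (\<lambda>a b. tensor_lift (f a b) t)" for t
    by (intro cbilinearI; simp only: ext tensor_lift_fun_add[OF bc bc] tensor_lift_fun_scale[OF bc bc])
  show "cbilinear (\<lambda>s t. tensor_lift (\<lambda>a b. tensor_lift (f a b) t) s)"
    by (intro cbilinearI; simp only: tensor_lift_add[OF b] tensor_lift_scale[OF b] tensor_lift_add[OF bc]
      tensor_lift_scale[OF bc] tensor_lift_fun_add[OF b b] tensor_lift_fun_scale[OF b b])
  show "tensor_lift (\<lambda>a b. tensor_lift (f a b) (c \<otimes> d)) (a \<otimes> b) = f a b c d"
    by (simp only: tensor_lift_pure[OF bc] tensor_lift_pure[OF ba])
qed

lemma
  assumes "cbilinear m" "cbilinear n"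
  shows cbilinear_tensor_mult: "cbilinear (tensor_mult m n)"
    and tensor_mult_pure: "tensor_mult m n (a \<otimes> b) (c \<otimes> d) = m a c \<otimes> n b d"
proof -
  have b: "cbilinear (\<lambda>c d. m a c \<otimes> n b d)" "cbilinear (\<lambda>a b. m a c \<otimes> n b d)" for a b c d
    by (intro cbilinearI; simp add: pure_tensor_simps cbilinear_simps[OF assms(1)] cbilinear_simps[OF assms(2)])+
  from tensor_lift2[of "\<lambda>a b c d. m a c \<otimes> n b d", OF b]
  show "cbilinear (tensor_mult m n)" "tensor_mult m n (a \<otimes> b) (c \<otimes> d) = m a c \<otimes> n b d"
    by (simp_all add: tensor_mult_def[abs_def])
qed

lemma
  fixes a b e :: "'a::complex_vector"
  shows clinear_leg12: "clinear (leg12 e)" and leg12_pure [simp]: "leg12 e (a \<otimes> b) = a \<otimes> (b \<otimes> e)"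
    and clinear_leg13: "clinear (leg13 e)" and leg13_pure [simp]: "leg13 e (a \<otimes> b) = a \<otimes> (e \<otimes> b)"
    and clinear_leg23: "clinear (leg23 e)" and leg23_pure [simp]: "leg23 e t = e \<otimes> t"
proof -
  have "cbilinear (\<lambda>(a::'a) (b::'a). a \<otimes> (b \<otimes> e))" "cbilinear (\<lambda>(a::'a) (b::'a). a \<otimes> (e \<otimes> b))"
    by (intro cbilinearI; simp add: pure_tensor_simps)+
  then show "clinear (leg12 e)" "leg12 e (a \<otimes> b) = a \<otimes> (b \<otimes> e)"
      "clinear (leg13 e)" "leg13 e (a \<otimes> b) = a \<otimes> (e \<otimes> b)"
    unfolding leg12_def leg13_def by (simp_all only: clinear_tensor_lift tensor_lift_pure)
  show "clinear (leg23 e)" "leg23 e t = e \<otimes> t"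
    by (intro clinearI; simp add: leg23_def pure_tensor_simps)(simp add: leg23_def)
qed

subsection \<open>Shortest expressions\<close>

text \<open>A maximal independent subset of \<open>W\<close> stays independent when \<open>v\<close>
  is added, so the values on it can be prescribed; no finiteness is involved.\<close>

lemma functional_separates:
  assumes "v \<notin> complex_vector.span W"
  obtains \<phi> :: "'a::complex_vector \<Rightarrow> complex"
  where "clinear \<phi>" "\<phi> v = 1" "\<And>w. w \<in> W \<Longrightarrow> \<phi> w = 0"
proof -
  interpret p: vector_space_pair "scaleC :: complex \<Rightarrow> 'a \<Rightarrow> 'a" "scaleC :: complex \<Rightarrow> complex \<Rightarrow> complex"
    by unfold_locales
  obtain B where B: "B \<subseteq> W" "complex_vector.independent B" "W \<subseteq> complex_vector.span B"
    using complex_vector.maximal_independent_subset[of W] by blast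
  have v: "v \<notin> complex_vector.span B"
    using assms B(1) complex_vector.span_mono by blast
  then have ind: "complex_vector.independent (insert v B)"
    using B(2) by (simp add: complex_vector.independent_insertI)
  obtain \<phi> where \<phi>: "Vector_Spaces.linear scaleC scaleC \<phi>"
      "\<forall>x\<in>insert v B. \<phi> x = (if x = v then 1 else (0::complex))"
    using p.linear_independent_extend[OF ind, of "\<lambda>x. if x = v then 1 else 0"] by blast
  have lin: "clinear \<phi>"
    using \<phi>(1) by (simp add: clinear_def)
  have "v \<notin> B"
    using v complex_vector.span_base by blast
  then have "\<And>x. x \<in> B \<Longrightarrow> \<phi> x = 0"
    using \<phi>(2) by auto
  moreover have "complex_vector.subspace {x. \<phi> x = 0}"
    by (auto simp: complex_vector.subspace_def clinear_add[OF lin] clinear_scale[OF lin] clinear_zero[OF lin])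
  ultimately have "complex_vector.span B \<subseteq> {x. \<phi> x = 0}"
    by (intro complex_vector.span_minimal) auto
  then have "\<And>w. w \<in> W \<Longrightarrow> \<phi> w = 0"
    using B(3) by auto
  then show thesis
    using that[OF lin] \<phi>(2) by auto
qed

text \<open>The contraction of the left factor by \<open>\<phi>\<close>, that is
  \<open>\<phi> \<otimes> id\<close> followed by the identification of
  \<open>\<complex> \<otimes> B\<close> with \<open>B\<close>.\<close>

definition slice_left :: "('a::complex_vector \<Rightarrow> complex) \<Rightarrow> ('a, 'b::complex_vector) tensor \<Rightarrow> 'b"
  where "slice_left \<phi> = tensor_lift (\<lambda>a b. \<phi> a *\<^sub>C b)"

definition slice_right :: "('b::complex_vector \<Rightarrow> complex) \<Rightarrow> ('a::complex_vector, 'b) tensor \<Rightarrow> 'a"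
  where "slice_right \<phi> = tensor_lift (\<lambda>a b. \<phi> b *\<^sub>C a)"

lemma
  fixes a d :: "'a::complex_vector" and b c :: "'b::complex_vector"
  assumes "clinear \<phi>"
  shows clinear_slice_left: "clinear (slice_left \<phi> :: ('a, 'b) tensor \<Rightarrow> 'b)"
    and slice_left_pure: "slice_left \<phi> (a \<otimes> b) = \<phi> a *\<^sub>C b"
    and clinear_slice_right: "clinear (slice_right \<phi> :: ('b, 'a) tensor \<Rightarrow> 'b)"
    and slice_right_pure: "slice_right \<phi> (c \<otimes> d) = \<phi> d *\<^sub>C c"
proof -
  have "cbilinear (\<lambda>a (b::'b). \<phi> a *\<^sub>C b)" "cbilinear (\<lambda>(a::'b) b. \<phi> b *\<^sub>C a)"
    by (intro cbilinearI; simp add: clinear_add[OF assms] clinear_scale[OF assms]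
        scaleC_add_right scaleC_add_left scaleC_scaleC mult.commute)+
  then show "clinear (slice_left \<phi> :: ('a, 'b) tensor \<Rightarrow> 'b)" "slice_left \<phi> (a \<otimes> b) = \<phi> a *\<^sub>C b"
    "clinear (slice_right \<phi> :: ('b, 'a) tensor \<Rightarrow> 'b)" "slice_right \<phi> (c \<otimes> d) = \<phi> d *\<^sub>C c"
    unfolding slice_left_def slice_right_def by (simp_all only: clinear_tensor_lift tensor_lift_pure)
qed

text \<open>A right tensorand that is a combination of those already present can be distributed over
  them, changing only left tensorands and not the number of summands.\<close>

lemma absorb_summand:
  assumes "b \<in> complex_vector.span (snd ` set ys)"
  shows "\<exists>zs. length zs = length ys \<and> (\<Sum>(x, y)\<leftarrow>zs. x \<otimes> y) = (\<Sum>(x, y)\<leftarrow>ys. x \<otimes> y) + a \<otimes> b"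
  using assms
proof (induction ys arbitrary: b)
  case Nil
  then have "b = 0"
    by simp
  then show ?case
    by (simp add: pure_tensor_simps)
next
  case (Cons p ys)
  obtain x v where p: "p = (x, v)"
    by fastforce
  from Cons.prems obtain k where "b - k *\<^sub>C v \<in> complex_vector.span (snd ` set ys)"
    by (auto simp: p complex_vector.span_breakdown_eq)
  from Cons.IH[OF this] obtain zs where zs: "length zs = length ys"
      "(\<Sum>(x, y)\<leftarrow>zs. x \<otimes> y) = (\<Sum>(x, y)\<leftarrow>ys. x \<otimes> y) + a \<otimes> (b - k *\<^sub>C v)"
    by blast
  have "(\<Sum>(x, y)\<leftarrow>(x + k *\<^sub>C a, v) # zs. x \<otimes> y) = (\<Sum>(x, y)\<leftarrow>p # ys. x \<otimes> y) + a \<otimes> b"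
    by (simp add: p zs pure_tensor_simps algebra_simps)
  moreover have "length ((x + k *\<^sub>C a, v) # zs) = length (p # ys)"
    by (simp add: zs)
  ultimately show ?case
    by blast
qed

text \<open>By \<open>absorb_summand\<close>, the right tensorand \<open>b\<close> of one summand is
  not in the span of the others, since otherwise a shorter expression would exist. A functional that
  is 1 on \<open>b\<close> and 0 on the others then contracts \<open>t\<close> to
  \<open>a\<close>.\<close>

lemma shortest_slice_right:
  assumes "shortest_expression t xs" "(a, b) \<in> set xs"
  obtains \<phi> where "clinear \<phi>" "slice_right \<phi> t = a"
proof -
  from assms(2) obtain ps qs where xs: "xs = ps @ (a, b) # qs"
    by (meson split_list)
  have t: "t = (\<Sum>(x, y)\<leftarrow>ps @ qs. x \<otimes> y) + a \<otimes> b"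
    using assms(1) by (auto simp: shortest_expression_def xs)
  have "b \<notin> complex_vector.span (snd ` set (ps @ qs))"
  proof
    assume "b \<in> complex_vector.span (snd ` set (ps @ qs))"
    from absorb_summand[OF this, of a] obtain zs where
      "length zs = length (ps @ qs)" "(\<Sum>(x, y)\<leftarrow>zs. x \<otimes> y) = t"
      using t by auto
    then have "length xs \<le> length (ps @ qs)"
      using assms(1) unfolding shortest_expression_def by metis
    then show False
      by (simp add: xs)
  qed
  then obtain \<phi> :: "_ \<Rightarrow> complex" where \<phi>: "clinear \<phi>" "\<phi> b = 1"
      "\<And>w. w \<in> snd ` set (ps @ qs) \<Longrightarrow> \<phi> w = 0"
    by (rule functional_separates) blast
  have zero: "slice_right \<phi> (\<Sum>(x, y)\<leftarrow>zs. x \<otimes> y) = 0"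
    if "\<And>w. w \<in> snd ` set zs \<Longrightarrow> \<phi> w = 0" for zs :: "('c::complex_vector \<times> _) list"
    using that by (induction zs)
      (auto simp: clinear_zero[OF clinear_slice_right[OF \<phi>(1)]] clinear_add[OF clinear_slice_right[OF \<phi>(1)]]
        slice_right_pure[OF \<phi>(1)])
  have "slice_right \<phi> t = a"
    by (simp only: t clinear_add[OF clinear_slice_right[OF \<phi>(1)]] zero[OF \<phi>(3)] slice_right_pure[OF \<phi>(1)] \<phi>(2)
        scaleC_one add_0)
  then show thesis
    using that \<phi>(1) by blast
qed

lemma shortest_expression_flip:
  assumes "shortest_expression t xs"
  shows "shortest_expression (tensor_flip t) (map prod.swap xs)"
proof -
  have flip: "tensor_flip (\<Sum>(x, y)\<leftarrow>zs. x \<otimes> y) = (\<Sum>(x, y)\<leftarrow>map prod.swap zs. x \<otimes> y)"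
    for zs :: "('c::complex_vector \<times> 'd::complex_vector) list"
    by (induction zs) (auto simp: clinear_zero[OF clinear_tensor_flip] clinear_add[OF clinear_tensor_flip])
  have "length xs \<le> length ys" if "(\<Sum>(x, y)\<leftarrow>ys. x \<otimes> y) = tensor_flip t" for ys
  proof -
    have "(\<Sum>(x, y)\<leftarrow>map prod.swap ys. x \<otimes> y) = t"
      using flip[of ys] that tensor_flip_flip[of t] by simp
    then have "length xs \<le> length (map prod.swap ys)"
      using assms unfolding shortest_expression_def by blast
    then show ?thesis
      by simp
  qed
  then show ?thesis
    using assms flip[of xs] unfolding shortest_expression_def by auto
qed

lemma shortest_slice_left:
  assumes "shortest_expression t xs" "(a, b) \<in> set xs"
  obtains \<phi> where "clinear \<phi>" "slice_left \<phi> t = b"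
proof -
  have "(b, a) \<in> set (map prod.swap xs)"
    using assms(2) by force
  from shortest_slice_right[OF shortest_expression_flip[OF assms(1)] this]
  obtain \<phi> where \<phi>: "clinear \<phi>" "slice_right \<phi> (tensor_flip t) = b"
    by blast
  have "slice_right \<phi> (tensor_flip s) = slice_left \<phi> s" for s
    by (induction s rule: tensor_induct)
      (simp_all add: slice_left_pure[OF \<phi>(1)] slice_right_pure[OF \<phi>(1)] clinear_add[OF clinear_tensor_flip]
        clinear_add[OF clinear_slice_left[OF \<phi>(1)]] clinear_add[OF clinear_slice_right[OF \<phi>(1)]])
  then show thesis
    using that \<phi> by metis
qed

lemma shortest_expression_exists: "\<exists>xs. shortest_expression t xs"
proof -
  let ?Q = "\<lambda>xs. (\<Sum>(x, y)\<leftarrow>xs. x \<otimes> y) = t"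
  obtain xs where "?Q xs"
    using tensor_sum_list by blast
  from ex_has_least_nat[of ?Q, OF this, of length] show ?thesis
    unfolding shortest_expression_def by blast
qed

abbreviation tensor_square :: "'a::complex_vector set \<Rightarrow> ('a, 'a) tensor set"
  where "tensor_square B \<equiv> complex_vector.span {b \<otimes> c | b c. b \<in> B \<and> c \<in> B}"

lemma tensor_squareI_list:
  assumes "fst ` set xs \<union> snd ` set xs \<subseteq> B"
  shows "(\<Sum>(a, b)\<leftarrow>xs. a \<otimes> b) \<in> tensor_square B"
  using assms
proof (induction xs)
  case Nil
  then show ?case
    by (simp add: complex_vector.span_zero)
next
  case (Cons p xs)
  then have "fst p \<otimes> snd p \<in> tensor_square B"
    by (intro complex_vector.span_base) auto
  with Cons show ?case
    by (auto simp: split_beta intro!: complex_vector.span_add)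
qed

lemma tensor_square_tensorands: "t \<in> tensor_square B" if "tensorands t \<subseteq> B"
proof -
  obtain xs where xs: "shortest_expression t xs"
    using shortest_expression_exists by blast
  then have "fst ` set xs \<union> snd ` set xs \<subseteq> tensorands t"
    unfolding tensorands_def by blast
  then have "fst ` set xs \<union> snd ` set xs \<subseteq> B"
    using that by blast
  from tensor_squareI_list[OF this] show ?thesis
    using xs by (simp add: shortest_expression_def)
qed

text \<open>Tensorands of shortest expressions are themselves slices, so membership can be tested on
  slices, which depend on \<open>t\<close> alone and not on a chosen expression.\<close>

lemma tensorands_subset_slices:
  assumes "\<And>\<phi>. clinear \<phi> \<Longrightarrow> slice_left \<phi> t \<in> B \<and> slice_right \<phi> t \<in> B"
  shows "tensorands t \<subseteq> B"
proof
  fix c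
  assume "c \<in> tensorands t"
  then obtain xs a b where xs: "shortest_expression t xs" "(a, b) \<in> set xs" and "c = a \<or> c = b"
    by (auto simp: tensorands_def)
  moreover have "a \<in> B"
    using shortest_slice_right[OF xs] assms by blast
  moreover have "b \<in> B"
    using shortest_slice_left[OF xs] assms by blast
  ultimately show "c \<in> B"
    by blast
qed

lemma slice_tensor_square:
  assumes "t \<in> tensor_square B" "complex_vector.subspace B" "clinear \<phi>"
  shows "slice_left \<phi> t \<in> B \<and> slice_right \<phi> t \<in> B"
  using assms(1)
proof (induction rule: complex_vector.span_induct_alt)
  case base
  then show ?case
    using assms(2) by (simp add: clinear_zero[OF clinear_slice_left[OF assms(3)]] complex_vector.subspace_0
       clinear_zero[OF clinear_slice_right[OF assms(3)]])
next
  case (step c x y)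
  then show ?case
    using assms(2)
    by (auto simp: clinear_add[OF clinear_slice_left[OF assms(3)]] clinear_scale[OF clinear_slice_left[OF assms(3)]]
       clinear_add[OF clinear_slice_right[OF assms(3)]] clinear_scale[OF clinear_slice_right[OF assms(3)]]
       slice_left_pure[OF assms(3)] slice_right_pure[OF assms(3)]
       intro!: complex_vector.subspace_add complex_vector.subspace_scale)
qed

lemma tensorands_subset: "tensorands t \<subseteq> B" if "t \<in> tensor_square B" "complex_vector.subspace B"
  using tensorands_subset_slices slice_tensor_square[OF that] by blast

text \<open>Only closure under comultiplication needs an argument, because it says that a common
  element of many tensor squares lies in the tensor square of the intersection. All slices of
  \<open>comult H x\<close> lie in every subalgebra \<open>B\<close> concerned, hence in the
  intersection, and a shortest expression is made of slices.\<close>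

lemma hopf_subalgebra_generated:
  fixes H :: "('a::complex_vector, 'm) hopf_scheme"
  shows "hopf_subalgebra H (hopf_generated H X)"
proof -
  let ?G = "hopf_generated H X"
  have G: "x \<in> ?G \<longleftrightarrow> (\<forall>B. hopf_subalgebra H B \<longrightarrow> X \<subseteq> B \<longrightarrow> x \<in> B)" for x
    by (auto simp: hopf_generated_def)
  have "comult H x \<in> tensor_square ?G" if x: "x \<in> ?G" for x
  proof (rule tensor_square_tensorands, rule tensorands_subset_slices)
    fix \<phi> :: "'a \<Rightarrow> complex"
    assume \<phi>: "clinear \<phi>"
    have "slice_left \<phi> (comult H x) \<in> B \<and> slice_right \<phi> (comult H x) \<in> B"
      if B: "hopf_subalgebra H B" "X \<subseteq> B" for B
    proof (rule slice_tensor_square[OF _ _ \<phi>])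
      show "comult H x \<in> tensor_square B" "complex_vector.subspace B"
        using B x G[of x] unfolding hopf_subalgebra_def by blast+
    qed
    then show "slice_left \<phi> (comult H x) \<in> ?G \<and> slice_right \<phi> (comult H x) \<in> ?G"
      unfolding G by blast
  qed
  moreover have "complex_vector.subspace ?G"
    unfolding hopf_generated_def
    by (rule complex_vector.subspace_Inter) (simp add: hopf_subalgebra_def)
  moreover have "unit H \<in> ?G" "\<And>x y. x \<in> ?G \<Longrightarrow> y \<in> ?G \<Longrightarrow> mult H x y \<in> ?G"
    "\<And>x. x \<in> ?G \<Longrightarrow> antipode H x \<in> ?G"
    unfolding G by (simp_all add: hopf_subalgebra_def)
  ultimately show ?thesis
    unfolding hopf_subalgebra_def[of H ?G] by blast
qed

subsection \<open>Gradings\<close>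

text \<open>These simp rules turn sums of parities into \<open>of_bool\<close> terms.\<close>

declare add_bit_eq_xor [simp del] mult_bit_eq_and [simp del]

lemma bit_simps: "(1::bit) + 1 = 0" "(i::bit) + i = 0"
  by (cases i; simp)+

lemma sign_simps [simp]: "sign 0 = 1" "sign 1 = - 1"
  by (simp_all add: sign_def)

lemma sign_add: "sign (i + j) = sign i * sign j"
  by (cases i; cases j; simp)

lemma sign_sign [simp]: "sign i * sign i = 1"
  by (cases i; simp)

lemma sign_sign_scaleC: "sign i *\<^sub>C (sign i *\<^sub>C x) = x"
  by (simp add: scaleC_scaleC scaleC_one)

context
  fixes P :: "bit \<Rightarrow> 'a::complex_vector set"
  assumes P: "is_grading P"
begin

lemma grading_subspace: "complex_vector.subspace (P i)"
  using P by (simp add: is_grading_def)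

lemma component_unique:
  assumes "x \<in> P i" "y \<in> P (i + 1)"
  shows "component P i (x + y) = x"
  unfolding component_def
proof (rule the_equality)
  show "x \<in> P i \<and> x + y - x \<in> P (i + 1)"
    using assms by simp
  fix z
  assume z: "z \<in> P i \<and> x + y - z \<in> P (i + 1)"
  have "x - z \<in> P i"
    using z assms by (simp add: complex_vector.subspace_diff grading_subspace)
  moreover have "(x + y - z) - y \<in> P (i + 1)"
    using complex_vector.subspace_diff[OF grading_subspace] z assms by blast
  then have "x - z \<in> P (i + 1)"
    by (simp add: algebra_simps)
  ultimately have "x - z \<in> P 0 \<inter> P 1"
    by (cases i; simp add: bit_simps)
  also have "P 0 \<inter> P 1 = {0}"
    using P by (simp add: is_grading_def)
  finally show "z = x"
    by simp
qed

lemma grading_decompose: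
  obtains x y where "x \<in> P i" "y \<in> P (i + 1)" "a = x + y"
proof -
  obtain x y where "x \<in> P 0" "y \<in> P 1" "a = x + y"
    using P unfolding is_grading_def by blast
  then show thesis
    using that[of x y] that[of y x] by (cases i; simp add: bit_simps add.commute)
qed

lemma component_in: "component P i a \<in> P i"
  by (rule grading_decompose[of i a]) (simp add: component_unique)

lemma component_same: "x \<in> P i \<Longrightarrow> component P i x = x"
  using component_unique[of x i 0] by (simp add: complex_vector.subspace_0 grading_subspace)

lemma component_other: "x \<in> P j \<Longrightarrow> i \<noteq> j \<Longrightarrow> component P i x = 0"
  using component_unique[of 0 i x]
  by (cases i; cases j; simp add: complex_vector.subspace_0 grading_subspace bit_simps)

lemma clinear_component: "clinear (component P i)"
proof (rule clinearI)
  fix a b c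
  obtain x y z w where "x \<in> P i" "y \<in> P (i + 1)" "a = x + y" "z \<in> P i" "w \<in> P (i + 1)" "b = z + w"
    using grading_decompose by metis
  then have "component P i ((x + z) + (y + w)) = x + z" "component P i (c *\<^sub>C x + c *\<^sub>C y) = c *\<^sub>C x"
    "component P i a = x" "component P i b = z"
    by (auto intro!: component_unique complex_vector.subspace_add complex_vector.subspace_scale
        grading_subspace)
  then show "component P i (a + b) = component P i a + component P i b"
    "component P i (c *\<^sub>C a) = c *\<^sub>C component P i a"
    using \<open>a = x + y\<close> \<open>b = z + w\<close> by (simp_all add: scaleC_add_right algebra_simps)
qed

lemma component_sum: "component P 0 a + component P 1 a = a"
proof -
  obtain x y where "x \<in> P 0" "y \<in> P 1" "a = x + y"
    using P unfolding is_grading_def by blast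
  then show ?thesis
    using component_unique[of x 0 y] component_unique[of y 1 x] by (simp add: bit_simps add.commute)
qed

end

lemma
  assumes P: "is_grading P" and Q: "is_grading Q"
  shows clinear_super_flip: "clinear (super_flip P Q)"
    and super_flip_pure: "a \<in> P i \<Longrightarrow> b \<in> Q j \<Longrightarrow> super_flip P Q (a \<otimes> b) = sign (i * j) *\<^sub>C (b \<otimes> a)"
proof -
  note lin = clinear_add[OF clinear_component[OF P]] clinear_scale[OF clinear_component[OF P]]
    clinear_add[OF clinear_component[OF Q]] clinear_scale[OF clinear_component[OF Q]]
  have bil: "cbilinear (\<lambda>v w. \<Sum>i\<in>{0, 1}. \<Sum>j\<in>{0, 1}. sign (i * j) *\<^sub>C (component Q j w \<otimes> component P i v))"
    by (intro cbilinearI) (simp_all add: lin pure_tensor_simps scaleC_add_right scaleC_scaleC algebra_simps)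
  then show "clinear (super_flip P Q)"
    unfolding super_flip_def by (rule clinear_tensor_lift)
  assume "a \<in> P i" "b \<in> Q j"
  then show "super_flip P Q (a \<otimes> b) = sign (i * j) *\<^sub>C (b \<otimes> a)"
    unfolding super_flip_def tensor_lift_pure[OF bil]
    by (cases i; cases j; simp add: component_same[OF P] component_same[OF Q]
        component_other[OF P] component_other[OF Q] pure_tensor_simps)
qed

lemma
  assumes P: "is_grading P" and Q: "is_grading Q" and m: "cbilinear m" and n: "cbilinear n"
  shows cbilinear_super_tensor_mult: "cbilinear (super_tensor_mult P Q m n)"
    and super_tensor_mult_pure: "a' \<in> P i \<Longrightarrow> b \<in> Q j \<Longrightarrow>
      super_tensor_mult P Q m n (a \<otimes> b) (a' \<otimes> b') = sign (i * j) *\<^sub>C (m a a' \<otimes> n b b')"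
proof -
  note lin = clinear_add[OF clinear_component[OF P]] clinear_scale[OF clinear_component[OF P]]
    clinear_add[OF clinear_component[OF Q]] clinear_scale[OF clinear_component[OF Q]]
  let ?f = "\<lambda>a b a' b'. \<Sum>i\<in>{0, 1}. \<Sum>j\<in>{0, 1}.
    sign (i * j) *\<^sub>C (m a (component P i a') \<otimes> n (component Q j b) b')"
  have bil: "cbilinear (?f a b)" "cbilinear (\<lambda>a b. ?f a b c d)" for a b c d
    by (intro cbilinearI; simp add: lin pure_tensor_simps cbilinear_simps[OF m] cbilinear_simps[OF n]
        scaleC_add_right scaleC_scaleC algebra_simps)+
  show "cbilinear (super_tensor_mult P Q m n)"
    unfolding super_tensor_mult_def[abs_def] by (rule cbilinear_tensor_lift2[OF bil])
  assume "a' \<in> P i" "b \<in> Q j"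
  then show "super_tensor_mult P Q m n (a \<otimes> b) (a' \<otimes> b') = sign (i * j) *\<^sub>C (m a a' \<otimes> n b b')"
    unfolding super_tensor_mult_def tensor_lift2_pure[OF bil]
    by (cases i; cases j; simp add: component_same[OF P] component_same[OF Q] component_other[OF P]
        component_other[OF Q] pure_tensor_simps cbilinear_simps[OF m] cbilinear_simps[OF n])
qed

section \<open>Conjugation by an involution: its eigenspaces, the twist F and the element
  \<open>Rg\<close>\<close>

locale involution_algebra =
  fixes m :: "'a::complex_vector \<Rightarrow> 'a \<Rightarrow> 'a" (infixl \<open>\<bullet>\<close> 80) and e g :: 'a
  assumes bilinear: "cbilinear (\<bullet>)"
    and assoc: "(a \<bullet> b) \<bullet> c = a \<bullet> (b \<bullet> c)"
    and unit_left [simp]: "e \<bullet> a = a"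
    and unit_right [simp]: "a \<bullet> e = a"
    and involution [simp]: "g \<bullet> g = e"
begin

lemmas mult_simps = cbilinear_simps[OF bilinear]

lemma involution_assoc [simp]: "g \<bullet> (g \<bullet> a) = a"
  by (simp flip: assoc)

text \<open>The eigenspaces of conjugation by \<open>g\<close>, written without an inverse because
  \<open>g\<close> is its own inverse.\<close>

definition hom :: "bit \<Rightarrow> 'a set"
  where "hom i = {a. g \<bullet> a \<bullet> g = sign i *\<^sub>C a}"

lemma hom_commute: "a \<in> hom i \<Longrightarrow> g \<bullet> a = sign i *\<^sub>C (a \<bullet> g)"
proof -
  assume "a \<in> hom i"
  then have "g \<bullet> a \<bullet> g \<bullet> g = sign i *\<^sub>C (a \<bullet> g)"
    by (simp add: hom_def mult_simps)
  then show ?thesis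
    by (simp add: assoc)
qed

lemma hom_commute_assoc: "a \<in> hom i \<Longrightarrow> g \<bullet> (a \<bullet> b) = sign i *\<^sub>C (a \<bullet> (g \<bullet> b))"
proof -
  assume "a \<in> hom i"
  have "g \<bullet> (a \<bullet> b) = g \<bullet> a \<bullet> b"
    by (simp only: assoc)
  also have "\<dots> = sign i *\<^sub>C (a \<bullet> (g \<bullet> b))"
    by (simp only: hom_commute[OF \<open>a \<in> hom i\<close>] mult_simps assoc)
  finally show ?thesis .
qed

lemma homI: "g \<bullet> a = sign i *\<^sub>C (a \<bullet> g) \<Longrightarrow> a \<in> hom i"
  by (simp add: hom_def mult_simps) (simp add: assoc)

lemma grading_hom: "is_grading hom"
  unfolding is_grading_def
proof (intro conjI allI)
  show "complex_vector.subspace (hom i)" for i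
    by (auto simp: complex_vector.subspace_def hom_def mult_simps scaleC_add_right scaleC_scaleC mult.commute)
  have "a = 0" if "a \<in> hom 0" "a \<in> hom 1" for a
  proof -
    have "a = - a"
      using that by (simp add: hom_def scaleC_one)
    then have "(2::complex) *\<^sub>C a = 0"
      using scaleC_add_left[of 1 1 a] by (simp add: scaleC_one eq_neg_iff_add_eq_0)
    then show ?thesis
      by simp
  qed
  moreover have "0 \<in> hom i" for i
    by (simp add: hom_def mult_simps)
  ultimately show "hom 0 \<inter> hom 1 = {0}"
    by blast
  fix a
  \<comment> \<open>The projections onto the two eigenspaces of conjugation, an operator of square
    1.\<close>
  let ?x = "(1/2) *\<^sub>C (a + g \<bullet> a \<bullet> g)" and ?y = "(1/2) *\<^sub>C (a - g \<bullet> a \<bullet> g)"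
  have "?x + ?y = (1/2 + 1/2) *\<^sub>C a"
    unfolding scaleC_add_left by (simp add: algebra_simps complex_vector.scale_right_diff_distrib scaleC_add_right)
  then have "a = ?x + ?y"
    by (simp add: scaleC_one)
  moreover have "?x \<in> hom 0" "?y \<in> hom 1"
    by (simp_all add: hom_def mult_simps assoc algebra_simps scaleC_one
        complex_vector.scale_right_diff_distrib scaleC_add_right)
  ultimately show "\<exists>x\<in>hom 0. \<exists>y\<in>hom 1. a = x + y"
    by blast
qed

lemma e_hom: "e \<in> hom 0" and g_hom: "g \<in> hom 0"
  by (simp_all add: hom_def scaleC_one)

lemma mult_hom: "a \<in> hom i \<Longrightarrow> b \<in> hom j \<Longrightarrow> a \<bullet> b \<in> hom (i + j)"
  by (rule homI) (simp add: hom_commute_assoc hom_commute mult_simps assoc scaleC_scaleC sign_add)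

lemma mult_g_hom: "a \<in> hom i \<Longrightarrow> a \<bullet> g \<in> hom i" "a \<in> hom i \<Longrightarrow> g \<bullet> a \<in> hom i"
  using mult_hom[OF _ g_hom, of a i] mult_hom[OF g_hom, of a i] by simp_all

lemma hom_induct [case_names hom add]:
  assumes "\<And>a i. a \<in> hom i \<Longrightarrow> Q a" and add: "\<And>a b. Q a \<Longrightarrow> Q b \<Longrightarrow> Q (a + b)"
  shows "Q a"
proof -
  have "Q (component hom 0 a + component hom 1 a)"
    by (intro add assms(1)[OF component_in[OF grading_hom]])
  then show ?thesis
    by (simp only: component_sum[OF grading_hom])
qed

lemma hom_tensor_induct [case_names pure add]:
  assumes "\<And>a b i j. a \<in> hom i \<Longrightarrow> b \<in> hom j \<Longrightarrow> Q (a \<otimes> b)" and add: "\<And>s t. Q s \<Longrightarrow> Q t \<Longrightarrow> Q (s + t)"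
  shows "Q t"
proof (induction t rule: tensor_induct)
  case (pure a b)
  let ?c = "component hom"
  have "Q (?c 0 a \<otimes> ?c 0 b + ?c 0 a \<otimes> ?c 1 b + (?c 1 a \<otimes> ?c 0 b + ?c 1 a \<otimes> ?c 1 b))"
    by (intro assms(2) assms(1)[OF component_in[OF grading_hom] component_in[OF grading_hom]])
  also have "?c 0 a \<otimes> ?c 0 b + ?c 0 a \<otimes> ?c 1 b + (?c 1 a \<otimes> ?c 0 b + ?c 1 a \<otimes> ?c 1 b) =
      (?c 0 a + ?c 1 a) \<otimes> (?c 0 b + ?c 1 b)"
    by (simp only: pure_tensor_simps ac_simps)
  finally show ?case
    by (simp only: component_sum[OF grading_hom])
qed (rule add)

abbreviation hom2 :: "bit \<Rightarrow> ('a, 'a) tensor set"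
  where "hom2 \<equiv> tensor_grading hom hom"

abbreviation mult2 (infixl \<open>\<bullet>\<bullet>\<close> 80)
  where "mult2 \<equiv> tensor_mult (\<bullet>) (\<bullet>)"

abbreviation super_mult2 (infixl \<open>\<bullet>\<^sub>s\<close> 80)
  where "super_mult2 \<equiv> super_tensor_mult hom hom (\<bullet>) (\<bullet>)"

abbreviation braid :: "('a, 'a) tensor \<Rightarrow> ('a, 'a) tensor"
  where "braid \<equiv> super_flip hom hom"

lemmas mult2_simps = cbilinear_simps[OF cbilinear_tensor_mult[OF bilinear bilinear]]
  tensor_mult_pure[OF bilinear bilinear]

lemmas bilinear_super_mult2 = cbilinear_super_tensor_mult[OF grading_hom grading_hom bilinear bilinear]

lemmas super_mult2_simps = cbilinear_simps[OF bilinear_super_mult2]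

lemmas super_mult2_pure = super_tensor_mult_pure[OF grading_hom grading_hom bilinear bilinear]

lemmas braid_add = clinear_add[OF clinear_super_flip[OF grading_hom grading_hom]]
  and braid_pure = super_flip_pure[OF grading_hom grading_hom]

lemma hom2_pure: "a \<in> hom i \<Longrightarrow> b \<in> hom j \<Longrightarrow> a \<otimes> b \<in> hom2 (i + j)"
  unfolding tensor_grading_def by (rule complex_vector.span_base) blast

lemma hom2_induct [consumes 1, case_names zero pure add]:
  assumes t: "t \<in> hom2 k" and "Q 0"
    and pure: "\<And>a b i j. a \<in> hom i \<Longrightarrow> b \<in> hom j \<Longrightarrow> i + j = k \<Longrightarrow> Q (a \<otimes> b)"
    and add: "\<And>s t. s \<in> hom2 k \<Longrightarrow> t \<in> hom2 k \<Longrightarrow> Q s \<Longrightarrow> Q t \<Longrightarrow> Q (s + t)"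
  shows "Q t"
proof -
  have "t \<in> hom2 k \<and> Q t"
    using t[unfolded tensor_grading_def]
  proof (induction rule: complex_vector.span_induct_alt)
    case base
    then show ?case
      using \<open>Q 0\<close> by (simp add: tensor_grading_def complex_vector.span_zero)
  next
    case (step c x y)
    then obtain a b i j where x: "x = a \<otimes> b" "a \<in> hom i" "b \<in> hom j" "i + j = k"
      by blast
    have "c *\<^sub>C a \<in> hom i"
      using x(2) by (simp add: complex_vector.subspace_scale[OF grading_subspace[OF grading_hom]])
    moreover have "c *\<^sub>C x = (c *\<^sub>C a) \<otimes> b"
      by (simp add: x pure_tensor_simps)
    ultimately have "c *\<^sub>C x \<in> hom2 k \<and> Q (c *\<^sub>C x)"
      using pure[of "c *\<^sub>C a" i b j] hom2_pure[of "c *\<^sub>C a" i b j] x(3,4) by simp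
    then show ?case
      using step add unfolding tensor_grading_def by (auto intro: complex_vector.span_add)
  qed
  then show ?thesis
    by blast
qed

lemma subspace_hom2: "complex_vector.subspace (hom2 k)"
  unfolding tensor_grading_def by (rule complex_vector.subspace_span)

text \<open>Parity in the tensor square is again an eigenvalue, now of conjugation by
  \<open>g \<otimes> g\<close>. This turns claims about spans of homogeneous tensors into
  equations.\<close>

lemma hom2_iff: "t \<in> hom2 k \<longleftrightarrow> (g \<otimes> g) \<bullet>\<bullet> t \<bullet>\<bullet> (g \<otimes> g) = sign k *\<^sub>C t"
proof
  assume "t \<in> hom2 k"
  then show "(g \<otimes> g) \<bullet>\<bullet> t \<bullet>\<bullet> (g \<otimes> g) = sign k *\<^sub>C t"
    by (induction rule: hom2_induct)
      (auto simp: mult2_simps hom_def scaleC_add_right pure_tensor_simps scaleC_scaleC sign_add mult.commute)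
next
  assume *: "(g \<otimes> g) \<bullet>\<bullet> t \<bullet>\<bullet> (g \<otimes> g) = sign k *\<^sub>C t"
  \<comment> \<open>Twice the projection onto the eigenvalue \<open>sign k\<close>: a pure tensor of
    homogeneous factors is either doubled or killed. Applied to \<open>t\<close> itself it gives
    \<open>t + t\<close>.\<close>
  have "s + sign k *\<^sub>C ((g \<otimes> g) \<bullet>\<bullet> s \<bullet>\<bullet> (g \<otimes> g)) \<in> hom2 k" for s
  proof (induction s rule: hom_tensor_induct)
    case (pure a b i j)
    have "a \<otimes> b + sign k *\<^sub>C ((g \<otimes> g) \<bullet>\<bullet> (a \<otimes> b) \<bullet>\<bullet> (g \<otimes> g)) = (1 + sign (i + j + k)) *\<^sub>C (a \<otimes> b)"
      using pure by (simp add: mult2_simps hom_def pure_tensor_simps scaleC_scaleC sign_add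
        scaleC_add_left scaleC_one mult.commute mult.left_commute)
    moreover have "(1 + sign (i + j + k)) *\<^sub>C (a \<otimes> b) \<in> hom2 k"
    proof (cases "i + j = k")
      case True
      then show ?thesis
        using hom2_pure[OF pure] by (simp add: complex_vector.subspace_scale[OF subspace_hom2])
    next
      case False
      then have "sign (i + j + k) = -1"
        by (cases i; cases j; cases k; simp add: bit_simps)
      then show ?thesis
        by (simp add: complex_vector.subspace_0[OF subspace_hom2])
    qed
    ultimately show ?case
      by simp
  next
    case (add s t)
    then have "(s + sign k *\<^sub>C ((g \<otimes> g) \<bullet>\<bullet> s \<bullet>\<bullet> (g \<otimes> g))) + (t + sign k *\<^sub>C ((g \<otimes> g) \<bullet>\<bullet> t \<bullet>\<bullet> (g \<otimes> g))) \<in> hom2 k"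
      by (rule complex_vector.subspace_add[OF subspace_hom2])
    then show ?case
      by (simp add: mult2_simps scaleC_add_right algebra_simps)
  qed
  from this[of t] have "t + t \<in> hom2 k"
    by (simp add: * sign_sign_scaleC)
  then have "(1/2) *\<^sub>C (t + t) \<in> hom2 k"
    by (rule complex_vector.subspace_scale[OF subspace_hom2])
  also have "(1/2) *\<^sub>C (t + t) = (1/2 + 1/2) *\<^sub>C t"
    by (simp only: scaleC_add_left scaleC_add_right)
  finally show "t \<in> hom2 k"
    by (simp add: scaleC_one)
qed

text \<open>Required for threefold tensor products, whose second factor is itself a tensor square.
  That the two components meet only in 0 is read off from the eigenvalues in
  \<open>hom2_iff\<close>.\<close>

lemma grading_hom2: "is_grading hom2"
  unfolding is_grading_def
proof (intro conjI allI)
  show "complex_vector.subspace (hom2 k)" for k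
    by (rule subspace_hom2)
  have "t = 0" if "t \<in> hom2 0" "t \<in> hom2 1" for t
  proof -
    have "t = - t"
      using that by (simp add: hom2_iff scaleC_one)
    then have "(2::complex) *\<^sub>C t = 0"
      using scaleC_add_left[of 1 1 t] by (simp add: scaleC_one eq_neg_iff_add_eq_0)
    then show ?thesis
      by simp
  qed
  then show "hom2 0 \<inter> hom2 1 = {0}"
    using complex_vector.subspace_0[OF subspace_hom2] by blast
  show "\<exists>x\<in>hom2 0. \<exists>y\<in>hom2 1. t = x + y" for t
  proof (induction t rule: hom_tensor_induct)
    case (pure a b i j)
    have zero: "0 \<in> hom2 k" for k
      by (rule complex_vector.subspace_0[OF subspace_hom2])
    show ?case
    proof (cases "i + j = 0")
      case True
      with hom2_pure[OF pure] have "a \<otimes> b \<in> hom2 0"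
        by simp
      then show ?thesis
        using zero[of 1] by (intro bexI[of _ "a \<otimes> b"] bexI[of _ 0]) simp_all
    next
      case False
      with hom2_pure[OF pure] have "a \<otimes> b \<in> hom2 1"
        by simp
      then show ?thesis
        using zero[of 0] by (intro bexI[of _ "a \<otimes> b"] bexI[of _ 0]) simp_all
    qed
  next
    case (add s t)
    then obtain x y x' y' where "x \<in> hom2 0" "y \<in> hom2 1" "s = x + y" "x' \<in> hom2 0" "y' \<in> hom2 1" "t = x' + y'"
      by blast
    then have "x + x' \<in> hom2 0" "y + y' \<in> hom2 1" "s + t = (x + x') + (y + y')"
      by (simp_all add: complex_vector.subspace_add[OF subspace_hom2])
    then show ?case
      by blast
  qed
qed

text \<open>Since \<open>g x = (-1)\<^bsup>p(x)\<^esup> x g\<close>, multiplying by \<open>g\<close> on the right absorbs the sign in the formula for the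
  twisted comultiplication, which is \<open>\<Delta>\<close> followed by \<open>x \<otimes> y \<mapsto> x g\<^bsup>p(y)\<^esup> \<otimes> y\<close>.\<close>

definition twist :: "('a, 'a) tensor \<Rightarrow> ('a, 'a) tensor"
  where "twist = tensor_lift (\<lambda>a b. a \<otimes> component hom 0 b + a \<bullet> g \<otimes> component hom 1 b)"

definition gpow :: "bit \<Rightarrow> 'a"
  where "gpow i = (if i = 0 then e else g)"

lemma gpow_simps [simp]: "gpow 0 = e" "gpow 1 = g"
  by (simp_all add: gpow_def)

lemma gpow_hom: "gpow i \<in> hom 0"
  by (simp add: gpow_def e_hom g_hom)

lemma clinear_twist: "clinear twist"
  and twist_pure: "b \<in> hom j \<Longrightarrow> twist (a \<otimes> b) = a \<bullet> gpow j \<otimes> b"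
proof -
  note lin = clinear_add[OF clinear_component[OF grading_hom]] clinear_scale[OF clinear_component[OF grading_hom]]
  have bil: "cbilinear (\<lambda>a b. a \<otimes> component hom 0 b + a \<bullet> g \<otimes> component hom 1 b)"
    by (intro cbilinearI) (simp_all add: lin pure_tensor_simps mult_simps scaleC_add_right algebra_simps)
  then show "clinear twist"
    unfolding twist_def by (rule clinear_tensor_lift)
  assume "b \<in> hom j"
  then show "twist (a \<otimes> b) = a \<bullet> gpow j \<otimes> b"
    unfolding twist_def tensor_lift_pure[OF bil]
    by (cases j; simp add: component_same[OF grading_hom] component_other[OF grading_hom] pure_tensor_simps)
qed

lemmas twist_add = clinear_add[OF clinear_twist]
  and twist_scale = clinear_scale[OF clinear_twist]
  and twist_zero = clinear_zero[OF clinear_twist]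

lemma gpow_gpow [simp]: "gpow i \<bullet> gpow i = e"
  by (cases i; simp)

lemma gpow_gpow_assoc [simp]: "a \<bullet> gpow i \<bullet> gpow i = a"
  by (cases i; simp add: assoc)

lemma mult_gpow_hom: "a \<in> hom i \<Longrightarrow> a \<bullet> gpow j \<in> hom i"
  by (cases j; simp add: mult_g_hom)

lemma twist_twist [simp]: "twist (twist t) = t"
  by (induction t rule: hom_tensor_induct) (simp_all add: twist_pure twist_add)

lemma gpow_commute_assoc: "a \<in> hom i \<Longrightarrow> gpow j \<bullet> (a \<bullet> b) = sign (i * j) *\<^sub>C (a \<bullet> (gpow j \<bullet> b))"
  by (cases j; simp add: hom_commute_assoc scaleC_one)

lemma gpow_add: "gpow (i + j) = gpow i \<bullet> gpow j"
  by (cases i; cases j; simp)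

text \<open>For \<open>a \<otimes> b\<close> and \<open>c \<otimes> d\<close> with \<open>b\<close>
  of parity \<open>j\<close> and \<open>c\<close> of parity \<open>k\<close>, the twisted factors
  multiply to \<open>a g^j c ...\<close> on the left. Moving \<open>g^j\<close> past
  \<open>c\<close> produces the sign (-1)^(jk), which is exactly the Koszul sign for exchanging
  \<open>b\<close> and \<open>c\<close>, so the two cancel.\<close>

lemma twist_mult: "twist (s \<bullet>\<bullet> t) = twist s \<bullet>\<^sub>s twist t"
proof (induction s rule: hom_tensor_induct)
  case (pure a b i j)
  show ?case
  proof (induction t rule: hom_tensor_induct)
    case (pure c d k l)
    with \<open>b \<in> hom j\<close> show ?case
      by (simp add: mult2_simps twist_pure[OF mult_hom] twist_pure super_mult2_pure[OF mult_gpow_hom]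
          gpow_commute_assoc gpow_add assoc mult_simps pure_tensor_simps scaleC_scaleC mult.commute scaleC_one)
  qed (simp add: mult2_simps super_mult2_simps twist_add)
qed (simp add: mult2_simps super_mult2_simps twist_add)

lemma twist_super_mult: "twist (s \<bullet>\<^sub>s t) = twist s \<bullet>\<bullet> twist t"
  using twist_mult[of "twist s" "twist t"] by (metis twist_twist)

lemma twist_hom2: "t \<in> hom2 k \<Longrightarrow> twist t \<in> hom2 k"
proof (induction rule: hom2_induct)
  case (pure a b i j)
  then show ?case
    using hom2_pure[OF mult_gpow_hom[OF pure(1)] pure(2), of j] by (simp add: twist_pure)
qed (simp_all add: twist_zero twist_add complex_vector.subspace_0[OF subspace_hom2]
    complex_vector.subspace_add[OF subspace_hom2])

text \<open>The Koszul sign sees only the left factor of the second tensor and the right factor of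
  the first; one even factor among these two removes it.\<close>

lemma super_mult_even:
  assumes "x \<in> hom 0"
  shows "t \<bullet>\<^sub>s (x \<otimes> y) = t \<bullet>\<bullet> (x \<otimes> y)"
proof (induction t rule: hom_tensor_induct)
  case (pure a b i j)
  with assms show ?case
    by (simp add: super_mult2_pure mult2_simps scaleC_one)
qed (simp add: mult2_simps super_mult2_simps)

lemma even_super_mult:
  assumes "y \<in> hom 0"
  shows "(x \<otimes> y) \<bullet>\<^sub>s t = (x \<otimes> y) \<bullet>\<bullet> t"
proof (induction t rule: hom_tensor_induct)
  case (pure a b i j)
  with assms show ?case
    by (simp add: super_mult2_pure mult2_simps scaleC_one)
qed (simp add: mult2_simps super_mult2_simps)

text \<open>With the idempotents \<open>p_i = (e + (-1)^i g) / 2\<close> of the group algebra of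
  \<open>{e, g}\<close>, this is the sum of \<open>(-1)^(ij) p_i \<otimes> p_j\<close>. So it has
  square 1 and is the nontrivial symmetric bicharacter when \<open>g\<close> differs from
  \<open>e\<close>.\<close>

definition Rg :: "('a, 'a) tensor"
  where "Rg = (1 / 2) *\<^sub>C (e \<otimes> e + e \<otimes> g + g \<otimes> e - g \<otimes> g)"

text \<open>Conceptually, \<open>p_k x = x p_(k+i)\<close> for \<open>x\<close> of parity
  \<open>i\<close>. Shifting the indices in the sum of \<open>(-1)^(kl) p_k \<otimes> p_l\<close> by
  the parities \<open>i\<close> and \<open>j\<close> yields the sign (-1)^(ij) and the factors
  \<open>g^j\<close> and \<open>g^i\<close>, since \<open>g p_k = (-1)^k p_k\<close>. The proof
  checks the four parity cases directly.\<close>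

lemma Rg_commute: "Rg \<bullet>\<bullet> t = tensor_flip (twist (braid (twist t))) \<bullet>\<bullet> Rg"
proof (induction t rule: hom_tensor_induct)
  case (pure a b i j)
  then have ops: "tensor_flip (twist (braid (twist (a \<otimes> b)))) = sign (i * j) *\<^sub>C (a \<bullet> gpow j \<otimes> b \<bullet> gpow i)"
    by (simp add: twist_pure braid_pure[OF mult_gpow_hom] twist_scale
        twist_pure[OF mult_gpow_hom] clinear_scale[OF clinear_tensor_flip])
  show ?case
    unfolding ops using pure
    by (cases i; cases j;
        simp add: Rg_def mult2_simps hom_commute pure_tensor_simps assoc scaleC_one algebra_simps)
qed (simp add: mult2_simps braid_add twist_add clinear_add[OF clinear_tensor_flip])

lemma Rg_Rg: "Rg \<bullet>\<bullet> Rg = e \<otimes> e"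
proof -
  have "Rg \<bullet>\<bullet> Rg = (1/4) *\<^sub>C (e \<otimes> e + e \<otimes> e + e \<otimes> e + e \<otimes> e)"
    unfolding Rg_def by (simp add: mult2_simps scaleC_add_right scaleC_scaleC algebra_simps
      complex_vector.scale_right_diff_distrib)
  also have "\<dots> = (1/4 + 1/4 + 1/4 + 1/4) *\<^sub>C (e \<otimes> e)"
    by (simp only: scaleC_add_left scaleC_add_right)
  finally show ?thesis
    by (simp add: scaleC_one)
qed

lemma flip_Rg: "tensor_flip Rg = Rg"
  by (simp add: Rg_def clinear_scale[OF clinear_tensor_flip] clinear_add[OF clinear_tensor_flip]
      clinear_diff[OF clinear_tensor_flip] algebra_simps)

lemma mult2_assoc: "r \<bullet>\<bullet> s \<bullet>\<bullet> t = r \<bullet>\<bullet> (s \<bullet>\<bullet> t)"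
proof (induction r rule: tensor_induct)
  case (pure a b)
  show ?case
  proof (induction s rule: tensor_induct)
    case (pure c d)
    show ?case
      by (induction t rule: tensor_induct) (simp_all add: mult2_simps assoc)
  qed (simp add: mult2_simps)
qed (simp add: mult2_simps)

lemma mult2_unit [simp]: "(e \<otimes> e) \<bullet>\<bullet> t = t" "t \<bullet>\<bullet> (e \<otimes> e) = t"
  by (induction t rule: tensor_induct) (simp_all add: mult2_simps)

text \<open>\<open>Rg\<close> can be cancelled because it is its own inverse; what remains is an
  equation between \<open>t\<close> and its image under F, the braiding and F, and F is an
  involution.\<close>

lemma Rg_commute_iff: "tensor_flip t \<bullet>\<bullet> Rg = Rg \<bullet>\<bullet> t \<longleftrightarrow> braid (twist t) = twist t"
proof -
  have cancel: "r \<bullet>\<bullet> Rg = s \<bullet>\<bullet> Rg \<longleftrightarrow> r = s" for r s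
  proof
    assume "r \<bullet>\<bullet> Rg = s \<bullet>\<bullet> Rg"
    then have "r \<bullet>\<bullet> Rg \<bullet>\<bullet> Rg = s \<bullet>\<bullet> Rg \<bullet>\<bullet> Rg"
      by simp
    then show "r = s"
      by (simp only: mult2_assoc Rg_Rg mult2_unit)
  qed simp
  have "tensor_flip t = tensor_flip (twist (braid (twist t))) \<longleftrightarrow> t = twist (braid (twist t))"
    by (metis tensor_flip_flip)
  also have "\<dots> \<longleftrightarrow> braid (twist t) = twist t"
    by (metis twist_twist)
  finally show ?thesis
    unfolding Rg_commute[of t] cancel .
qed

end

subsection \<open>Twisting a Hopf algebra by an involution\<close>

context hopf_common
begin

abbreviation hmult (infixl \<open>\<bullet>\<close> 80)
  where "a \<bullet> b \<equiv> mult H a b"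

lemmas mult_simps = cbilinear_simps[OF mult_bilinear]

lemmas lin_simps = clinear_add[OF comult_linear] clinear_scale[OF comult_linear] clinear_zero[OF comult_linear]
  clinear_add[OF counit_linear] clinear_scale[OF counit_linear] clinear_zero[OF counit_linear]
  clinear_add[OF antipode_linear] clinear_scale[OF antipode_linear] clinear_zero[OF antipode_linear]
  clinear_diff[OF comult_linear] clinear_diff[OF counit_linear] clinear_diff[OF antipode_linear]

lemmas lift_mult_simps = tensor_lift_pure[OF mult_bilinear] tensor_lift_add[OF mult_bilinear]

text \<open>\<open>id\<close> is listed in both forms because the induction method unfolds it.\<close>

lemma
  assumes "clinear f"
  shows map_left_simps:
      "tensor_map f id (a \<otimes> b) = f a \<otimes> b" "tensor_map f id (s + t) = tensor_map f id s + tensor_map f id t"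
      "tensor_map f (\<lambda>x. x) (a \<otimes> b) = f a \<otimes> b"
      "tensor_map f (\<lambda>x. x) (s + t) = tensor_map f (\<lambda>x. x) s + tensor_map f (\<lambda>x. x) t"
      "tensor_map f id 0 = 0" "tensor_map f (\<lambda>x. x) 0 = 0"
    and map_right_simps:
      "tensor_map id f (a \<otimes> c) = a \<otimes> f c" "tensor_map id f (v + w) = tensor_map id f v + tensor_map id f w"
      "tensor_map (\<lambda>x. x) f (a \<otimes> c) = a \<otimes> f c"
      "tensor_map (\<lambda>x. x) f (v + w) = tensor_map (\<lambda>x. x) f v + tensor_map (\<lambda>x. x) f w"
      "tensor_map id f 0 = 0" "tensor_map (\<lambda>x. x) f 0 = 0"
  using assms by (simp_all add: tensor_map_pure clinear_ident clinear_add[OF clinear_tensor_map]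
    clinear_zero[OF clinear_tensor_map])

lemma cbilinear_counit_left: "cbilinear (\<lambda>x y. counit H x *\<^sub>C y)"
  and cbilinear_counit_right: "cbilinear (\<lambda>x y. counit H y *\<^sub>C x)"
  by (intro cbilinearI; simp add: lin_simps scaleC_add_left scaleC_add_right scaleC_scaleC mult.commute)+

lemma unit_nonzero: "unit H \<noteq> 0"
  using counit_unit by (auto simp: lin_simps)

text \<open>Both sides are \<open>T * id * S\<close> in the convolution algebra.\<close>

lemma antipode_unique:
  assumes T: "clinear T"
    and inv: "\<And>a. tensor_lift (mult H) (tensor_map T id (comult H a)) = counit H a *\<^sub>C unit H"
  shows "T a = antipode H a"
proof -
  let ?S = "antipode H"
  note T_simps = clinear_add[OF T] clinear_scale[OF T]
  have inner: "cbilinear (\<lambda>y z. x \<bullet> (y \<bullet> ?S z))" for x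
    by (intro cbilinearI) (simp_all add: lin_simps mult_simps)
  have ext: "(\<lambda>y z. T (x + x') \<bullet> (y \<bullet> ?S z)) = (\<lambda>y z. T x \<bullet> (y \<bullet> ?S z) + T x' \<bullet> (y \<bullet> ?S z))"
      "(\<lambda>y z. T (c *\<^sub>C x) \<bullet> (y \<bullet> ?S z)) = (\<lambda>y z. c *\<^sub>C (T x \<bullet> (y \<bullet> ?S z)))" for x x' c
    by (simp_all add: fun_eq_iff T_simps mult_simps)
  have outer: "cbilinear (\<lambda>x. tensor_lift (\<lambda>y z. T x \<bullet> (y \<bullet> ?S z)))"
    by (intro cbilinearI; simp only: ext tensor_lift_add[OF inner] tensor_lift_scale[OF inner]
        tensor_lift_fun_add[OF inner inner] tensor_lift_fun_scale[OF inner inner])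
  \<comment> \<open>\<open>M\<close> evaluates the triple convolution on a right-bracketed tensor.
    Contracting the last two factors leaves \<open>T\<close>; reassociating and contracting the
    first two leaves the antipode.\<close>
  define M where "M = tensor_lift (\<lambda>x. tensor_lift (\<lambda>y z. T x \<bullet> (y \<bullet> ?S z)))"
  have M: "M (s + s') = M s + M s'" "M (x \<otimes> t) = tensor_lift (\<lambda>y z. T x \<bullet> (y \<bullet> ?S z)) t"
     "M (x \<otimes> (y \<otimes> z)) = T x \<bullet> (y \<bullet> ?S z)" for s s' t x y z
    unfolding M_def by (simp_all only: tensor_lift_add[OF outer] tensor_lift_pure[OF outer] tensor_lift_pure[OF inner])
  have right: "tensor_lift (\<lambda>y z. T x \<bullet> (y \<bullet> ?S z)) t = T x \<bullet> tensor_lift (mult H) (tensor_map id ?S t)" for x t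
    by (induction t rule: tensor_induct)
      (simp_all only: tensor_lift_add[OF inner] tensor_lift_pure[OF inner] lift_mult_simps
        map_right_simps[OF antipode_linear] mult_simps)
  have left: "M (tensor_assoc (t \<otimes> z)) = tensor_lift (mult H) (tensor_map T id t) \<bullet> ?S z" for t z
    by (induction t rule: tensor_induct)
      (simp_all only: pure_tensor_simps clinear_add[OF clinear_tensor_assoc] tensor_assoc_pure M(1,3) lift_mult_simps
        map_left_simps[OF T] mult_simps mult_assoc)
  have "M (tensor_map id (comult H) t) = T (tensor_lift (\<lambda>x y. counit H y *\<^sub>C x) t)" for t
    by (induction t rule: tensor_induct)
      (simp_all add: map_right_simps[OF comult_linear] M(1,2) right antipode_right mult_simps T_simps
        tensor_lift_add[OF cbilinear_counit_right]
        tensor_lift_pure[OF cbilinear_counit_right] mult_unit_right)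
  then have "M (tensor_map id (comult H) (comult H a)) = T a"
    by (simp add: counit_right)
  moreover have "M (tensor_assoc (tensor_map (comult H) id t)) = ?S (tensor_lift (\<lambda>x y. counit H x *\<^sub>C y) t)" for t
    by (induction t rule: tensor_induct)
      (simp_all add: map_left_simps[OF comult_linear] M(1) left inv mult_simps lin_simps
        clinear_add[OF clinear_tensor_assoc]
        tensor_lift_add[OF cbilinear_counit_left] tensor_lift_pure[OF cbilinear_counit_left] mult_unit_left)
  then have "M (tensor_assoc (tensor_map (comult H) id (comult H a))) = ?S a"
    by (simp add: counit_left)
  ultimately show ?thesis
    by (simp add: comult_coassoc)
qed

lemma antipode_unit: "antipode H (unit H) = unit H"
  using antipode_left[of "unit H"]
  by (simp add: comult_unit counit_unit map_left_simps[OF antipode_linear] lift_mult_simps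
      mult_unit_right scaleC_one)

end

section \<open>Twisting by a grouplike involution, in a setting common to Hopf algebras and Hopf
  superalgebras\<close>

locale twistable = hopf_common H for H :: "('a::complex_vector, 'm) hopf_scheme" +
  fixes g :: 'a
  assumes g_g: "mult H g g = unit H"
    and comult_g: "comult H g = g \<otimes> g"
    and comult_mult_g: "comult H (mult H a g) = tensor_mult (mult H) (mult H) (comult H a) (g \<otimes> g)"
    and comult_g_mult: "comult H (mult H g a) = tensor_mult (mult H) (mult H) (g \<otimes> g) (comult H a)"
begin

sublocale involution_algebra "mult H" "unit H" g
  by unfold_locales (simp_all add: mult_bilinear mult_assoc mult_unit_left mult_unit_right g_g)

notation mult2 (infixl \<open>\<bullet>\<bullet>\<close> 80)
notation super_mult2 (infixl \<open>\<bullet>\<^sub>s\<close> 80)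

lemma g_nonzero: "g \<noteq> 0"
  using g_g unit_nonzero hopf_common.mult_simps(5)[OF hopf_common_axioms, of g] by metis

lemma counit_g: "counit H g = 1"
proof -
  have "counit H g *\<^sub>C g = g"
    using counit_left[of g] by (simp add: comult_g tensor_lift_pure[OF cbilinear_counit_left])
  then have "(counit H g - 1) *\<^sub>C g = 0"
    by (simp add: complex_vector.scale_left_diff_distrib scaleC_one)
  then show ?thesis
    using g_nonzero by simp
qed

text \<open>The counit is multiplicative with value 1 at \<open>g\<close>, hence invariant under
  conjugation by \<open>g\<close>, which negates odd elements.\<close>

lemma counit_odd: "a \<in> hom 1 \<Longrightarrow> counit H a = 0"
  using counit_mult[of "g \<bullet> a" g] counit_mult[of g a]
  by (simp add: hom_def counit_g clinear_minus[OF counit_linear])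

text \<open>The map \<open>T a = g S(a g)\<close> is a left convolution inverse of the identity:
  inserting \<open>g g = 1\<close> behind the second factor rewrites \<open>T * id\<close> at
  \<open>a\<close> as \<open>g (S * id)(a g) g\<close>, because \<open>comult H\<close> of
  \<open>a g\<close> is \<open>comult H a\<close> times \<open>g \<otimes> g\<close>.\<close>

lemma antipode_mult_g: "antipode H (a \<bullet> g) = g \<bullet> antipode H a"
proof -
  let ?T = "\<lambda>a. g \<bullet> antipode H (a \<bullet> g)"
  have T: "clinear ?T"
    by (intro clinearI) (simp_all add: mult_simps lin_simps)
  have "?T a = antipode H a"
  proof (rule antipode_unique[OF T])
    fix a
    have "tensor_lift (mult H) (tensor_map ?T id t) =
        g \<bullet> tensor_lift (mult H) (tensor_map (antipode H) id (t \<bullet>\<bullet> (g \<otimes> g))) \<bullet> g" for t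
      by (induction t rule: tensor_induct)
        (simp_all add: map_left_simps[OF T] map_left_simps[OF antipode_linear]
          lift_mult_simps mult2_simps assoc mult_simps)
    from this[of "comult H a"]
    show "tensor_lift (mult H) (tensor_map ?T id (comult H a)) = counit H a *\<^sub>C unit H"
      by (simp add: antipode_left counit_mult counit_g mult_simps flip: comult_mult_g)
  qed
  from arg_cong[OF this, of "mult H g"] show ?thesis
    by simp
qed

lemma antipode_g_mult: "antipode H (g \<bullet> a) = antipode H a \<bullet> g"
proof -
  let ?T = "\<lambda>a. antipode H (g \<bullet> a) \<bullet> g"
  have T: "clinear ?T"
    by (intro clinearI) (simp_all add: mult_simps lin_simps)
  have "?T a = antipode H a"
  proof (rule antipode_unique[OF T])
    fix a
    have "tensor_lift (mult H) (tensor_map ?T id t) =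
        tensor_lift (mult H) (tensor_map (antipode H) id ((g \<otimes> g) \<bullet>\<bullet> t))" for t
      by (induction t rule: tensor_induct)
        (simp_all add: map_left_simps[OF T] map_left_simps[OF antipode_linear]
          lift_mult_simps mult2_simps assoc mult_simps)
    from this[of "comult H a"]
    show "tensor_lift (mult H) (tensor_map ?T id (comult H a)) = counit H a *\<^sub>C unit H"
      by (simp add: antipode_left counit_mult counit_g mult_simps flip: comult_g_mult)
  qed
  then have "?T a \<bullet> g = antipode H a \<bullet> g"
    by simp
  then show ?thesis
    by (simp add: assoc)
qed

lemma antipode_hom: "a \<in> hom i \<Longrightarrow> antipode H a \<in> hom i"
proof -
  assume "a \<in> hom i"
  then have "antipode H (g \<bullet> a \<bullet> g) = sign i *\<^sub>C antipode H a"
    by (simp add: hom_def lin_simps)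
  then show ?thesis
    by (simp add: hom_def antipode_mult_g antipode_g_mult assoc)
qed

lemma antipode_g: "antipode H g = g"
  using antipode_mult_g[of "unit H"] by (simp add: antipode_unit)

text \<open>Comultiplication carries conjugation by \<open>g\<close> to conjugation by
  \<open>g \<otimes> g\<close>, and \<open>hom2_iff\<close> identifies the eigenspaces of the
  latter.\<close>

lemma comult_hom: "a \<in> hom i \<Longrightarrow> comult H a \<in> hom2 i"
  using comult_mult_g[of "g \<bullet> a"] by (simp add: comult_g_mult hom2_iff hom_def lin_simps)

lemma twist_comult_eq: "twist_comult H hom g a = twist (comult H a)"
proof -
  note comp = clinear_component[OF grading_hom]
  \<comment> \<open>In \<open>hom2 k\<close> an odd right factor forces the left factor
    \<open>x\<close> to have parity \<open>k + 1\<close>, so that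
    \<open>- (-1)^k g x = x g\<close>.\<close>
  have "tensor_map id (component hom 0) t -
      sign k *\<^sub>C ((g \<otimes> unit H) \<bullet>\<bullet> tensor_map id (component hom 1) t) = twist t" if "t \<in> hom2 k" for t k
    using that
  proof (induction rule: hom2_induct)
    case (pure a b i j)
    then show ?case
      by (cases i; cases j; simp add: map_right_simps[OF comp] component_same[OF grading_hom]
          component_other[OF grading_hom] twist_pure mult2_simps pure_tensor_simps hom_commute scaleC_one bit_simps)
  qed (simp_all add: map_right_simps[OF comp] mult2_simps twist_zero twist_add scaleC_add_right algebra_simps)
  from this[OF comult_hom[OF component_in[OF grading_hom]]]
  have "twist_comult H hom g a = twist (comult H (component hom 0 a)) + twist (comult H (component hom 1 a))"
    unfolding twist_comult_def by simp
  also have "\<dots> = twist (comult H (component hom 0 a + component hom 1 a))"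
    by (simp only: lin_simps twist_add)
  finally show ?thesis
    by (simp only: component_sum[OF grading_hom])
qed

lemma clinear_twist_antipode: "clinear (twist_antipode H hom g)"
  unfolding twist_antipode_def
  by (intro clinearI) (simp_all add: clinear_add[OF clinear_component[OF grading_hom]]
      clinear_scale[OF clinear_component[OF grading_hom]] lin_simps mult_simps scaleC_add_right)

lemma twist_antipode_pure: "a \<in> hom i \<Longrightarrow> twist_antipode H hom g a = gpow i \<bullet> antipode H a"
  unfolding twist_antipode_def
  by (cases i; simp add: component_same[OF grading_hom] component_other[OF grading_hom] lin_simps mult_simps)

lemma antipode_mult_gpow: "antipode H (a \<bullet> gpow i) = gpow i \<bullet> antipode H a"
  by (cases i; simp add: antipode_mult_g)

lemma comult_mult_gpow: "comult H (a \<bullet> gpow i) = comult H a \<bullet>\<bullet> (gpow i \<otimes> gpow i)"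
  by (cases i; simp add: comult_mult_g)

lemma counit_gpow: "counit H (gpow i) = 1"
  by (cases i; simp add: counit_g counit_unit)

text \<open>The threefold analogue of F: it sends \<open>x \<otimes> y \<otimes> z\<close> to
  \<open>x g^(p(y)+p(z)) \<otimes> y g^(p(z)) \<otimes> z\<close> for homogeneous \<open>y\<close>
  and \<open>z\<close>.\<close>

definition twist3 :: "('a, ('a, 'a) tensor) tensor \<Rightarrow> ('a, ('a, 'a) tensor) tensor"
  where "twist3 = tensor_lift (\<lambda>x s. x \<otimes> twist (component hom2 0 s) + x \<bullet> g \<otimes> twist (component hom2 1 s))"

lemma clinear_twist3: "clinear twist3"
  and twist3_pure: "s \<in> hom2 k \<Longrightarrow> twist3 (x \<otimes> s) = x \<bullet> gpow k \<otimes> twist s"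
proof -
  note lin = clinear_add[OF clinear_component[OF grading_hom2]] clinear_scale[OF clinear_component[OF grading_hom2]]
  have bil: "cbilinear (\<lambda>x s. x \<otimes> twist (component hom2 0 s) + x \<bullet> g \<otimes> twist (component hom2 1 s))"
    by (intro cbilinearI)
      (simp_all add: lin pure_tensor_simps twist_add twist_scale mult_simps scaleC_add_right algebra_simps)
  then show "clinear twist3"
    unfolding twist3_def by (rule clinear_tensor_lift)
  assume "s \<in> hom2 k"
  then show "twist3 (x \<otimes> s) = x \<bullet> gpow k \<otimes> twist s"
    unfolding twist3_def tensor_lift_pure[OF bil]
    by (cases k; simp add: component_same[OF grading_hom2] component_other[OF grading_hom2]
        pure_tensor_simps twist_zero)
qed

lemma clinear_twist_comult: "clinear (\<lambda>a. twist (comult H a))"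
  by (rule clinear_compose[OF clinear_twist comult_linear])

text \<open>Both iterates of the twisted comultiplication are \<open>twist3\<close> applied to the
  corresponding iterates of \<open>comult H\<close>, so coassociativity is inherited.\<close>

lemma twist_coassoc:
  "tensor_assoc (tensor_map (\<lambda>a. twist (comult H a)) id (twist (comult H a))) =
    tensor_map id (\<lambda>a. twist (comult H a)) (twist (comult H a))"
proof -
  note lin = map_left_simps[OF clinear_twist_comult] map_right_simps[OF clinear_twist_comult]
    map_left_simps[OF comult_linear] map_right_simps[OF comult_linear]
    clinear_add[OF clinear_tensor_assoc] clinear_add[OF clinear_twist3] twist_add
  \<comment> \<open>The power of \<open>g\<close> that the outer twist attaches to the left factor
    is itself comultiplied and appears in both of the first two legs.\<close>
  have left: "tensor_assoc (twist (s \<bullet>\<bullet> (gpow j \<otimes> gpow j)) \<otimes> y) = twist3 (tensor_assoc (s \<otimes> y))"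
    if y: "y \<in> hom j" for s y j
  proof (induction s rule: hom_tensor_induct)
    case (pure a b i k)
    have "gpow j \<bullet> gpow k = gpow (k + j)"
      by (cases j; cases k; simp)
    with pure y show ?case
      by (simp add: mult2_simps twist_pure[OF mult_gpow_hom] twist_pure[OF y] twist3_pure[OF hom2_pure] assoc)
  qed (simp add: mult2_simps pure_tensor_simps lin)
  have "tensor_assoc (tensor_map (\<lambda>a. twist (comult H a)) id (twist t)) =
      twist3 (tensor_assoc (tensor_map (comult H) id t))" for t
  proof (induction t rule: hom_tensor_induct)
    case (pure a b i j)
    then show ?case
      using left[of b j "comult H a"] by (simp add: lin twist_pure comult_mult_gpow)
  qed (simp add: lin)
  moreover have "tensor_map id (\<lambda>a. twist (comult H a)) (twist t) = twist3 (tensor_map id (comult H) t)" for t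
  proof (induction t rule: hom_tensor_induct)
    case (pure a b i j)
    then show ?case
      by (simp add: lin twist_pure twist3_pure[OF comult_hom[OF pure(2)]])
  qed (simp add: lin)
  ultimately show ?thesis
    by (simp add: comult_coassoc)
qed

lemma twist_counit_left: "tensor_lift (\<lambda>x y. counit H x *\<^sub>C y) (twist t) = tensor_lift (\<lambda>x y. counit H x *\<^sub>C y) t"
proof (induction t rule: hom_tensor_induct)
  case (pure a b i j)
  then show ?case
    by (simp add: twist_pure tensor_lift_pure[OF cbilinear_counit_left] counit_mult counit_gpow)
qed (simp add: twist_add tensor_lift_add[OF cbilinear_counit_left])

text \<open>The twist changes only tensors with odd right factor, and these are killed by the counit
  on that factor.\<close>

lemma twist_counit_right: "tensor_lift (\<lambda>x y. counit H y *\<^sub>C x) (twist t) = tensor_lift (\<lambda>x y. counit H y *\<^sub>C x) t"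
proof (induction t rule: hom_tensor_induct)
  case (pure a b i j)
  then show ?case
    by (cases j; simp add: twist_pure tensor_lift_pure[OF cbilinear_counit_right] counit_odd)
qed (simp add: twist_add tensor_lift_add[OF cbilinear_counit_right])

text \<open>On homogeneous tensors of total parity \<open>k\<close>, the powers of \<open>g\<close>
  from the twist and from the antipode combine to a single factor \<open>g^k\<close> in front. It
  does no harm: for \<open>k = 1\<close> the counit of \<open>a\<close> vanishes.\<close>

lemma twist_antipode_left:
  "tensor_lift (mult H) (tensor_map (twist_antipode H hom g) id (twist (comult H a))) = counit H a *\<^sub>C unit H"
proof (induction a rule: hom_induct)
  case (hom a k)
  note lin = clinear_zero[OF clinear_tensor_lift[OF mult_bilinear]]
    map_left_simps[OF clinear_twist_antipode] map_left_simps[OF antipode_linear] lift_mult_simps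
  have "tensor_lift (mult H) (tensor_map (twist_antipode H hom g) id (twist t)) =
      gpow k \<bullet> tensor_lift (mult H) (tensor_map (antipode H) id t)" if "t \<in> hom2 k" for t
    using that
  proof (induction rule: hom2_induct)
    case (pure a b i j)
    have "gpow k \<bullet> x = gpow i \<bullet> (gpow j \<bullet> x)" for x
      by (simp add: gpow_add assoc flip: pure(3))
    with pure show ?case
      by (simp add: lin twist_pure twist_antipode_pure[OF mult_gpow_hom] antipode_mult_gpow assoc)
  qed (simp_all add: lin twist_zero twist_add mult_simps)
  from this[OF comult_hom[OF hom]]
  have "tensor_lift (mult H) (tensor_map (twist_antipode H hom g) id (twist (comult H a))) = counit H a *\<^sub>C unit H"
    using hom by (cases k; simp add: antipode_left counit_odd mult_simps)
  then show ?case
    by (simp only: id_def)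
qed (simp add: lin_simps twist_add lift_mult_simps map_left_simps[OF clinear_twist_antipode] scaleC_add_left)

text \<open>Here the power of \<open>g\<close> attached to the left factor meets the same power in
  front of the antipode of the right factor, and they cancel.\<close>

lemma twist_antipode_right:
  "tensor_lift (mult H) (tensor_map id (twist_antipode H hom g) (twist (comult H a))) = counit H a *\<^sub>C unit H"
proof -
  have "tensor_lift (mult H) (tensor_map id (twist_antipode H hom g) (twist t)) =
      tensor_lift (mult H) (tensor_map id (antipode H) t)" for t
  proof (induction t rule: hom_tensor_induct)
    case (pure a b i j)
    then show ?case
      by (cases j; simp add: twist_pure twist_antipode_pure map_right_simps[OF clinear_twist_antipode]
          map_right_simps[OF antipode_linear] lift_mult_simps assoc)
  qed (simp add: twist_add lift_mult_simps map_right_simps[OF clinear_twist_antipode]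
      map_right_simps[OF antipode_linear])
  then show ?thesis
    by (simp add: antipode_right)
qed

lemma twist_antipode_hom: "a \<in> hom i \<Longrightarrow> twist_antipode H hom g a \<in> hom i"
  using mult_hom[OF gpow_hom antipode_hom, of a i i] by (simp add: twist_antipode_pure)

text \<open>\<open>K\<close> has its own record extension, so that it can be a superalgebra in one
  direction and an ordinary algebra in the other.\<close>

lemma hopf_common_twist:
  fixes K :: "('a, 'n) hopf_scheme"
  assumes "mult K = mult H" "unit K = unit H" "comult K = twist_comult H hom g"
    "counit K = counit H" "antipode K = twist_antipode H hom g"
  shows "hopf_common K"
proof -
  have comult: "comult K = (\<lambda>a. twist (comult H a))"
    by (simp add: assms fun_eq_iff twist_comult_eq)
  show ?thesis
    by unfold_locales
      (simp_all only: assms(1,2,4,5) comult mult_bilinear mult_assoc mult_unit_left mult_unit_right clinear_twist_comult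
        twist_coassoc counit_linear twist_counit_left twist_counit_right counit_left counit_right counit_mult
        counit_unit comult_unit twist_pure[OF e_hom] gpow_simps clinear_twist_antipode
        twist_antipode_left twist_antipode_right)
qed

end

text \<open>In the coproduct identities for \<open>Rg\<close> the two factors 1/2 give 1/4, while
  the product of the unnormalized elements is twice the unnormalized left-hand side.\<close>

lemma quarter_double: "(1/4) *\<^sub>C (x + x) = (1/2::complex) *\<^sub>C (x::'b::complex_vector)"
proof -
  have "(1/4) *\<^sub>C (x + x) = (1/4 + 1/4) *\<^sub>C x"
    by (simp only: scaleC_add_left scaleC_add_right)
  then show ?thesis
    by simp
qed

lemma inverse_of_involution:
  assumes "hopf_common H" "mult H g g = unit H"
  shows "inverse_of H g = g"
  unfolding inverse_of_def
proof (rule the_equality)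
  interpret hopf_common H by fact
  fix h
  assume "mult H g h = unit H \<and> mult H h g = unit H"
  then have "mult H (mult H g g) h = g"
    by (simp add: mult_assoc mult_unit_right)
  then show "h = g"
    by (simp add: assms(2) mult_unit_left)
qed (simp add: assms(2))

context twistable
begin

lemma Ad_grading_eq: "Ad_grading H g = hom"
  by (simp add: fun_eq_iff Ad_grading_def hom_def inverse_of_involution[OF hopf_common_axioms g_g])

lemma Rg_eq: "R_of H g = Rg"
  by (simp add: R_of_def Rg_def)

lemma hopf_superalgebra_twist:
  fixes K :: "('a, 'n) super_hopf_scheme"
  assumes H: "hopf_algebra H"
    and K: "mult K = mult H" "unit K = unit H" "comult K = twist_comult H hom g"
      "counit K = counit H" "antipode K = twist_antipode H hom g" and grade: "grade K = hom"
  shows "hopf_superalgebra K"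
proof -
  interpret hopf_algebra H by (rule H)
  interpret K: hopf_common K
    using K by (rule hopf_common_twist)
  have comult: "comult K a = twist (comult H a)" for a
    by (simp add: K twist_comult_eq)
  show ?thesis
    by unfold_locales
      (simp_all only: grade grading_hom e_hom mult_hom counit_odd twist_antipode_hom K(1,2,4,5) comult
        twist_hom2[OF comult_hom] comult_mult twist_mult)
qed

lemma hopf_algebra_twist:
  fixes K :: "('a, 'n) hopf_scheme"
  assumes H: "\<And>a b. comult H (a \<bullet> b) = comult H a \<bullet>\<^sub>s comult H b"
    and K: "mult K = mult H" "unit K = unit H" "comult K = twist_comult H hom g"
      "counit K = counit H" "antipode K = twist_antipode H hom g"
  shows "hopf_algebra K"
proof -
  interpret K: hopf_common K
    using K by (rule hopf_common_twist)
  have comult: "comult K a = twist (comult H a)" for a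
    by (simp add: K twist_comult_eq)
  show ?thesis
    by unfold_locales (simp only: K(1) comult H twist_super_mult)
qed

lemma twist_antipode_involution:
  fixes K :: "('a, 'n) hopf_scheme"
  assumes "mult K = mult H" "antipode K = twist_antipode H hom g"
  shows "twist_antipode K hom g = antipode H"
proof
  fix a
  have "twist_antipode K hom g a =
      antipode H (component hom 0 a) + g \<bullet> (g \<bullet> antipode H (component hom 1 a))"
    using twist_antipode_pure[OF component_in[OF grading_hom, of 0 a]]
      twist_antipode_pure[OF component_in[OF grading_hom, of 1 a]]
    by (simp add: twist_antipode_def[of K] assms)
  also have "\<dots> = antipode H (component hom 0 a + component hom 1 a)"
    by (simp add: lin_simps)
  finally show "twist_antipode K hom g a = antipode H a"
    by (simp only: component_sum[OF grading_hom])
qed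

lemma Rg_components:
  "tensor_map (component hom 0) (component hom 0) Rg = Rg"
  "tensor_map (component hom 1) (component hom 1) Rg = 0"
  by (simp_all add: Rg_def clinear_scale[OF clinear_tensor_map] clinear_add[OF clinear_tensor_map]
      clinear_diff[OF clinear_tensor_map] tensor_map_pure clinear_component[OF grading_hom]
      component_same[OF grading_hom e_hom] component_same[OF grading_hom g_hom]
      component_other[OF grading_hom e_hom] component_other[OF grading_hom g_hom] pure_tensor_simps)

text \<open>All tensorands of \<open>Rg\<close> are even, so the odd part of the R-matrix vanishes
  and the formula reduces to \<open>Rg\<close> squared.\<close>

lemma twist_R_Rg: "twist_R H hom g Rg = unit H \<otimes> unit H"
  by (simp add: twist_R_def Rg_eq Rg_components mult2_simps Rg_Rg)

lemma twist_R_unit: "twist_R H hom g (unit H \<otimes> unit H) = Rg"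
  by (simp add: twist_R_def Rg_eq tensor_map_pure clinear_component[OF grading_hom]
      component_same[OF grading_hom e_hom] component_other[OF grading_hom e_hom] pure_tensor_simps mult2_simps)

lemma drinfeld_Rg: "drinfeld H Rg = g"
proof -
  note map = clinear_tensor_map[OF clinear_ident(1) antipode_linear]
  have "drinfeld H Rg = (1/2) *\<^sub>C (unit H + g + g - unit H)"
    unfolding drinfeld_def Rg_def
    by (simp add: clinear_scale[OF map] clinear_add[OF map] clinear_diff[OF map] map_right_simps[OF antipode_linear]
        clinear_scale[OF clinear_tensor_flip] clinear_add[OF clinear_tensor_flip] clinear_diff[OF clinear_tensor_flip]
        clinear_scale[OF clinear_tensor_lift[OF mult_bilinear]] clinear_diff[OF clinear_tensor_lift[OF mult_bilinear]]
        lift_mult_simps antipode_unit antipode_g)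
  also have "\<dots> = (1/2 + 1/2) *\<^sub>C g"
    by (simp only: scaleC_add_left) (simp add: scaleC_add_right)
  finally show ?thesis
    by (simp add: scaleC_one)
qed

abbreviation mult3
  where "mult3 \<equiv> tensor_mult (mult H) mult2"

lemmas mult3_simps = cbilinear_simps[OF cbilinear_tensor_mult[OF bilinear cbilinear_tensor_mult[OF bilinear bilinear]]]
  tensor_mult_pure[OF bilinear cbilinear_tensor_mult[OF bilinear bilinear]]

lemma comult_Rg_left:
  "tensor_assoc (tensor_map (comult H) id Rg) = mult3 (leg13 (unit H) Rg) (leg23 (unit H) Rg)"
proof -
  let ?R = "unit H \<otimes> unit H + unit H \<otimes> g + g \<otimes> unit H - g \<otimes> g"
  note lin = clinear_tensor_map[OF comult_linear clinear_ident(1)]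
  have "mult3 (leg13 (unit H) ?R) (leg23 (unit H) ?R) =
      tensor_assoc (tensor_map (comult H) id ?R) + tensor_assoc (tensor_map (comult H) id ?R)"
    by (simp add: clinear_add[OF clinear_leg13] clinear_diff[OF clinear_leg13] pure_tensor_simps mult3_simps mult2_simps
        clinear_add[OF lin] clinear_diff[OF lin] tensor_map_pure[OF comult_linear clinear_ident(1)]
        comult_unit comult_g clinear_add[OF clinear_tensor_assoc] clinear_diff[OF clinear_tensor_assoc] algebra_simps)
  then show ?thesis
    unfolding Rg_def
    by (simp only: clinear_scale[OF clinear_leg13] clinear_scale[OF clinear_leg23] mult3_simps clinear_scale[OF lin]
        clinear_scale[OF clinear_tensor_assoc] scaleC_scaleC) (simp add: quarter_double)
qed

lemma comult_Rg_right:
  "tensor_map id (comult H) Rg = mult3 (leg13 (unit H) Rg) (leg12 (unit H) Rg)"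
proof -
  let ?R = "unit H \<otimes> unit H + unit H \<otimes> g + g \<otimes> unit H - g \<otimes> g"
  note lin = clinear_tensor_map[OF clinear_ident(1) comult_linear]
  have "mult3 (leg13 (unit H) ?R) (leg12 (unit H) ?R) = tensor_map id (comult H) ?R + tensor_map id (comult H) ?R"
    by (simp add: clinear_add[OF clinear_leg13] clinear_diff[OF clinear_leg13] clinear_add[OF clinear_leg12]
        clinear_diff[OF clinear_leg12] pure_tensor_simps mult3_simps mult2_simps
        clinear_add[OF lin] clinear_diff[OF lin] tensor_map_pure[OF clinear_ident(1) comult_linear]
        comult_unit comult_g algebra_simps)
  then show ?thesis
    unfolding Rg_def
    by (simp only: clinear_scale[OF clinear_leg13] clinear_scale[OF clinear_leg12] mult3_simps clinear_scale[OF lin]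
        scaleC_scaleC) (simp add: quarter_double)
qed

text \<open>For every grouplike involution the two coproduct identities and the inverse condition
  hold by expansion; only the compatibility with the opposite comultiplication is a genuine
  condition.\<close>

lemma triangular_Rg_iff:
  assumes "hopf_algebra H"
  shows "triangular_hopf_algebra H Rg \<longleftrightarrow> (\<forall>a. braid (twist (comult H a)) = twist (comult H a))"
proof
  assume "triangular_hopf_algebra H Rg"
  then interpret triangular_hopf_algebra H Rg .
  show "\<forall>a. braid (twist (comult H a)) = twist (comult H a)"
    using comult_op by (simp add: Rg_commute_iff)
next
  assume "\<forall>a. braid (twist (comult H a)) = twist (comult H a)"
  then show "triangular_hopf_algebra H Rg"
    by (intro triangular_hopf_algebra.intro triangular_hopf_algebra_axioms.intro assms)
      (simp_all only: comult_Rg_left comult_Rg_right Rg_commute_iff flip_Rg Rg_Rg)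
qed

end

section \<open>The two directions of the correspondence, mutually inverse on single
  structures\<close>

lemma twistable_grouplike:
  assumes "hopf_algebra H" "comult H g = g \<otimes> g" "mult H g g = unit H"
  shows "twistable H g"
proof -
  interpret hopf_algebra H by fact
  show ?thesis
    by unfold_locales (simp_all add: assms comult_mult)
qed

text \<open>Each component of the grading lies in an eigenspace of conjugation by \<open>g\<close>,
  so the homogeneous decomposition of an element is also its eigenspace decomposition, which is
  unique. With \<open>g\<close> thereby even, products with \<open>g \<otimes> g\<close> carry no
  Koszul sign.\<close>

lemma
  fixes K :: "('a::complex_vector, 'm) super_hopf_scheme"
  assumes K: "hopf_superalgebra K" and g: "parity_grouplike K g"
  shows twistable_parity_grouplike: "twistable K g"
    and grade_parity_grouplike: "grade K = involution_algebra.hom (mult K) g"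
proof -
  interpret K: hopf_superalgebra K by fact
  have gg: "mult K g g = unit K" and comult_g: "comult K g = g \<otimes> g"
    using g by (auto simp: parity_grouplike_def grouplike_def)
  interpret inv: involution_algebra "mult K" "unit K" g
    by unfold_locales (simp_all add: K.mult_bilinear K.mult_assoc K.mult_unit_left K.mult_unit_right gg)
  have "inverse_of K g = g"
    by (rule inverse_of_involution[OF K.hopf_common_axioms gg])
  then have sub: "grade K i \<subseteq> inv.hom i" for i
    using g by (auto simp: parity_grouplike_def inv.hom_def)
  show grade: "grade K = inv.hom"
  proof
    fix i
    have "a \<in> grade K i" if "a \<in> inv.hom i" for a
    proof -
      have "component inv.hom i a = component (grade K) i a"
        using grading_decompose[OF K.grading, of i a]
        by (metis component_unique K.grading inv.grading_hom sub subsetD)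
      then show ?thesis
        using component_same[OF inv.grading_hom that] component_in[OF K.grading, of i a] by simp
    qed
    then show "grade K i = inv.hom i"
      using sub by blast
  qed
  show "twistable K g"
    by unfold_locales
      (simp_all add: gg comult_g K.comult_mult grade inv.super_mult_even inv.even_super_mult inv.g_hom)
qed

text \<open>For the trivial R-matrix, compatibility with the opposite comultiplication is
  cocommutativity, and the other axioms follow from the unit being even and grouplike.\<close>

lemma trivial_super_triangular:
  assumes K: "cocommutative_hopf_superalgebra K" and g: "parity_grouplike K g"
  shows "triangular_hopf_superalgebra K (unit K \<otimes> unit K)" "super_drinfeld K (unit K \<otimes> unit K) = unit K"
proof -
  interpret K: cocommutative_hopf_superalgebra K by fact
  interpret tw: twistable K g
    using K.hopf_superalgebra_axioms g by (rule twistable_parity_grouplike)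
  have grade: "grade K = tw.hom"
    using K.hopf_superalgebra_axioms g by (rule grade_parity_grouplike)
  have ee: "unit K \<otimes> unit K \<in> tw.hom2 0"
    using tw.hom2_pure[OF tw.e_hom tw.e_hom] by simp
  have braid: "tw.braid (unit K \<otimes> unit K) = unit K \<otimes> unit K"
    by (simp add: tw.braid_pure[OF tw.e_hom tw.e_hom] scaleC_one)
  have mult: "tw.super_mult2 t (unit K \<otimes> unit K) = t" "tw.super_mult2 (unit K \<otimes> unit K) t = t" for t
    by (simp_all add: tw.super_mult_even[OF tw.e_hom] tw.even_super_mult[OF tw.e_hom])
  note super3 = super_tensor_mult_pure[OF tw.grading_hom tw.grading_hom2 tw.bilinear tw.bilinear_super_mult2
    tw.e_hom ee]
  show "triangular_hopf_superalgebra K (unit K \<otimes> unit K)"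
    using K.cocommutative
    by unfold_locales (simp_all add: grade ee braid mult super3 scaleC_one tensor_map_pure K.comult_linear
        clinear_ident K.comult_unit)
  show "super_drinfeld K (unit K \<otimes> unit K) = unit K"
    by (simp add: super_drinfeld_def grade tensor_map_pure K.antipode_linear clinear_ident K.antipode_unit braid
        tensor_lift_pure[OF K.mult_bilinear])
qed

lemma with_trivial_R_subset: "with_trivial_R ` cocommutative_pairs \<subseteq> super_triangular_pairs"
  using trivial_super_triangular
  by (auto simp: with_trivial_R_def cocommutative_pairs_def super_triangular_pairs_def)

text \<open>The Hopf structure produced by \<open>to_super\<close>, with \<open>g\<close> as an
  argument in place of the Drinfeld element.\<close>

definition superize :: "'a::complex_vector hopf \<Rightarrow> 'a \<Rightarrow> 'a super_hopf"
  where "superize H g = \<lparr>mult = mult H, unit = unit H, comult = twist_comult H (Ad_grading H g) g,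
    counit = counit H, antipode = twist_antipode H (Ad_grading H g) g, grade = Ad_grading H g\<rparr>"

definition ordinarize :: "'a::complex_vector super_hopf \<Rightarrow> 'a \<Rightarrow> 'a hopf"
  where "ordinarize K g = \<lparr>mult = mult K, unit = unit K, comult = twist_comult K (grade K) g,
    counit = counit K, antipode = twist_antipode K (grade K) g\<rparr>"

lemma superize_simps [simp]:
  "mult (superize H g) = mult H" "unit (superize H g) = unit H"
  "comult (superize H g) = twist_comult H (Ad_grading H g) g" "counit (superize H g) = counit H"
  "antipode (superize H g) = twist_antipode H (Ad_grading H g) g" "grade (superize H g) = Ad_grading H g"
  by (simp_all add: superize_def)

lemma ordinarize_simps [simp]:
  "mult (ordinarize K g) = mult K" "unit (ordinarize K g) = unit K"
  "comult (ordinarize K g) = twist_comult K (grade K) g" "counit (ordinarize K g) = counit K"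
  "antipode (ordinarize K g) = twist_antipode K (grade K) g"
  by (simp_all add: ordinarize_def)

text \<open>The working form of rank at most 2. The choice \<open>g = unit H\<close> is allowed and
  covers the trivial R-matrix.\<close>

definition involution_triangular :: "('a::complex_vector, 'm) hopf_scheme \<Rightarrow> 'a \<Rightarrow> bool"
  where "involution_triangular H g \<longleftrightarrow>
    triangular_hopf_algebra H (R_of H g) \<and> grouplike H g \<and> mult H g g = unit H"

text \<open>\<open>superize\<close> keeps the product and \<open>g\<close>, hence also the
  eigenspace grading and F. The second twist is therefore by the same involution and undoes the
  first.\<close>

lemma
  assumes H: "involution_triangular H g"
  shows to_super_involution: "to_super (H, R_of H g) = ((superize H g, unit H \<otimes> unit H), g)"
    and superize_cocommutative: "(superize H g, g) \<in> cocommutative_pairs"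
    and ordinarize_superize: "ordinarize (superize H g) g = H"
    and drinfeld_R_of: "drinfeld H (R_of H g) = g"
proof -
  from H interpret H: triangular_hopf_algebra H "R_of H g"
    by (simp add: involution_triangular_def)
  have g: "comult H g = g \<otimes> g" "g \<noteq> 0" "mult H g g = unit H"
    using H by (auto simp: involution_triangular_def grouplike_def)
  interpret tw: twistable H g
    using H.hopf_algebra_axioms g(1,3) by (rule twistable_grouplike)
  have comult: "comult (superize H g) a = tw.twist (comult H a)" for a
    by (simp add: tw.Ad_grading_eq tw.twist_comult_eq)
  show drinfeld: "drinfeld H (R_of H g) = g"
    by (simp add: tw.Rg_eq tw.drinfeld_Rg)
  then show "to_super (H, R_of H g) = ((superize H g, unit H \<otimes> unit H), g)"
    by (simp add: to_super_def superize_def Let_def tw.Ad_grading_eq tw.Rg_eq tw.twist_R_Rg)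
  have super: "hopf_superalgebra (superize H g)"
    by (rule tw.hopf_superalgebra_twist[OF H.hopf_algebra_axioms]) (simp_all add: tw.Ad_grading_eq)
  have "\<forall>a. tw.braid (tw.twist (comult H a)) = tw.twist (comult H a)"
    using tw.triangular_Rg_iff[OF H.hopf_algebra_axioms] H.triangular_hopf_algebra_axioms by (simp add: tw.Rg_eq)
  then have cocomm: "cocommutative_hopf_superalgebra (superize H g)"
    by (intro cocommutative_hopf_superalgebra.intro super cocommutative_hopf_superalgebra_axioms.intro)
      (simp only: comult superize_simps(6) tw.Ad_grading_eq)
  have pg: "parity_grouplike (superize H g) g"
    using g tw.twist_pure[OF tw.g_hom, of g] inverse_of_involution[OF H.hopf_common_axioms g(3)]
    by (auto simp: parity_grouplike_def grouplike_def tw.Ad_grading_eq tw.twist_comult_eq tw.hom_def inverse_of_def)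
  then show "(superize H g, g) \<in> cocommutative_pairs"
    using cocomm by (simp add: cocommutative_pairs_def)
  interpret super: twistable "superize H g" g
    using super pg by (rule twistable_parity_grouplike)
  have "comult (ordinarize (superize H g) g) = comult H"
    using super.twist_comult_eq by (simp add: fun_eq_iff tw.Ad_grading_eq tw.twist_comult_eq)
  moreover have "antipode (ordinarize (superize H g) g) = antipode H"
    using tw.twist_antipode_involution[of "superize H g"] by (simp add: tw.Ad_grading_eq)
  ultimately show "ordinarize (superize H g) g = H"
    by (intro hopf.equality) simp_all
qed

lemma
  assumes "(K, g) \<in> cocommutative_pairs"
  shows from_super_trivial: "from_super (with_trivial_R (K, g)) = (ordinarize K g, R_of (ordinarize K g) g)"
    and ordinarize_triangular: "involution_triangular (ordinarize K g) g"
    and superize_ordinarize: "superize (ordinarize K g) g = K"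
proof -
  from assms interpret K: cocommutative_hopf_superalgebra K
    by (simp add: cocommutative_pairs_def)
  have pg: "parity_grouplike K g"
    using assms by (simp add: cocommutative_pairs_def)
  interpret tw: twistable K g
    using K.hopf_superalgebra_axioms pg by (rule twistable_parity_grouplike)
  have grade: "grade K = tw.hom"
    using K.hopf_superalgebra_axioms pg by (rule grade_parity_grouplike)
  let ?O = "ordinarize K g"
  show "from_super (with_trivial_R (K, g)) = (?O, R_of ?O g)"
    using tw.twist_R_unit by (simp add: from_super_def with_trivial_R_def Let_def ordinarize_def grade tw.Rg_def R_of_def)
  have O: "hopf_algebra ?O"
    by (rule tw.hopf_algebra_twist) (simp_all add: grade K.comult_mult)
  have comult: "comult ?O a = tw.twist (comult K a)" for a
    by (simp add: grade tw.twist_comult_eq)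
  have g: "comult ?O g = g \<otimes> g" "mult ?O g g = unit ?O" "g \<noteq> 0"
    using pg tw.twist_pure[OF tw.g_hom, of g] unfolding comult
    by (auto simp: parity_grouplike_def grouplike_def)
  interpret O: twistable ?O g
    using O g(1,2) by (rule twistable_grouplike)
  have "triangular_hopf_algebra ?O O.Rg"
    unfolding O.triangular_Rg_iff[OF O] comult using K.cocommutative by (simp add: grade)
  then show "involution_triangular ?O g"
    using g unfolding involution_triangular_def O.Rg_eq grouplike_def by blast
  have Ad: "Ad_grading ?O g = tw.hom"
    using O.Ad_grading_eq by simp
  have "comult (superize ?O g) = comult K"
    using O.twist_comult_eq by (simp add: fun_eq_iff Ad grade tw.twist_comult_eq)
  moreover have "antipode (superize ?O g) = antipode K"
    using tw.twist_antipode_involution[of ?O] by (simp add: Ad grade)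
  ultimately show "superize ?O g = K"
    by (intro super_hopf.equality hopf.equality) (simp_all add: Ad grade)
qed

subsection \<open>R-matrices of rank at most 2\<close>

definition tensor_functional :: "('a::complex_vector \<Rightarrow> complex) \<Rightarrow> ('b::complex_vector \<Rightarrow> complex) \<Rightarrow> ('a, 'b) tensor \<Rightarrow> complex"
  where "tensor_functional \<phi> \<psi> = tensor_lift (\<lambda>a b. \<phi> a * \<psi> b)"

lemma
  assumes "clinear \<phi>" "clinear \<psi>"
  shows clinear_tensor_functional: "clinear (tensor_functional \<phi> \<psi>)"
    and tensor_functional_pure: "tensor_functional \<phi> \<psi> (a \<otimes> b) = \<phi> a * \<psi> b"
proof -
  have "cbilinear (\<lambda>a b. \<phi> a * \<psi> b)"
    by (intro cbilinearI) (simp_all add: clinear_add[OF assms(1)] clinear_scale[OF assms(1)]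
      clinear_add[OF assms(2)] clinear_scale[OF assms(2)] algebra_simps)
  then show "clinear (tensor_functional \<phi> \<psi>)" "tensor_functional \<phi> \<psi> (a \<otimes> b) = \<phi> a * \<psi> b"
    unfolding tensor_functional_def by (simp_all only: clinear_tensor_lift tensor_lift_pure)
qed

lemma in_span_pair: "x \<in> complex_vector.span {v, w} \<longleftrightarrow> (\<exists>a b. x = a *\<^sub>C v + b *\<^sub>C w)"
proof -
  have "x - a *\<^sub>C v - b *\<^sub>C w = 0 \<longleftrightarrow> x = a *\<^sub>C v + b *\<^sub>C w" for a b
    by (simp add: algebra_simps)
  then show ?thesis
    by (simp add: complex_vector.span_breakdown_eq)
qed

lemma tensor_square_pair:
  assumes "t \<in> tensor_square (complex_vector.span {v, w})"
  shows "\<exists>a b c d. t = a *\<^sub>C (v \<otimes> v) + b *\<^sub>C (v \<otimes> w) + c *\<^sub>C (w \<otimes> v) + d *\<^sub>C (w \<otimes> w)"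
  using assms
proof (induction rule: complex_vector.span_induct_alt)
  case base
  show ?case
    by (intro exI[of _ 0]) simp
next
  case (step k x y)
  then obtain p q r s where x: "x = (p *\<^sub>C v + q *\<^sub>C w) \<otimes> (r *\<^sub>C v + s *\<^sub>C w)"
    by (auto simp: in_span_pair)
  obtain a b c d where y: "y = a *\<^sub>C (v \<otimes> v) + b *\<^sub>C (v \<otimes> w) + c *\<^sub>C (w \<otimes> v) + d *\<^sub>C (w \<otimes> w)"
    using step by blast
  show ?case
    by (intro exI[of _ "k * p * r + a"] exI[of _ "k * p * s + b"] exI[of _ "k * q * r + c"] exI[of _ "k * q * s + d"])
      (simp add: x y pure_tensor_simps scaleC_add_left scaleC_add_right scaleC_scaleC algebra_simps)
qed

text \<open>The span of 1 and \<open>g\<close> is a Hopf subalgebra whose tensor square contains the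
  R-matrix, so it bounds the subalgebra generated by the tensorands.\<close>

lemma R_rank_involution:
  assumes "involution_triangular H g"
  shows "R_rank H (R_of H g) \<le> 2"
proof -
  from assms interpret H: triangular_hopf_algebra H "R_of H g"
    by (simp add: involution_triangular_def)
  have g: "comult H g = g \<otimes> g" "mult H g g = unit H"
    using assms by (auto simp: involution_triangular_def grouplike_def)
  interpret tw: twistable H g
    using H.hopf_algebra_axioms g by (rule twistable_grouplike)
  let ?B = "complex_vector.span {unit H, g}"
  have base: "unit H \<in> ?B" "g \<in> ?B"
    by (auto intro: complex_vector.span_base)
  have pure: "a \<otimes> b \<in> tensor_square ?B" if "a \<in> ?B" "b \<in> ?B" for a b
    using that by (intro complex_vector.span_base) blast
  have lc: "a *\<^sub>C unit H + b *\<^sub>C g \<in> ?B" for a b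
    using in_span_pair by blast
  have sub: "hopf_subalgebra H ?B"
    unfolding hopf_subalgebra_def
  proof (intro conjI ballI)
    show "complex_vector.subspace ?B"
      by (rule complex_vector.subspace_span)
    show "unit H \<in> ?B"
      by (rule base)
    fix x
    assume "x \<in> ?B"
    then obtain a b where x: "x = a *\<^sub>C unit H + b *\<^sub>C g"
      using in_span_pair by blast
    have "comult H x = a *\<^sub>C (unit H \<otimes> unit H) + b *\<^sub>C (g \<otimes> g)"
      by (simp add: x H.lin_simps g H.comult_unit)
    then show "comult H x \<in> tensor_square ?B"
      using pure base by (auto intro!: complex_vector.span_add complex_vector.span_scale)
    show "antipode H x \<in> ?B"
      using lc by (simp add: x H.lin_simps H.antipode_unit tw.antipode_g)
    fix y
    assume "y \<in> ?B"
    then obtain c d where y: "y = c *\<^sub>C unit H + d *\<^sub>C g"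
      using in_span_pair by blast
    have "mult H x y = (a * c + b * d) *\<^sub>C unit H + (a * d + b * c) *\<^sub>C g"
      by (simp add: x y H.mult_simps scaleC_add_right scaleC_add_left scaleC_scaleC algebra_simps)
    then show "mult H x y \<in> ?B"
      using lc by simp
  qed
  have "R_of H g \<in> tensor_square ?B"
    unfolding R_of_def
    using pure base by (auto intro!: complex_vector.span_add complex_vector.span_diff complex_vector.span_scale)
  then have "tensorands (R_of H g) \<subseteq> ?B"
    by (rule tensorands_subset) (rule complex_vector.subspace_span)
  then have le: "hopf_generated H (tensorands (R_of H g)) \<subseteq> ?B"
    using sub unfolding hopf_generated_def by blast
  have "complex_vector.dim (hopf_generated H (tensorands (R_of H g))) \<le> card {unit H, g}"
    using le by (rule complex_vector.dim_le_card) simp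
  also have "\<dots> \<le> 2"
    by (simp add: card_insert_if)
  finally have "enat (complex_vector.dim (hopf_generated H (tensorands (R_of H g)))) \<le> 2"
    by (simp add: numeral_eq_enat)
  then show ?thesis
    using le unfolding R_rank_def edim_def by (auto intro: exI[of _ "{unit H, g}"])
qed

text \<open>Extending \<open>u\<close> to a basis of \<open>V\<close> adds at most one vector; if it
  adds none, \<open>y = u\<close> serves.\<close>

lemma edim_le_2_span:
  assumes V: "complex_vector.subspace V" "edim V \<le> 2" and u: "u \<in> V" "u \<noteq> 0"
  obtains y where "y \<in> V" "V = complex_vector.span {u, y}"
proof -
  obtain F where F: "finite F" "V \<subseteq> complex_vector.span F" and dim: "complex_vector.dim V \<le> 2"
    using V(2) by (auto simp: edim_def numeral_eq_enat split: if_splits)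
  have "complex_vector.independent {u}"
    using u by simp
  then obtain C where C: "{u} \<subseteq> C" "C \<subseteq> V" "complex_vector.independent C" "V \<subseteq> complex_vector.span C"
    using complex_vector.maximal_independent_subset_extend[of "{u}" V] u by auto
  have fin: "finite C"
    using complex_vector.independent_span_bound[OF F(1) C(3)] C(2) F(2) by blast
  have "card C \<le> 2"
    using complex_vector.basis_card_eq_dim[OF C(2,4,3)] dim by simp
  then have "card (C - {u}) \<le> 1"
    using C(1) fin by simp
  then have eq: "y = z" if "y \<in> C - {u}" "z \<in> C - {u}" for y z
    using that fin card_le_Suc0_iff_eq[of "C - {u}"] by auto
  have "\<exists>y\<in>V. C \<subseteq> {u, y}"
  proof (cases "C - {u} = {}")
    case True
    then show ?thesis
      using u by blast
  next
    case False
    then obtain y where "y \<in> C - {u}"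
      by blast
    then show ?thesis
      using C(2) eq by blast
  qed
  then obtain y where y: "y \<in> V" "C \<subseteq> {u, y}"
    by blast
  have "V \<subseteq> complex_vector.span {u, y}"
    using C(4) complex_vector.span_mono[OF y(2)] by blast
  moreover have "complex_vector.span {u, y} \<subseteq> V"
    using u y V(1) by (intro complex_vector.span_minimal) auto
  ultimately show thesis
    using that y by blast
qed

text \<open>Normalizing the second basis vector to \<open>\<epsilon>(x) = 0\<close> gives \<open>\<Delta>(x) = 1 \<otimes> x + x \<otimes> 1 + \<mu> x \<otimes> x\<close> and
  \<open>x\<^sup>2 = \<lambda> x\<close>. Multiplicativity of \<open>\<Delta>\<close> leaves \<open>\<mu> \<lambda> \<in> {-1, -2}\<close>, the antipode excludes \<open>-1\<close>, and
  \<open>g = 1 + \<mu> x\<close>.\<close>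

lemma (in hopf_algebra) two_dimensional_grouplike:
  assumes B: "hopf_subalgebra H B" "B = complex_vector.span {unit H, y}"
  obtains g where "comult H g = g \<otimes> g" "mult H g g = unit H" "B \<subseteq> complex_vector.span {unit H, g}"
proof -
  let ?e = "unit H"
  define x where "x = y - counit H y *\<^sub>C ?e"
  have eps: "counit H x = 0"
    by (simp add: x_def lin_simps counit_unit)
  have Bx: "B = complex_vector.span {?e, x}"
  proof -
    have "a *\<^sub>C ?e + b *\<^sub>C x = (a - b * counit H y) *\<^sub>C ?e + b *\<^sub>C y"
      "a *\<^sub>C ?e + b *\<^sub>C y = (a + b * counit H y) *\<^sub>C ?e + b *\<^sub>C x" for a b
      by (simp_all add: x_def complex_vector.scale_left_diff_distrib complex_vector.scale_right_diff_distrib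
          scaleC_add_left scaleC_scaleC)
    note eqs = this
    have "z \<in> complex_vector.span {?e, y}" if z: "z \<in> complex_vector.span {?e, x}" for z
    proof -
      obtain a b where "z = a *\<^sub>C ?e + b *\<^sub>C x"
        using z in_span_pair by blast
      then show ?thesis
        unfolding eqs(1) in_span_pair by blast
    qed
    moreover have "z \<in> complex_vector.span {?e, x}" if z: "z \<in> complex_vector.span {?e, y}" for z
    proof -
      obtain a b where "z = a *\<^sub>C ?e + b *\<^sub>C y"
        using z in_span_pair by blast
      then show ?thesis
        unfolding eqs(2) in_span_pair by blast
    qed
    ultimately have "complex_vector.span {?e, x} = complex_vector.span {?e, y}"
      by blast
    then show ?thesis
      by (simp add: B(2))
  qed
  show thesis
  proof (cases "x = 0")
    case True
    then show thesis
      using that[of ?e] by (simp add: Bx comult_unit mult_unit_left complex_vector.span_insert_0 insert_commute)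
  next
    case False
    have xB: "x \<in> B"
      by (simp add: Bx complex_vector.span_base)
    have "x \<notin> complex_vector.span {?e}"
    proof
      assume "x \<in> complex_vector.span {?e}"
      then obtain k where k: "x = k *\<^sub>C ?e"
        by (auto simp: complex_vector.span_singleton)
      then have "k = 0"
        using eps by (simp add: lin_simps counit_unit)
      then show False
        using k False by simp
    qed
    \<comment> \<open>\<open>\<phi>\<close> reads off the coefficient of \<open>x\<close> in the
      basis 1, \<open>x\<close>, just as the counit reads off that of 1.\<close>
    then obtain \<phi> :: "'a \<Rightarrow> complex" where \<phi>: "clinear \<phi>" "\<phi> x = 1" "\<phi> ?e = 0"
      by (rule functional_separates) blast
    note \<phi>_simps = clinear_add[OF \<phi>(1)] clinear_scale[OF \<phi>(1)] clinear_zero[OF \<phi>(1)] \<phi>(2,3)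
    have "comult H x \<in> tensor_square (complex_vector.span {?e, x})"
      using B(1) xB unfolding Bx hopf_subalgebra_def by blast
    then obtain a b c \<mu> where
      comult: "comult H x = a *\<^sub>C (?e \<otimes> ?e) + b *\<^sub>C (?e \<otimes> x) + c *\<^sub>C (x \<otimes> ?e) + \<mu> *\<^sub>C (x \<otimes> x)"
      using tensor_square_pair by blast
    have left: "a *\<^sub>C ?e + b *\<^sub>C x = x"
      using counit_left[of x] unfolding comult
      by (simp add: tensor_lift_add[OF cbilinear_counit_left] tensor_lift_scale[OF cbilinear_counit_left]
          tensor_lift_pure[OF cbilinear_counit_left] eps counit_unit scaleC_one)
    have right: "a *\<^sub>C ?e + c *\<^sub>C x = x"
      using counit_right[of x] unfolding comult
      by (simp add: tensor_lift_add[OF cbilinear_counit_right] tensor_lift_scale[OF cbilinear_counit_right]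
          tensor_lift_pure[OF cbilinear_counit_right] eps counit_unit scaleC_one)
    have "a = 0" "b = 1" "c = 1"
      using arg_cong[OF left, of "counit H"] arg_cong[OF left, of \<phi>] arg_cong[OF right, of \<phi>]
      by (simp_all add: lin_simps eps counit_unit \<phi>_simps)
    then have comult: "comult H x = ?e \<otimes> x + x \<otimes> ?e + \<mu> *\<^sub>C (x \<otimes> x)"
      by (simp add: comult scaleC_one)
    have "mult H x x \<in> complex_vector.span {?e, x}"
      using B(1) xB unfolding Bx hopf_subalgebra_def by blast
    then obtain k l where xx: "mult H x x = k *\<^sub>C ?e + l *\<^sub>C x"
      using in_span_pair by blast
    have "k = 0"
      using counit_mult[of x x] by (simp add: xx lin_simps eps counit_unit)
    then have xx: "mult H x x = l *\<^sub>C x"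
      by (simp add: xx)
    have "antipode H x \<in> complex_vector.span {?e, x}"
      using B(1) xB unfolding Bx hopf_subalgebra_def by blast
    then obtain p s where S: "antipode H x = p *\<^sub>C ?e + s *\<^sub>C x"
      using in_span_pair by blast
    note lift = tensor_lift_scale[OF mult_bilinear] lift_mult_simps
      clinear_scale[OF clinear_tensor_map[OF antipode_linear clinear_ident(1)]]
    \<comment> \<open>The antipode axiom at \<open>x\<close>. Its coefficient of 1 gives
      \<open>p = 0\<close>, its coefficient of \<open>x\<close> then gives
      \<open>s * (\<mu> * l + 1) = - 1\<close>.\<close>
    have anti: "x + (p *\<^sub>C ?e + s *\<^sub>C x) + \<mu> *\<^sub>C (p *\<^sub>C x + s *\<^sub>C l *\<^sub>C x) = 0"
      using antipode_left[of x]
      by (simp add: comult map_left_simps[OF antipode_linear] lift S antipode_unit mult_unit_left mult_unit_right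
          mult_simps xx eps)
    have "p = 0"
      using arg_cong[OF anti, of "counit H"] by (simp add: lin_simps eps counit_unit)
    then have "1 + s + \<mu> * (s * l) = 0"
      using arg_cong[OF anti, of \<phi>] by (simp add: \<phi>_simps)
    moreover have "s * (\<mu> * l + 1) = (1 + s + \<mu> * (s * l)) - 1"
      by (simp add: algebra_simps)
    ultimately have "s * (\<mu> * l + 1) = - 1"
      by simp
    then have ne: "\<mu> * l + 1 \<noteq> 0"
      by auto
    let ?f = "tensor_functional \<phi> \<phi>"
    note f = clinear_tensor_functional[OF \<phi>(1,1)]
    \<comment> \<open>The coefficient of \<open>x \<otimes> x\<close> in the comultiplication of
      \<open>x x\<close>, computed first from \<open>x x = l x\<close> and then from
      multiplicativity.\<close>
    have "?f (comult H (mult H x x)) = l * \<mu>"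
      by (simp add: xx lin_simps comult clinear_add[OF f] clinear_scale[OF f]
          tensor_functional_pure[OF \<phi>(1,1)] \<phi>_simps)
    moreover have "?f (comult H (mult H x x)) = 2 + 4 * (\<mu> * l) + (\<mu> * l)\<^sup>2"
      unfolding comult_mult comult
      by (simp add: cbilinear_simps[OF cbilinear_tensor_mult[OF mult_bilinear mult_bilinear]]
          tensor_mult_pure[OF mult_bilinear mult_bilinear] clinear_add[OF f] clinear_scale[OF f]
          tensor_functional_pure[OF \<phi>(1,1)] \<phi>_simps mult_unit_left mult_unit_right xx power2_eq_square
          algebra_simps)
    moreover have "(\<mu> * l + 1) * (\<mu> * l + 2) = (2 + 4 * (\<mu> * l) + (\<mu> * l)\<^sup>2) - l * \<mu>"
      by (simp add: power2_eq_square algebra_simps)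
    ultimately have "(\<mu> * l + 1) * (\<mu> * l + 2) = 0"
      by simp
    then have ml: "\<mu> * l = - 2"
      using ne by (simp add: eq_neg_iff_add_eq_0)
    then have "\<mu> \<noteq> 0"
      by auto
    define g where "g = ?e + \<mu> *\<^sub>C x"
    have "mult H g g = ?e + (\<mu> *\<^sub>C x + (\<mu> *\<^sub>C x + (\<mu> * (\<mu> * l)) *\<^sub>C x))"
      by (simp add: g_def mult_simps mult_unit_left mult_unit_right xx scaleC_scaleC scaleC_add_right add.assoc)
    also have "\<mu> *\<^sub>C x + (\<mu> *\<^sub>C x + (\<mu> * (\<mu> * l)) *\<^sub>C x) = (\<mu> + (\<mu> + \<mu> * (\<mu> * l))) *\<^sub>C x"
      by (simp only: scaleC_add_left)
    finally have "mult H g g = ?e"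
      by (simp add: ml)
    moreover have "comult H g = g \<otimes> g"
      by (simp add: g_def lin_simps comult comult_unit pure_tensor_simps scaleC_add_right algebra_simps)
    moreover have "B \<subseteq> complex_vector.span {?e, g}"
    proof
      fix z
      assume "z \<in> B"
      then obtain a b where "z = a *\<^sub>C ?e + b *\<^sub>C x"
        unfolding Bx in_span_pair by blast
      then have "z = (a - b / \<mu>) *\<^sub>C ?e + (b / \<mu>) *\<^sub>C g"
        using \<open>\<mu> \<noteq> 0\<close>
        by (simp add: g_def scaleC_add_right scaleC_scaleC complex_vector.scale_left_diff_distrib)
      then show "z \<in> complex_vector.span {?e, g}"
        using in_span_pair by blast
    qed
    ultimately show thesis
      using that by blast
  qed
qed

text \<open>On the characters of \<open>span {1, g}\<close>, which form a group of order 2, \<open>R\<close> is an invertible bicharacter.\<close>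

lemma (in triangular_hopf_algebra) R_matrix_of_involution:
  assumes g: "comult H g = g \<otimes> g" "mult H g g = unit H"
    and R: "R \<in> tensor_square (complex_vector.span {unit H, g})"
  shows "R = R_of H g \<or> R = R_of H (unit H)"
proof -
  let ?e = "unit H"
  have half: "(1/2) *\<^sub>C (z + z) = z" for z :: "('a, 'a) tensor"
  proof -
    have "(1/2) *\<^sub>C (z + z) = (1/2 + 1/2) *\<^sub>C z"
      by (simp only: scaleC_add_left scaleC_add_right)
    then show ?thesis
      by (simp add: scaleC_one)
  qed
  have R_unit: "R_of H ?e = ?e \<otimes> ?e"
    by (simp add: R_of_def half)
  interpret tw: twistable H g
    using hopf_algebra_axioms g by (rule twistable_grouplike)
  obtain a b c d where R: "R = a *\<^sub>C (?e \<otimes> ?e) + b *\<^sub>C (?e \<otimes> g) + c *\<^sub>C (g \<otimes> ?e) + d *\<^sub>C (g \<otimes> g)"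
    using tensor_square_pair[OF R] by blast
  \<comment> \<open>Write r(i, j) for the value of \<open>R\<close> under
    \<open>\<chi> i \<otimes> \<chi> j\<close>. As \<open>g\<close> is grouplike, comultiplying a
    leg multiplies the values at \<open>g\<close>, so the equations say r(ij, k) = r(i, k) r(j, k),
    r(i, jk) = r(i, j) r(i, k) and r(i, j) r(j, i) = 1.\<close>
  have key: "a + s k * b + s i * s j * c + s i * s j * s k * d =
        (a + s k * b + s i * c + s i * s k * d) * (a + s k * b + s j * c + s j * s k * d)"
      "a + s i * c + s j * s k * b + s j * s k * s i * d =
        (a + s j * b + s i * c + s i * s j * d) * (a + s k * b + s i * c + s i * s k * d)"
      "(a + s j * b + s i * c + s i * s j * d) * (a + s i * b + s j * c + s i * s j * d) = 1"
    if \<chi>: "\<And>i. clinear (\<chi> i)" "\<And>i. \<chi> i ?e = 1" "\<And>i. \<chi> i g = s i" and s: "\<And>i. s i * s i = 1"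
    for \<chi> :: "bit \<Rightarrow> 'a \<Rightarrow> complex" and s i j k
  proof -
    let ?f = "tensor_functional (\<chi> i) (tensor_functional (\<chi> j) (\<chi> k))"
    note f2 = clinear_tensor_functional[OF \<chi>(1,1)]
    note f3 = clinear_tensor_functional[OF \<chi>(1) f2]
    note lin = clinear_add[OF f3] clinear_scale[OF f3] tensor_functional_pure[OF \<chi>(1) f2]
      tensor_functional_pure[OF \<chi>(1,1)] clinear_add[OF clinear_tensor_assoc] clinear_scale[OF clinear_tensor_assoc]
      clinear_add[OF clinear_leg12] clinear_scale[OF clinear_leg12] clinear_add[OF clinear_leg13]
      clinear_scale[OF clinear_leg13] pure_tensor_simps tw.mult3_simps tw.mult2_simps \<chi>(2,3) s
      comult_unit g
    have s': "s i * (s i * z) = z" for i z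
      using s[of i] by (simp flip: mult.assoc)
    show "a + s k * b + s i * s j * c + s i * s j * s k * d =
        (a + s k * b + s i * c + s i * s k * d) * (a + s k * b + s j * c + s j * s k * d)"
      using arg_cong[OF comult_R_left, of ?f] unfolding R
      by (simp add: lin map_left_simps[OF comult_linear] s'
          clinear_scale[OF clinear_tensor_map[OF comult_linear clinear_ident(1)]] algebra_simps)
    show "a + s i * c + s j * s k * b + s j * s k * s i * d =
        (a + s j * b + s i * c + s i * s j * d) * (a + s k * b + s i * c + s i * s k * d)"
      using arg_cong[OF comult_R_right, of ?f] unfolding R
      by (simp add: lin map_right_simps[OF comult_linear] s'
          clinear_scale[OF clinear_tensor_map[OF clinear_ident(1) comult_linear]] algebra_simps)
    show "(a + s j * b + s i * c + s i * s j * d) * (a + s i * b + s j * c + s i * s j * d) = 1"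
      using arg_cong[OF R_flip_right, of "tensor_functional (\<chi> i) (\<chi> j)"] unfolding R
      by (simp add: lin clinear_add[OF clinear_tensor_flip] clinear_scale[OF clinear_tensor_flip] s'
          clinear_add[OF f2] clinear_scale[OF f2] algebra_simps)
  qed
  show ?thesis
  proof (cases "g = ?e")
    case True
    have "R = (a + b + c + d) *\<^sub>C (?e \<otimes> ?e)"
      by (simp add: R True scaleC_add_left)
    \<comment> \<open>The value is idempotent by the coproduct axiom and has square 1 by the inverse
      axiom.\<close>
    moreover have "a + b + c + d = 1"
      using key(1)[of "\<lambda>_. counit H" "\<lambda>_. 1"] key(3)[of "\<lambda>_. counit H" "\<lambda>_. 1"] counit_unit counit_linear
      by (auto simp: True)
    ultimately show ?thesis
      by (simp add: R_unit scaleC_one)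
  next
    case False
    have "g \<notin> complex_vector.span {?e}"
    proof
      assume "g \<in> complex_vector.span {?e}"
      then obtain k where k: "g = k *\<^sub>C ?e"
        by (auto simp: complex_vector.span_singleton)
      then have "k = 1"
        using tw.counit_g by (simp add: lin_simps counit_unit)
      then show False
        using k False by (simp add: scaleC_one)
    qed
    then obtain \<phi> :: "'a \<Rightarrow> complex" where \<phi>: "clinear \<phi>" "\<phi> g = 1" "\<phi> ?e = 0"
      by (rule functional_separates) blast
    \<comment> \<open>Linear functionals on the whole space that restrict to the two characters of
      \<open>{1, g}\<close>; only their values at 1 and \<open>g\<close> matter, as \<open>R\<close>
      lies in the tensor square of the span.\<close>
    define \<chi> where "\<chi> = (\<lambda>i x. counit H x + (sign i - 1) * \<phi> x)"
    have \<chi>: "clinear (\<chi> i)" "\<chi> i ?e = 1" "\<chi> i g = sign i" for i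
      unfolding \<chi>_def
      by (intro clinearI; simp add: lin_simps clinear_add[OF \<phi>(1)] clinear_scale[OF \<phi>(1)] algebra_simps)
        (simp_all add: \<phi> tw.counit_g counit_unit)
    note key = key[of \<chi> sign, OF \<chi> sign_sign]
    \<comment> \<open>The values of \<open>R\<close> on pairs of characters. A bicharacter of a
      group of order 2 is 1 as soon as one argument is trivial, and its last value is 1 or -1; these
      two cases are the two R-matrices.\<close>
    define r00 r01 r10 r11 where r: "r00 = a + b + c + d" "r01 = a - b + c - d" "r10 = a + b - c - d" "r11 = a - b - c + d"
    have "r00 = r00 * r00"
      using key(1)[of 0 0 0] by (simp add: r)
    moreover have "r00 * r00 = 1"
      using key(3)[of 0 0] by (simp add: r)
    moreover have "r01 = r01 * r01"
      using key(1)[of 1 0 0] by (simp add: r)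
    moreover have "r01 * r10 = 1"
      using key(3)[of 1 0] by (simp add: r)
    moreover have "r10 = r10 * r10"
      using key(2)[of 1 0 0] by (simp add: r diff_add_eq)
    moreover have "r01 = r11 * r11"
      using key(1)[of 1 1 1] by (simp add: r)
    ultimately have "r00 = 1" "r01 = 1" "r10 = 1" "r11 * r11 = 1"
      by (metis mult.assoc mult.commute mult_1)+
    moreover have "r11 = 1 \<or> r11 = - 1"
      using \<open>r11 * r11 = 1\<close> by (simp add: square_eq_1_iff)
    ultimately consider "a = 1" "b = 0" "c = 0" "d = 0" | "a = 1/2" "b = 1/2" "c = 1/2" "d = - 1/2"
    proof -
      assume "r00 = 1" "r01 = 1" "r10 = 1" "r11 = 1 \<or> r11 = - 1"
      \<comment> \<open>Fourier inversion on the product of two groups of order 2.\<close>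
      moreover have "a = (r00 + r01 + r10 + r11) / 4" "b = (r00 - r01 + r10 - r11) / 4"
        "c = (r00 + r01 - r10 - r11) / 4" "d = (r00 - r01 - r10 + r11) / 4"
        by (simp_all add: r)
      ultimately have "r11 = 1 \<and> a = 1 \<and> b = 0 \<and> c = 0 \<and> d = 0 \<or>
          r11 = - 1 \<and> a = 1/2 \<and> b = 1/2 \<and> c = 1/2 \<and> d = - 1/2"
        by (elim disjE) simp_all
      then show thesis
        using that by blast
    qed
    then show ?thesis
    proof cases
      case 1
      then show ?thesis
        by (simp add: R R_unit scaleC_one)
    next
      case 2
      have "R = R_of H g"
        unfolding R 2 R_of_def by (simp add: scaleC_add_right complex_vector.scale_right_diff_distrib)
      then show ?thesis
        by blast
    qed
  qed
qed

lemma rank_le_2_involution: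
  assumes "triangular_hopf_algebra H R" "R_rank H R \<le> 2"
  obtains g where "R = R_of H g" "involution_triangular H g"
proof -
  interpret triangular_hopf_algebra H R by fact
  let ?B = "hopf_generated H (tensorands R)"
  have B: "hopf_subalgebra H ?B"
    by (rule hopf_subalgebra_generated)
  then have "complex_vector.subspace ?B" "unit H \<in> ?B" "edim ?B \<le> 2"
    using assms(2) by (simp_all add: R_rank_def hopf_subalgebra_def)
  then obtain y where "?B = complex_vector.span {unit H, y}"
    using edim_le_2_span[of ?B "unit H"] unit_nonzero by metis
  from two_dimensional_grouplike[OF B this] obtain g where
    g: "comult H g = g \<otimes> g" "mult H g g = unit H" "?B \<subseteq> complex_vector.span {unit H, g}"
    by blast
  have "tensorands R \<subseteq> ?B"
    unfolding hopf_generated_def by blast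
  then have "R \<in> tensor_square (complex_vector.span {unit H, g})"
    using g(3) by (intro tensor_square_tensorands) blast
  from R_matrix_of_involution[OF g(1,2) this] have "R = R_of H g \<or> R = R_of H (unit H)" .
  moreover have "grouplike H g"
    using g(1,2) unit_nonzero mult_simps(5)[of g] by (auto simp: grouplike_def)
  moreover have "grouplike H (unit H)"
    using unit_nonzero by (simp add: grouplike_def comult_unit)
  ultimately show thesis
    using that g(2) mult_unit_left triangular_hopf_algebra_axioms unfolding involution_triangular_def by metis
qed

lemma triangular_rank_le_2_iff:
  "(H, R) \<in> triangular_rank_le_2 \<longleftrightarrow> (\<exists>g. R = R_of H g \<and> involution_triangular H g)"
proof
  assume "(H, R) \<in> triangular_rank_le_2"
  then have "triangular_hopf_algebra H R" "R_rank H R \<le> 2"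
    by (simp_all add: triangular_rank_le_2_def)
  then show "\<exists>g. R = R_of H g \<and> involution_triangular H g"
    by (rule rank_le_2_involution) blast
next
  assume "\<exists>g. R = R_of H g \<and> involution_triangular H g"
  then obtain g where g: "R = R_of H g" "involution_triangular H g"
    by blast
  then show "(H, R) \<in> triangular_rank_le_2"
    using R_rank_involution[OF g(2)] by (simp add: triangular_rank_le_2_def involution_triangular_def)
qed

subsection \<open>Isomorphisms\<close>

text \<open>\<open>K\<close> and \<open>K'\<close> are superalgebras in one direction of the correspondence and ordinary algebras in the
  other.\<close>

lemma hopf_iso_twist:
  fixes H :: "('a::complex_vector, 'm) hopf_scheme" and H' :: "('b::complex_vector, 'n) hopf_scheme"
    and K :: "('a, 'p) hopf_scheme" and K' :: "('b, 'q) hopf_scheme"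
  assumes tw: "twistable H g" "twistable H' g'" and f: "hopf_iso f H H'" "f g = g'"
    and K: "mult K = mult H" "unit K = unit H" "comult K = twist_comult H (Ad_grading H g) g"
      "counit K = counit H" "antipode K = twist_antipode H (Ad_grading H g) g"
    and K': "mult K' = mult H'" "unit K' = unit H'" "comult K' = twist_comult H' (Ad_grading H' g') g'"
      "counit K' = counit H'" "antipode K' = twist_antipode H' (Ad_grading H' g') g'"
  shows "hopf_iso f K K'" and "f ` Ad_grading H g i = Ad_grading H' g' i"
proof -
  interpret tw: twistable H g by fact
  interpret tw': twistable H' g' by fact
  have lin: "clinear f" and bij: "bij f" and mult: "f (mult H a b) = mult H' (f a) (f b)"
    and unit: "f (unit H) = unit H'" and comult: "comult H' (f a) = tensor_map f f (comult H a)"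
    and counit: "counit H' (f a) = counit H a" and antipode: "antipode H' (f a) = f (antipode H a)" for a b
    using f(1) by (auto simp: hopf_iso_def)
  have inj: "f x = f y \<longleftrightarrow> x = y" for x y
    using bij by (auto simp: bij_def dest: injD)
  \<comment> \<open>An isomorphism taking \<open>g\<close> to \<open>g'\<close> intertwines the two
    conjugations and so matches their eigenspaces; the twist depends on nothing more than these, the
    product and \<open>g\<close>.\<close>
  have hom: "a \<in> tw.hom i \<longleftrightarrow> f a \<in> tw'.hom i" for a i
  proof -
    have "f (mult H (mult H g a) g) = mult H' (mult H' g' (f a)) g'" "f (sign i *\<^sub>C a) = sign i *\<^sub>C f a"
      by (simp_all add: mult f(2) clinear_scale[OF lin])
    then show ?thesis
      using inj[of "mult H (mult H g a) g" "sign i *\<^sub>C a"] by (simp add: tw.hom_def tw'.hom_def)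
  qed
  show "f ` Ad_grading H g i = Ad_grading H' g' i"
  proof -
    have "b \<in> f ` tw.hom i" if "b \<in> tw'.hom i" for b
    proof -
      obtain a where "b = f a"
        using bij by (rule bij_pointE) blast
      then show ?thesis
        using that hom by blast
    qed
    then show ?thesis
      unfolding tw.Ad_grading_eq tw'.Ad_grading_eq using hom by blast
  qed
  have gpow: "f (tw.gpow i) = tw'.gpow i" for i
    by (cases i; simp add: unit f(2))
  have twist: "tw'.twist (tensor_map f f t) = tensor_map f f (tw.twist t)" for t
  proof (induction t rule: tw.hom_tensor_induct)
    case (pure a b i j)
    then have "f b \<in> tw'.hom j"
      using hom by blast
    with pure show ?case
      by (simp add: tensor_map_pure lin tw.twist_pure tw'.twist_pure mult gpow)
  qed (simp add: clinear_add[OF clinear_tensor_map[OF lin lin]] tw.twist_add tw'.twist_add)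
  have "twist_antipode H' tw'.hom g' (f a) = f (twist_antipode H tw.hom g a)" for a
  proof (induction a rule: tw.hom_induct)
    case (hom a i)
    then have "f a \<in> tw'.hom i"
      using \<open>\<And>a i. a \<in> tw.hom i \<longleftrightarrow> f a \<in> tw'.hom i\<close> by blast
    with hom show ?case
      by (simp add: tw.twist_antipode_pure tw'.twist_antipode_pure antipode mult gpow)
  qed (simp add: clinear_add[OF lin] clinear_add[OF tw.clinear_twist_antipode]
      clinear_add[OF tw'.clinear_twist_antipode])
  then show "hopf_iso f K K'"
    unfolding hopf_iso_def K K' tw.Ad_grading_eq tw'.Ad_grading_eq tw.twist_comult_eq tw'.twist_comult_eq
    using lin bij by (simp add: mult unit comult counit twist)
qed

lemma tensor_map_R_of:
  assumes "clinear f" "f (unit H) = unit H'" "f g = g'"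
  shows "tensor_map f f (R_of H g) = R_of H' g'"
  using assms by (simp add: R_of_def tensor_map_pure clinear_scale[OF clinear_tensor_map]
      clinear_add[OF clinear_tensor_map] clinear_diff[OF clinear_tensor_map])

text \<open>The Drinfeld element is built from the product and the antipode alone. This is how an
  isomorphism that respects the R-matrices is seen to respect the involutions.\<close>

lemma hopf_iso_drinfeld:
  assumes f: "hopf_iso f H H'" and H: "hopf_common H" "hopf_common H'"
  shows "drinfeld H' (tensor_map f f t) = f (drinfeld H t)"
proof -
  interpret H: hopf_common H by fact
  interpret H': hopf_common H' by fact
  have lin: "clinear f" and mult: "\<And>a b. f (mult H a b) = mult H' (f a) (f b)"
    and antipode: "\<And>a. antipode H' (f a) = f (antipode H a)"
    using f by (auto simp: hopf_iso_def)
  note simps = H.map_right_simps[OF H.antipode_linear] H'.map_right_simps[OF H'.antipode_linear]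
    H.lift_mult_simps H'.lift_mult_simps clinear_add[OF lin] clinear_add[OF clinear_tensor_map[OF lin lin]]
    tensor_map_pure[OF lin lin] clinear_add[OF clinear_tensor_flip] mult antipode
  show ?thesis
    unfolding drinfeld_def
    by (induction t rule: tensor_induct) (simp_all add: simps)
qed

lemma cocommutative_pairsD:
  assumes "(K, g) \<in> cocommutative_pairs"
  shows "twistable K g" "Ad_grading K g = grade K"
proof -
  have K: "hopf_superalgebra K" "parity_grouplike K g"
    using assms by (auto simp: cocommutative_pairs_def cocommutative_hopf_superalgebra_def)
  show "twistable K g"
    using K by (rule twistable_parity_grouplike)
  then show "Ad_grading K g = grade K"
    using twistable.Ad_grading_eq grade_parity_grouplike[OF K] by metis
qed

lemma involution_triangularD:
  assumes "involution_triangular H g"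
  shows "twistable H g" "hopf_common H"
proof -
  have H: "hopf_algebra H" "comult H g = g \<otimes> g" "mult H g g = unit H"
    using assms by (auto simp: involution_triangular_def grouplike_def triangular_hopf_algebra_def)
  show "twistable H g"
    using H by (rule twistable_grouplike)
  show "hopf_common H"
    using H(1) by (simp add: hopf_algebra_def)
qed

text \<open>From left to right, \<open>f g = g'\<close> comes from comparing Drinfeld elements. From
  right to left, twisting back restores the ordinary structures, and the formula for
  \<open>R_of\<close> carries one R-matrix to the other.\<close>

lemma triangular_isomorphic_iff:
  fixes H :: "'a::complex_vector hopf" and H' :: "'b::complex_vector hopf"
  assumes H: "involution_triangular H g" and H': "involution_triangular H' g'"
  shows "triangular_isomorphic (H, R_of H g) (H', R_of H' g') \<longleftrightarrow>
    super_pair_isomorphic (superize H g, g) (superize H' g', g')"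
proof
  assume "triangular_isomorphic (H, R_of H g) (H', R_of H' g')"
  then obtain f where f: "hopf_iso f H H'" "tensor_map f f (R_of H g) = R_of H' g'"
    by (auto simp: triangular_isomorphic_def)
  have fg: "f g = g'"
    using hopf_iso_drinfeld[OF f(1) involution_triangularD(2)[OF H] involution_triangularD(2)[OF H'], of "R_of H g"]
    by (simp add: f(2) drinfeld_R_of[OF H] drinfeld_R_of[OF H'])
  note tw = involution_triangularD(1)[OF H] involution_triangularD(1)[OF H']
  have "super_hopf_iso f (superize H g) (superize H' g')"
    unfolding super_hopf_iso_def
  proof (intro conjI allI)
    show "hopf_iso f (superize H g) (superize H' g')"
      by (rule hopf_iso_twist[OF tw f(1) fg]) simp_all
    show "f ` grade (superize H g) p = grade (superize H' g') p" for p
      using hopf_iso_twist(2)[OF tw f(1) fg, of "superize H g" "superize H' g'" p] by simp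
  qed
  then show "super_pair_isomorphic (superize H g, g) (superize H' g', g')"
    using fg by (auto simp: super_pair_isomorphic_def)
next
  assume "super_pair_isomorphic (superize H g, g) (superize H' g', g')"
  then obtain f where f: "hopf_iso f (superize H g) (superize H' g')" "f g = g'"
    by (auto simp: super_pair_isomorphic_def super_hopf_iso_def)
  have lin: "clinear f" and unit: "f (unit H) = unit H'"
    using f(1) by (auto simp: hopf_iso_def)
  note pairs = superize_cocommutative[OF H] superize_cocommutative[OF H']
  have "hopf_iso f (ordinarize (superize H g) g) (ordinarize (superize H' g') g')"
    by (rule hopf_iso_twist[OF cocommutative_pairsD(1)[OF pairs(1)] cocommutative_pairsD(1)[OF pairs(2)] f])
      (simp_all only: ordinarize_simps cocommutative_pairsD(2)[OF pairs(1)] cocommutative_pairsD(2)[OF pairs(2)])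
  then have "hopf_iso f H H'"
    by (simp only: ordinarize_superize[OF H] ordinarize_superize[OF H'])
  then show "triangular_isomorphic (H, R_of H g) (H', R_of H' g')"
    using tensor_map_R_of[OF lin unit f(2)] by (auto simp: triangular_isomorphic_def)
qed

lemma super_triangular_isomorphic_trivial:
  "super_triangular_isomorphic (with_trivial_R y) (with_trivial_R y') \<longleftrightarrow> super_pair_isomorphic y y'"
proof -
  have "tensor_map f f (unit H \<otimes> unit H) = unit K \<otimes> unit K" if "super_hopf_iso f H K"
    for f and H :: "'a super_hopf" and K :: "'b super_hopf"
    using that by (simp add: super_hopf_iso_def hopf_iso_def tensor_map_pure)
  then show ?thesis
    by (cases y; cases y')
      (auto simp: super_triangular_isomorphic_def super_pair_isomorphic_def with_trivial_R_def)
qed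

subsection \<open>The correspondence\<close>

text \<open>The image of the class of \<open>x\<close> is exactly the class of \<open>f x\<close>,
  and a map injective on \<open>A\<close> is injective on subsets of \<open>A\<close>.\<close>

lemma bij_betw_quotients:
  assumes bij: "bij_betw f A B" and r: "r \<subseteq> A \<times> A" and s: "s \<subseteq> B \<times> B"
    and iff: "\<And>x y. x \<in> A \<Longrightarrow> y \<in> A \<Longrightarrow> (x, y) \<in> r \<longleftrightarrow> (f x, f y) \<in> s"
  shows "bij_betw ((`) f) (A // r) (B // s)"
proof -
  have B: "B = f ` A"
    using bij by (simp add: bij_betw_def)
  have image: "f ` (r `` {x}) = s `` {f x}" if "x \<in> A" for x
  proof
    show "f ` (r `` {x}) \<subseteq> s `` {f x}"
      using that r iff by blast
    show "s `` {f x} \<subseteq> f ` (r `` {x})"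
    proof
      fix b
      assume b: "b \<in> s `` {f x}"
      then obtain y where "y \<in> A" "b = f y"
        using s B by blast
      then show "b \<in> f ` (r `` {x})"
        using b that iff by blast
    qed
  qed
  have sub: "X \<subseteq> A" if "X \<in> A // r" for X
    using that r unfolding quotient_def by blast
  have "inj_on ((`) f) (A // r)"
  proof (rule inj_onI)
    fix X Y
    assume "X \<in> A // r" "Y \<in> A // r" "f ` X = f ` Y"
    then show "X = Y"
      using inj_on_image_eq_iff[OF bij_betw_imp_inj_on[OF bij]] sub by blast
  qed
  moreover have "(`) f ` (A // r) = B // s"
    unfolding quotient_def B using image by (simp add: image_UN image_image)
  ultimately show ?thesis
    by (simp add: bij_betw_def)
qed

lemma to_super_rank_le_2:
  assumes "x \<in> triangular_rank_le_2"
  obtains H g where "x = (H, R_of H g)" "involution_triangular H g"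
    "to_super x = with_trivial_R (superize H g, g)"
proof -
  obtain H R where x: "x = (H, R)"
    by fastforce
  then obtain g where g: "R = R_of H g" "involution_triangular H g"
    using assms triangular_rank_le_2_iff by blast
  then show thesis
    using that x to_super_involution[OF g(2)] by (simp add: with_trivial_R_def)
qed

lemma from_super_to_super:
  assumes "x \<in> triangular_rank_le_2"
  shows "from_super (to_super x) = x"
proof -
  obtain H g where x: "x = (H, R_of H g)" "involution_triangular H g"
    "to_super x = with_trivial_R (superize H g, g)"
    using assms by (rule to_super_rank_le_2)
  then show ?thesis
    by (simp add: from_super_trivial[OF superize_cocommutative] ordinarize_superize)
qed

lemma
  assumes "z \<in> with_trivial_R ` cocommutative_pairs"
  shows from_super_rank_le_2: "from_super z \<in> triangular_rank_le_2"
    and to_super_from_super: "to_super (from_super z) = z"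
proof -
  obtain K g where z: "z = with_trivial_R (K, g)" and pair: "(K, g) \<in> cocommutative_pairs"
    using assms by auto
  show "from_super z \<in> triangular_rank_le_2"
    using ordinarize_triangular[OF pair] unfolding z from_super_trivial[OF pair] triangular_rank_le_2_iff by blast
  show "to_super (from_super z) = z"
    unfolding z from_super_trivial[OF pair] to_super_involution[OF ordinarize_triangular[OF pair]]
    by (simp add: superize_ordinarize[OF pair] with_trivial_R_def)
qed

lemma to_super_image:
  "to_super ` (triangular_rank_le_2 :: ('a::complex_vector hopf \<times> ('a, 'a) tensor) set) =
    with_trivial_R ` cocommutative_pairs"
proof (intro subset_antisym image_subsetI)
  show "to_super x \<in> with_trivial_R ` cocommutative_pairs"
    if "x \<in> triangular_rank_le_2" for x :: "'a hopf \<times> ('a, 'a) tensor"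
    using that
  proof (rule to_super_rank_le_2)
    fix H :: "'a hopf" and g
    assume "involution_triangular H g" "to_super x = with_trivial_R (superize H g, g)"
    then show ?thesis
      using superize_cocommutative by (intro image_eqI)
  qed
  show "with_trivial_R y \<in> to_super ` triangular_rank_le_2"
    if "y \<in> cocommutative_pairs" for y :: "'a super_hopf \<times> 'a"
    using to_super_from_super[OF imageI[OF that], symmetric] from_super_rank_le_2[OF imageI[OF that]]
    by (rule image_eqI)
qed

lemma triangular_isomorphic_to_super:
  assumes "x \<in> triangular_rank_le_2" "x' \<in> triangular_rank_le_2"
  shows "triangular_isomorphic x x' \<longleftrightarrow> super_triangular_isomorphic (to_super x) (to_super x')"
proof -
  obtain H g where x: "x = (H, R_of H g)" "involution_triangular H g"
    "to_super x = with_trivial_R (superize H g, g)"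
    using assms(1) by (rule to_super_rank_le_2)
  obtain H' g' where x': "x' = (H', R_of H' g')" "involution_triangular H' g'"
    "to_super x' = with_trivial_R (superize H' g', g')"
    using assms(2) by (rule to_super_rank_le_2)
  show ?thesis
    unfolding x(3) x'(3) super_triangular_isomorphic_trivial
    unfolding x(1) x'(1) by (rule triangular_isomorphic_iff[OF x(2) x'(2)])
qed

lemma rank_le_2_involutive:
  "(triangular_rank_le_2 :: ('a::complex_vector hopf \<times> ('a, 'a) tensor) set) \<subseteq> triangular_involutive"
proof
  fix x :: "'a hopf \<times> ('a, 'a) tensor"
  assume "x \<in> triangular_rank_le_2"
  then obtain H g where x: "x = (H, R_of H g)" "involution_triangular H g"
    by (rule to_super_rank_le_2)
  then show "x \<in> triangular_involutive"
    using drinfeld_R_of[OF x(2)] by (simp add: triangular_involutive_def involution_triangular_def)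
qed

lemma bij_betw_isomorphism_classes:
  "bij_betw (\<lambda>X. with_trivial_R -` (to_super ` X))
    ((triangular_rank_le_2 :: ('a::complex_vector hopf \<times> ('a, 'a) tensor) set) // triangular_iso_rel)
    (cocommutative_pairs // super_pair_iso_rel)"
proof -
  let ?A = "triangular_rank_le_2 :: ('a hopf \<times> ('a, 'a) tensor) set"
  let ?B = "cocommutative_pairs :: ('a super_hopf \<times> 'a) set"
  \<comment> \<open>\<open>to_super\<close> with its R-matrix dropped, which is trivial on this
    domain. Since \<open>with_trivial_R\<close> is injective, taking preimages under it does the
    same to whole classes.\<close>
  define \<phi> where "\<phi> x = (fst (fst (to_super x)), snd (to_super x))" for x :: "'a hopf \<times> ('a, 'a) tensor"
  have \<phi>_trivial: "\<phi> x = y \<longleftrightarrow> to_super x = with_trivial_R y" if "x \<in> ?A" for x y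
    using that by (rule to_super_rank_le_2) (cases y; auto simp: \<phi>_def with_trivial_R_def)
  have \<phi>: "to_super x = with_trivial_R (\<phi> x)" if "x \<in> ?A" for x
    using \<phi>_trivial[OF that] by blast
  have "inj_on \<phi> ?A"
  proof (rule inj_onI)
    fix x y
    assume "x \<in> ?A" "y \<in> ?A" "\<phi> x = \<phi> y"
    then have "from_super (to_super x) = from_super (to_super y)"
      by (simp add: \<phi>)
    then show "x = y"
      using \<open>x \<in> ?A\<close> \<open>y \<in> ?A\<close> by (simp add: from_super_to_super)
  qed
  moreover have "\<phi> ` ?A = ?B"
  proof (intro subset_antisym image_subsetI subsetI)
    show "\<phi> x \<in> ?B" if "x \<in> ?A" for x
      using that by (rule to_super_rank_le_2) (simp add: \<phi>_def with_trivial_R_def superize_cocommutative)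
    show "y \<in> \<phi> ` ?A" if y: "y \<in> ?B" for y
    proof (rule image_eqI)
      show "from_super (with_trivial_R y) \<in> ?A"
        using imageI[OF y] by (rule from_super_rank_le_2)
      from \<phi>_trivial[OF this, of y] show "y = \<phi> (from_super (with_trivial_R y))"
        using to_super_from_super[OF imageI[OF y]] by simp
    qed
  qed
  ultimately have bij: "bij_betw \<phi> ?A ?B"
    by (simp add: bij_betw_def)
  have "bij_betw ((`) \<phi>) (?A // triangular_iso_rel) (?B // super_pair_iso_rel)"
  proof (rule bij_betw_quotients[OF bij])
    show "triangular_iso_rel \<subseteq> ?A \<times> ?A" "super_pair_iso_rel \<subseteq> ?B \<times> ?B"
      by (auto simp: triangular_iso_rel_def super_pair_iso_rel_def)
    fix x y
    assume xy: "x \<in> ?A" "y \<in> ?A"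
    then have "\<phi> x \<in> ?B" "\<phi> y \<in> ?B"
      using \<open>\<phi> ` ?A = ?B\<close> by blast+
    then show "(x, y) \<in> triangular_iso_rel \<longleftrightarrow> (\<phi> x, \<phi> y) \<in> super_pair_iso_rel"
      using xy triangular_isomorphic_to_super[OF xy]
      by (simp add: triangular_iso_rel_def super_pair_iso_rel_def super_triangular_isomorphic_trivial \<phi>)
  qed
  moreover have "with_trivial_R -` (to_super ` X) = \<phi> ` X" if "X \<in> ?A // triangular_iso_rel" for X
  proof -
    have "X \<subseteq> ?A"
      using that by (auto simp: quotient_def triangular_iso_rel_def)
    show ?thesis
    proof (intro subset_antisym subsetI)
      fix y
      assume "y \<in> with_trivial_R -` (to_super ` X)"
      then obtain x where "x \<in> X" "to_super x = with_trivial_R y"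
        by (auto simp: vimage_def image_iff)
      then show "y \<in> \<phi> ` X"
        using \<phi>_trivial[of x y] \<open>X \<subseteq> ?A\<close> by blast
    next
      fix y
      assume "y \<in> \<phi> ` X"
      then obtain x where "x \<in> X" "y = \<phi> x"
        by blast
      then have "to_super x = with_trivial_R y"
        using \<phi>[of x] \<open>X \<subseteq> ?A\<close> by blast
      then show "y \<in> with_trivial_R -` (to_super ` X)"
        using imageI[OF \<open>x \<in> X\<close>, of to_super] by simp
    qed
  qed
  ultimately show ?thesis
    using bij_betw_cong[of "?A // triangular_iso_rel" "\<lambda>X. with_trivial_R -` (to_super ` X)" "(`) \<phi>"] by simp
qed

theorem corollary7p1p3p3:
  shows
    "(triangular_rank_le_2 :: ('a::complex_vector hopf \<times> ('a, 'a) tensor) set) \<subseteq> triangular_involutive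
     \<and> with_trivial_R ` (cocommutative_pairs :: ('a super_hopf \<times> 'a) set) \<subseteq> super_triangular_pairs
     \<and> to_super ` (triangular_rank_le_2 :: ('a hopf \<times> ('a, 'a) tensor) set) = with_trivial_R ` cocommutative_pairs
     \<and> (\<forall>x \<in> (triangular_rank_le_2 :: ('a hopf \<times> ('a, 'a) tensor) set). from_super (to_super x) = x)
     \<and> (\<forall>y \<in> with_trivial_R ` (cocommutative_pairs :: ('a super_hopf \<times> 'a) set). to_super (from_super y) = y)
     \<and> (\<forall>x \<in> (triangular_rank_le_2 :: ('a hopf \<times> ('a, 'a) tensor) set).
         \<forall>x' \<in> (triangular_rank_le_2 :: ('b::complex_vector hopf \<times> ('b, 'b) tensor) set).
           triangular_isomorphic x x' \<longleftrightarrow> super_triangular_isomorphic (to_super x) (to_super x'))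
     \<and> bij_betw (\<lambda>X. with_trivial_R -` (to_super ` X))
         ((triangular_rank_le_2 :: ('a hopf \<times> ('a, 'a) tensor) set) // triangular_iso_rel)
         (cocommutative_pairs // super_pair_iso_rel)"
  by (intro conjI ballI rank_le_2_involutive with_trivial_R_subset to_super_image from_super_to_super
      to_super_from_super triangular_isomorphic_to_super bij_betw_isomorphism_classes)

end
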